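(* Let $M\ge0$ and let $a:\mathbb{R}\to\mathbb{R}^d$, together with a closed interval $I$, satisfy the genuine nonlinearity condition (GN). There are constants $\gamma>0$ and $C$ such that for any non-negative entropy subsolution $u$ of $\operatorname{div}[A(u)]=0$ in $B_2\subset\mathbb{R}^d$ with image contained in $I$ and $\|u\|_{L^\infty(B_2)}\le M$, the following estimate holds: $$\|u\|_{L^\infty(B_1)}\le C\,\|u\|_{L^1(B_2)}^{\gamma}.$$ The constant $\gamma$ depends on $\alpha$ and $d$, and $C$ depends on the constants involved in (GN) and on $M$.
   Context: $A:\mathbb{R}\to\mathbb{R}^d$, $a=A'$, and $B_r$ is the ball of radius $r$ centered at the origin of $\mathbb{R}^d$. The equation is $\operatorname{div}[A(u)]=a(u)\cdot\nabla u=0$. Entropy subsolution: $u\in L^\infty(\Omega)$ is an entropy subsolution in an open set $\Omega$ if for every convex and non-decreasing $\eta:\mathbb{R}\to\mathbb{R}$, with $q:\mathbb{R}\to\mathbb{R}^d$ such that $q_i'(v)=\eta'(v)a_i(v)$ for $i=1,\dots,d$, and every smooth compactly supported $\varphi\ge0$ in $\Omega$, one has $\int_\Omega q(u)\cdot\nabla\varphi\,dx\ge0$. (GN): $a$ is $C^1$ and there exist $\alpha\in(0,1]$ and $C_0>0$ such that for every $\xi\in\mathbb{R}^d$ with $|\xi|=1$ and every $\delta>0$, $|\{v\in I:|a(v)\cdot\xi|<\delta\}|\le C_0\delta^\alpha$, where $I$ is a closed interval containing the image of $u$. The constants involved in (GN) are $\alpha$, $C_0$ and $\|a\|_{C^1(I)}$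 (the dimension $d$ being fixed). *)

theory Defs
  imports "HOL-Probability.Essential_Supremum"
begin

definition Linf_norm :: "'a::euclidean_space set \<Rightarrow> ('a \<Rightarrow> real) \<Rightarrow> ereal" where
  "Linf_norm \<Omega> u = esssup (lebesgue_on \<Omega>) (\<lambda>x. ereal \<bar>u x\<bar>)"

definition Linf :: "'a::euclidean_space set \<Rightarrow> ('a \<Rightarrow> real) set" where
  "Linf \<Omega> = {u. u \<in> borel_measurable (lebesgue_on \<Omega>) \<and> Linf_norm \<Omega> u < \<infinity>}"

text \<open>The Bochner integral is \<open>0\<close> for non-integrable functions; this is the \<open>L\<^sup>1\<close> norm
  only for integrable \<open>u\<close>, in particular for bounded measurable \<open>u\<close> on a bounded set.\<close>

definition L1_norm :: "'a::euclidean_space set \<Rightarrow> ('a \<Rightarrow> real) \<Rightarrow> real" where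
  "L1_norm \<Omega> u = (LINT x|lebesgue_on \<Omega>. \<bar>u x\<bar>)"

text \<open>The value \<open>\<infinity>\<close> is attained when \<open>a\<close> or its derivative is unbounded on \<open>I\<close>.\<close>

definition C1_norm :: "(real \<Rightarrow> 'a::real_normed_vector) \<Rightarrow> real set \<Rightarrow> ereal" where
  "C1_norm a I = (SUP v\<in>I. ereal (norm (a v))) +
                 (SUP v\<in>I. ereal (norm (vector_derivative a (at v))))"

definition genuinely_nonlinear ::
    "(real \<Rightarrow> 'a::euclidean_space) \<Rightarrow> real set \<Rightarrow> real \<Rightarrow> real \<Rightarrow> bool" where
  "genuinely_nonlinear a I \<alpha> C\<^sub>0 \<longleftrightarrow>
     a C1_differentiable_on UNIV \<and> 0 < \<alpha> \<and> \<alpha> \<le> 1 \<and> 0 < C\<^sub>0 \<and>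
     (\<forall>\<xi> \<delta>. norm \<xi> = 1 \<and> 0 < \<delta> \<longrightarrow>
        emeasure lborel {v \<in> I. \<bar>a v \<bullet> \<xi>\<bar> < \<delta>} \<le> ennreal (C\<^sub>0 * \<delta> powr \<alpha>))"

primrec C_k :: "nat \<Rightarrow> (real^'n \<Rightarrow> real) \<Rightarrow> bool" where
  "C_k 0 f \<longleftrightarrow> continuous_on UNIV f"
| "C_k (Suc k) f \<longleftrightarrow>
     (\<exists>g::real^'n \<Rightarrow> real^'n. (\<forall>x. GDERIV f x :> g x) \<and> (\<forall>i. C_k k (\<lambda>x. g x $ i)))"

definition test_function :: "(real^'n) set \<Rightarrow> (real^'n \<Rightarrow> real) \<Rightarrow> bool" where
  "test_function \<Omega> \<phi> \<longleftrightarrow>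
     (\<forall>k. C_k k \<phi>) \<and> compact (closure {x. \<phi> x \<noteq> 0}) \<and> closure {x. \<phi> x \<noteq> 0} \<subseteq> \<Omega>"

text \<open>A convex \<open>\<eta>\<close> need not be differentiable everywhere, but its points of
  non-differentiability form a countable set.  Hence \<open>q' = \<eta>' a\<close> is required exactly at
  the points where \<open>\<eta>'\<close> exists; since \<open>q\<close> is continuous, this determines \<open>q\<close> up to an
  additive constant, as the primitive of \<open>\<eta>' a\<close>.\<close>

definition entropy_flux ::
    "(real \<Rightarrow> real^'n) \<Rightarrow> (real \<Rightarrow> real) \<Rightarrow> (real \<Rightarrow> real^'n) \<Rightarrow> bool" where
  "entropy_flux a \<eta> q \<longleftrightarrow> continuous_on UNIV q \<and>
     (\<forall>v. \<eta> differentiable (at v) \<longrightarrow>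
        (\<forall>i. ((\<lambda>w. q w $ i) has_real_derivative deriv \<eta> v * a v $ i) (at v)))"

definition entropy_subsolution ::
    "(real \<Rightarrow> real^'n) \<Rightarrow> (real^'n) set \<Rightarrow> (real^'n \<Rightarrow> real) \<Rightarrow> bool" where
  "entropy_subsolution a \<Omega> u \<longleftrightarrow> open \<Omega> \<and> u \<in> Linf \<Omega> \<and>
     (\<forall>\<eta> q \<phi> D\<phi>. convex_on UNIV \<eta> \<and> mono \<eta> \<and> entropy_flux a \<eta> q \<and>
        test_function \<Omega> \<phi> \<and> (\<forall>x. 0 \<le> \<phi> x) \<and> (\<forall>x. GDERIV \<phi> x :> D\<phi> x) \<longrightarrow>
        0 \<le> (LINT x|lebesgue_on \<Omega>. q (u x) \<bullet> D\<phi> x))"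

end

theory Submission
  imports Defs "HOL-Computational_Algebra.Polynomial" "HOL-Probability.Probability"
begin

text \<open>
  Testing the inequality with the entropies \<open>(v - \<kappa>)\<^sub>+\<close> and using finite differences in \<open>\<kappa>\<close> shows that
  the kinetic function \<open>\<chi>(x, v) = 1\<^bsub>v < u(x)\<^esub>\<close>, paired with a function mollified at scale \<open>\<sigma>\<close>, changes
  little when it is translated by \<open>s a(v)\<close> and \<open>s\<close> is small compared with \<open>\<sigma>\<close>; the loss is controlled by
  the mass of \<open>u\<close> above the level. Averaging over \<open>v\<close> and \<open>s\<close> replaces the test function by an average
  over random translations. By Cauchy--Schwarz the average may be iterated \<open>2 ^ d\<close> times, and after so
  many steps genuine nonlinearity makes the random directions span the space with high probability, so
  that the iterated average is smoothing in all directions.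

  Writing a cutoff as a sum of dyadic differences of its mollifications and adding up the resulting
  decay yields a superlinear inequality between the measures of the superlevel sets of \<open>u\<close> at two
  levels and in two balls. De Giorgi's iteration then makes \<open>{u \<ge> \<kappa>}\<close> null in the unit ball as soon
  as \<open>\<kappa>\<close> exceeds a multiple of a power of the mass of \<open>u\<close>.
\<close>

subsection \<open>Smooth functions\<close>

text \<open>Two opposing demands fix the scales. Averaging translates by \<open>s a(v)\<close>, with
  |s| at most \<open>S\<close>, acts on differences of mollifications at scale \<sigma> only if
  \<open>S\<close> is much larger than \<sigma>. The price, in the entropy inequality, is
  \<open>S\<close> times the Lipschitz constant in \<open>v\<close> of the test function
  \<open>w (x + s a(v))\<close>. Since its derivative in \<open>v\<close> carries a factor
  \<open>s\<close>, the price is of order S + S^2/\<sigma>. The Lipschitz bound on \<open>a\<close>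
  thus leaves the window \<sigma> << S << sqrt \<sigma>. Neither bound is better than linear in the
  measure U of the superlevel set. The superlinear gain comes from the coarsest mollification: it is
  bounded pointwise by U over a power of \<theta>, so its pairing is quadratic in U, whereas the
  finer differences sum to U times a positive power of \<theta>. Taking \<theta> to be a small power
  of U gives both terms an exponent above 1. The dissipation measure of the entropy inequality is
  never constructed; its sign and mass enter only through non-negative test functions dominated by a
  cutoff \<zeta>.\<close>

lemma GDERIV_eqI: "GDERIV f x :> D \<Longrightarrow> D = E \<Longrightarrow> GDERIV f x :> E"
  by simp

lemma GDERIV_unique:
  fixes f :: "'a::real_inner \<Rightarrow> real"
  assumes "GDERIV f x :> D" "GDERIV f x :> E"
  shows "D = E"
proof -
  have "(\<lambda>h. inner h D) = (\<lambda>h. inner h E)"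
    using has_derivative_unique[OF assms[unfolded gderiv_def]] .
  then have "inner (D - E) D = inner (D - E) E" by (rule fun_cong)
  then have "inner (D - E) (D - E) = 0" by (simp add: inner_diff_right)
  then show ?thesis by simp
qed

lemma C_k_SucD: "C_k (Suc k) f \<Longrightarrow> C_k k f"
proof (induction k arbitrary: f)
  case 0
  then show ?case
    unfolding C_k.simps gderiv_def by (metis continuous_at_imp_continuous_on has_derivative_continuous)
next
  case (Suc k)
  then obtain g where g: "\<forall>x. GDERIV f x :> g x" "\<forall>i. C_k (Suc k) (\<lambda>x. g x $ i)"
    by (auto simp only: C_k.simps(2)[of "Suc k"])
  then have "\<forall>i. C_k k (\<lambda>x. g x $ i)" using Suc.IH by blast
  with g(1) show ?case by auto
qed

lemma C_k_const: "C_k k (\<lambda>x. c)"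
proof (induction k arbitrary: c)
  case (Suc k)
  then show ?case
    by (intro C_k.simps(2)[THEN iffD2] exI[of _ "\<lambda>_. 0"]) (simp add: GDERIV_const)
qed auto

lemma C_k_add: "C_k k f \<Longrightarrow> C_k k g \<Longrightarrow> C_k k (\<lambda>x. f x + g x)"
proof (induction k arbitrary: f g)
  case (Suc k)
  then obtain F G where
    "\<forall>x. GDERIV f x :> F x" "\<forall>i. C_k k (\<lambda>x. F x $ i)"
    "\<forall>x. GDERIV g x :> G x" "\<forall>i. C_k k (\<lambda>x. G x $ i)" by auto
  then show ?case
    by (intro C_k.simps(2)[THEN iffD2] exI[of _ "\<lambda>x. F x + G x"])
      (simp add: GDERIV_add Suc.IH)
qed (auto intro: continuous_intros)

lemma C_k_mult: "C_k k f \<Longrightarrow> C_k k g \<Longrightarrow> C_k k (\<lambda>x. f x * g x)"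
proof (induction k arbitrary: f g)
  case (Suc k)
  then obtain F G where *:
    "\<forall>x. GDERIV f x :> F x" "\<forall>i. C_k k (\<lambda>x. F x $ i)"
    "\<forall>x. GDERIV g x :> G x" "\<forall>i. C_k k (\<lambda>x. G x $ i)" by auto
  have "C_k k f" "C_k k g" using Suc.prems C_k_SucD by blast+
  with * show ?case
    by (intro C_k.simps(2)[THEN iffD2] exI[of _ "\<lambda>x. f x *\<^sub>R G x + g x *\<^sub>R F x"])
      (simp add: GDERIV_mult C_k_add Suc.IH)
qed (auto intro: continuous_intros)

lemma C_k_cmult: "C_k k f \<Longrightarrow> C_k k (\<lambda>x. c * f x)"
  by (rule C_k_mult[OF C_k_const])

lemma C_k_nth: "C_k k (\<lambda>x::real^'n. x $ i)"
proof (cases k)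
  case 0
  then show ?thesis by (auto intro!: continuous_intros)
next
  case (Suc m)
  have "GDERIV (\<lambda>x. x $ i) x :> axis i 1" for x :: "real^'n"
    unfolding gderiv_def
    by (rule has_derivative_eq_rhs[OF bounded_linear.has_derivative[OF bounded_linear_vec_nth has_derivative_ident]])
       (auto simp: inner_axis)
  then show ?thesis unfolding Suc
    by (intro C_k.simps(2)[THEN iffD2] exI[of _ "\<lambda>_. axis i 1"]) (simp add: C_k_const)
qed

lemma GDERIV_affine:
  assumes "GDERIV f (c *\<^sub>R x + b) :> D"
  shows "GDERIV (\<lambda>x. f (c *\<^sub>R x + b)) x :> c *\<^sub>R D"
proof -
  have "((\<lambda>x. c *\<^sub>R x + b) has_derivative (\<lambda>h. c *\<^sub>R h)) (at x)"
    by (auto intro!: derivative_eq_intros)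
  from diff_chain_at[OF this assms[unfolded gderiv_def]] show ?thesis
    unfolding gderiv_def by (simp add: o_def)
qed

lemma C_k_affine: "C_k k f \<Longrightarrow> C_k k (\<lambda>x. f (c *\<^sub>R x + b))"
proof (induction k arbitrary: f)
  case 0
  then show ?case
    by (auto intro!: continuous_on_compose2[of UNIV f] continuous_intros)
next
  case (Suc k)
  then obtain F where *:
    "\<forall>x. GDERIV f x :> F x" "\<forall>i. C_k k (\<lambda>x. F x $ i)" by auto
  then show ?case
    by (intro C_k.simps(2)[THEN iffD2] exI[of _ "\<lambda>x. c *\<^sub>R F (c *\<^sub>R x + b)"])
      (simp add: GDERIV_affine C_k_cmult Suc.IH[of "\<lambda>x. F x $ i" for i])
qed

text \<open>\<open>C_k\<close> provides a gradient field separately for every order; uniqueness of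
  gradients identifies these fields, so that one of them serves all orders.\<close>

lemma smooth_gradient:
  fixes f :: "real^'n \<Rightarrow> real"
  assumes "\<And>k. C_k k f"
  obtains F where "\<And>x. GDERIV f x :> F x" "\<And>k i. C_k k (\<lambda>x. F x $ i)"
proof -
  from assms[of "Suc 0"] obtain F where F: "\<forall>x. GDERIV f x :> F x" by auto
  have "C_k k (\<lambda>x. F x $ i)" for k i
  proof -
    from assms[of "Suc k"] obtain G where G: "\<forall>x. GDERIV f x :> G x" "\<forall>i. C_k k (\<lambda>x. G x $ i)" by auto
    have "F = G" using GDERIV_unique F G(1) by blast
    with G show ?thesis by auto
  qed
  with F that show ?thesis by blast
qed

lemma continuous_on_smooth:
  fixes F :: "real^'n \<Rightarrow> real^'n"
  assumes "\<And>k i. C_k k (\<lambda>x. F x $ i)"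
  shows "continuous_on UNIV F"
proof -
  have "continuous_on UNIV (\<lambda>x. \<chi> i. F x $ i)"
    using assms[of 0] by (intro continuous_on_vec_lambda) simp
  then show ?thesis by simp
qed

subsection \<open>A smooth bump function\<close>

text \<open>The polynomial factor makes the family closed under differentiation, so that smoothness
  across \<open>0\<close> follows for all members by one induction; \<open>p = 1\<close> is the
  usual flat function.\<close>

definition exp_flat :: "real poly \<Rightarrow> real \<Rightarrow> real" where
  "exp_flat p t = (if 0 < t then poly p (1/t) * exp (- (1/t)) else 0)"

lemma tendsto_poly_times_exp_neg: "((\<lambda>x. poly p x * exp (- x)) \<longlongrightarrow> (0::real)) at_top"
proof -
  have "((\<lambda>x. \<Sum>i\<le>degree p. coeff p i * (x ^ i / exp x)) \<longlongrightarrow> (\<Sum>i\<le>degree p. coeff p i * 0)) at_top"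
    by (intro tendsto_intros tendsto_power_div_exp_0)
  then show ?thesis
    by (simp add: poly_altdef exp_minus sum_distrib_right divide_inverse mult.assoc)
qed

text \<open>Dividing by \<open>t\<close> merely raises the degree of the polynomial in
  \<open>1/t\<close>, so the difference quotient at \<open>0\<close> is again a polynomial times a
  decaying exponential.\<close>

lemma exp_flat_tendsto_0: "((\<lambda>t. exp_flat p t / t) \<longlongrightarrow> 0) (at 0)"
proof -
  have "((\<lambda>t. exp_flat p t / t) \<longlongrightarrow> 0) (at_right 0)"
  proof -
    have "((\<lambda>t. poly (monom 1 1 * p) (inverse t) * exp (- inverse t)) \<longlongrightarrow> (0::real)) (at_right 0)"
      by (rule filterlim_compose[OF tendsto_poly_times_exp_neg filterlim_inverse_at_top_right])
    then show ?thesis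
      by (rule Lim_transform_eventually)
        (auto simp: eventually_at_filter exp_flat_def poly_monom divide_inverse)
  qed
  moreover have "((\<lambda>t. exp_flat p t / t) \<longlongrightarrow> 0) (at_left 0)"
    by (rule Lim_transform_eventually[OF tendsto_const])
      (auto simp: eventually_at_filter exp_flat_def)
  ultimately show ?thesis by (simp add: filterlim_split_at)
qed

lemma exp_flat_has_derivative:
  "(exp_flat p has_real_derivative exp_flat (monom 1 2 * (p - pderiv p)) t) (at t)"
proof (cases t "0::real" rule: linorder_cases)
  case less
  have "((\<lambda>_. 0) has_real_derivative 0) (at t)" by simp
  then have "(exp_flat p has_real_derivative 0) (at t)"
    by (rule has_field_derivative_transform_within[where d = "-t"])
      (use less in \<open>auto simp: exp_flat_def dist_real_def\<close>)
  with less show ?thesis by (simp add: exp_flat_def)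
next
  case equal
  then show ?thesis
    using exp_flat_tendsto_0[of p] by (simp add: has_field_derivative_iff exp_flat_def)
next
  case greater
  have "((\<lambda>t. poly p (1/t) * exp (- (1/t))) has_real_derivative
      exp_flat (monom 1 2 * (p - pderiv p)) t) (at t)"
    using greater
    by (auto intro!: derivative_eq_intros simp: exp_flat_def poly_monom power2_eq_square field_simps)
  then show ?thesis
    by (rule has_field_derivative_transform_within[where d = t])
      (use greater in \<open>auto simp: exp_flat_def dist_real_def\<close>)
qed

lemma C_k_exp_flat: "C_k k (\<lambda>x. exp_flat p (1 - x \<bullet> x))"
proof (induction k arbitrary: p)
  case 0
  have "continuous_on UNIV (exp_flat p)"
    by (intro DERIV_continuous_on[OF DERIV_subset[OF exp_flat_has_derivative]]) auto
  then show ?case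
    by (auto intro!: continuous_on_compose2[of UNIV "exp_flat p"] continuous_intros)
next
  case (Suc k)
  let ?g = "\<lambda>x::real^'a. exp_flat (monom 1 2 * (p - pderiv p)) (1 - x \<bullet> x) *\<^sub>R ((-2) *\<^sub>R x)"
  have "GDERIV (\<lambda>x. exp_flat p (1 - x \<bullet> x)) x :> ?g x" for x :: "real^'a"
  proof -
    have "((\<lambda>x. 1 - x \<bullet> x) has_derivative (\<lambda>h. h \<bullet> ((-2) *\<^sub>R x))) (at x)"
      by (auto intro!: derivative_eq_intros simp: inner_commute)
    from diff_chain_at[OF this exp_flat_has_derivative[unfolded has_field_derivative_def]]
    show ?thesis unfolding gderiv_def by (simp add: o_def mult.assoc)
  qed
  moreover have "C_k k (\<lambda>x. ?g x $ i)" for i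
    unfolding vector_scaleR_component real_scaleR_def
    by (intro C_k_mult C_k_const C_k_nth Suc.IH)
  ultimately show ?case
    by (intro C_k.simps(2)[THEN iffD2] exI[of _ ?g]) blast
qed

subsection \<open>Mollification\<close>

lemma integrable_bounded_support:
  fixes f :: "'a::euclidean_space \<Rightarrow> 'b::{banach,second_countable_topology}"
  assumes f: "f \<in> borel_measurable borel"
    and b: "\<And>x. norm (f x) \<le> C" and s: "\<And>x. R < norm x \<Longrightarrow> f x = 0"
  shows "integrable lborel f"
proof (rule Bochner_Integration.integrable_bound)
  show "integrable lborel (\<lambda>x. C * indicator (cball 0 R) x :: real)"
    by (intro integrable_mult_right integrable_real_indicator)
      (use emeasure_lborel_cball_finite[of 0 R] in \<open>auto simp: top.not_eq_extremum\<close>)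
  show "AE x in lborel. norm (f x) \<le> norm (C * indicator (cball 0 R) x :: real)"
    using b s by (intro AE_I2) (auto simp: indicator_def intro: order_trans[OF _ abs_ge_self])
qed (use f in simp)

lemma integrable_mult_bounded:
  fixes h :: "'a \<Rightarrow> real" and f :: "'a \<Rightarrow> 'b::{banach,second_countable_topology}"
  assumes h: "integrable M h" and f: "f \<in> borel_measurable M" and b: "\<And>x. norm (f x) \<le> C"
  shows "integrable M (\<lambda>x. h x *\<^sub>R f x)"
proof (rule Bochner_Integration.integrable_bound)
  show "integrable M (\<lambda>x. C * h x)" using h by simp
  have "0 \<le> C" using order_trans[OF norm_ge_zero b] .
  then show "AE x in M. norm (h x *\<^sub>R f x) \<le> norm (C * h x)"
    using b by (auto simp: abs_mult mult.commute[of C] intro!: mult_left_mono)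
qed (use assms in measurable)

lemma integral_affine:
  fixes f :: "'a::euclidean_space \<Rightarrow> 'b::{banach,second_countable_topology}"
  assumes [measurable]: "f \<in> borel_measurable borel" and c: "c \<noteq> 0"
  shows "(LINT x|lborel. f x) = \<bar>c\<bar> ^ DIM('a) *\<^sub>R (LINT x|lborel. f (t + c *\<^sub>R x))"
  by (subst lborel_affine[OF c, of t])
    (simp add: integral_density integral_distr del: integral_scaleR_right
       add: integral_scaleR_right[symmetric])

lemma continuous_bounded_support_uniformly:
  fixes f :: "'a::euclidean_space \<Rightarrow> 'b::real_normed_vector"
  assumes "continuous_on UNIV f" and s: "\<And>x. R < norm x \<Longrightarrow> f x = 0" and "0 < e"
  obtains d where "0 < d" "\<And>x y. dist x y < d \<Longrightarrow> dist (f x) (f y) < e"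
proof -
  have "uniformly_continuous_on (cball 0 (R + 1)) f"
    by (intro compact_uniformly_continuous continuous_on_subset[OF assms(1)]) auto
  then obtain d where d: "d > 0" "\<And>x y. x \<in> cball 0 (R+1) \<Longrightarrow> y \<in> cball 0 (R+1) \<Longrightarrow> dist y x < d \<Longrightarrow> dist (f y) (f x) < e"
    using \<open>0 < e\<close> unfolding uniformly_continuous_on_def by metis
  have "dist (f x) (f y) < e" if "dist x y < min d 1" for x y
  proof (cases "x \<in> cball 0 (R+1) \<and> y \<in> cball 0 (R+1)")
    case True
    with d(2)[of y x] that show ?thesis by auto
  next
    case False
    have "norm x \<le> norm y + dist x y" "norm y \<le> norm x + dist x y"
      by (auto simp: dist_norm norm_triangle_sub norm_minus_commute add.commute)
        (metis norm_minus_commute norm_triangle_sub)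
    with False that have "R < norm x" "R < norm y" by auto
    then show ?thesis using s \<open>0 < e\<close> by auto
  qed
  with \<open>d > 0\<close> that[of "min d 1"] show ?thesis by auto
qed

lemma continuous_bounded_support_bounded:
  fixes f :: "'a::euclidean_space \<Rightarrow> 'b::real_normed_vector"
  assumes "continuous_on UNIV f" and s: "\<And>x. R < norm x \<Longrightarrow> f x = 0"
  obtains C where "0 < C" "\<And>x. norm (f x) \<le> C"
proof -
  have "compact (f ` cball 0 R)"
    by (intro compact_continuous_image continuous_on_subset[OF assms(1)]) auto
  then obtain C where "0 < C" "\<forall>y\<in>f ` cball 0 R. norm y \<le> C"
    using compact_imp_bounded bounded_pos by metis
  with s that[of C] show ?thesis
    by (metis image_eqI mem_cball_0 norm_zero not_le order_less_imp_le)
qed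

lemma GDERIV_zero_outside:
  fixes f :: "'a::euclidean_space \<Rightarrow> real"
  assumes "\<And>x. GDERIV f x :> F x" "\<And>x. R < norm x \<Longrightarrow> f x = 0" "R < norm x"
  shows "F x = 0"
proof -
  have "open (- cball 0 R :: 'a set)" by auto
  have "((\<lambda>_. 0) has_derivative (\<lambda>h. h \<bullet> 0)) (at x)" by simp
  then have "GDERIV f x :> 0" unfolding gderiv_def
    by (rule has_derivative_transform_within_open[OF _ \<open>open (- cball 0 R)\<close>]) (use assms in auto)
  with assms(1) show ?thesis using GDERIV_unique by blast
qed

text \<open>Uniform continuity of \<open>G\<close> makes the first-order error small uniformly in
  the base point \<open>p\<close>. This permits differentiation under integrals whose other factor
  has no regularity.\<close>

lemma GDERIV_uniform_linearization:
  fixes \<rho> :: "'a::euclidean_space \<Rightarrow> real"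
  assumes \<rho>: "\<And>x. GDERIV \<rho> x :> G x" and G: "continuous_on UNIV G"
    and s: "\<And>x. R < norm x \<Longrightarrow> \<rho> x = 0" and "0 < e"
  obtains d where "0 < d" "\<And>p w. norm w < d \<Longrightarrow> \<bar>\<rho> (p + w) - \<rho> p - w \<bullet> G p\<bar> \<le> norm w * e"
proof -
  have sG: "R < norm x \<Longrightarrow> G x = 0" for x by (rule GDERIV_zero_outside[OF \<rho> s])
  obtain d where d: "0 < d" "\<And>x y. dist x y < d \<Longrightarrow> dist (G x) (G y) < e"
    using continuous_bounded_support_uniformly[OF G sG \<open>0 < e\<close>] by metis
  have "\<bar>\<rho> (p + w) - \<rho> p - w \<bullet> G p\<bar> \<le> norm w * e" if "norm w < d" for p w
  proof -
    have "norm (\<rho> (p + w) - \<rho> p - (p + w - p) \<bullet> G p) \<le> norm (p + w - p) * e"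
    proof (rule differentiable_bound_linearization[where S = "ball p d" and f' = "\<lambda>x h. h \<bullet> G x"])
      fix t :: real assume t: "t \<in> {0..1}"
      have "norm (t *\<^sub>R w) \<le> norm w" using t by (simp add: mult_left_le_one_le)
      with that show "p + t *\<^sub>R (p + w - p) \<in> ball p d" by (simp add: dist_norm)
    next
      fix q assume q: "q \<in> ball p d"
      show "(\<rho> has_derivative (\<lambda>h. h \<bullet> G q)) (at q within ball p d)"
        using \<rho>[of q] unfolding gderiv_def by (rule has_derivative_at_withinI)
      show "onorm ((\<lambda>h. h \<bullet> G q) - (\<lambda>h. h \<bullet> G p)) \<le> e"
      proof (rule onorm_le)
        fix v
        have "norm (v \<bullet> (G q - G p)) \<le> norm v * norm (G q - G p)"
          using Cauchy_Schwarz_ineq2[of v "G q - G p"] by simp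
        also have "\<dots> \<le> norm v * e"
          using d(2)[of q p] q by (intro mult_left_mono) (auto simp: dist_norm norm_minus_commute)
        finally show "norm (((\<lambda>h. h \<bullet> G q) - (\<lambda>h. h \<bullet> G p)) v) \<le> e * norm v"
          by (simp add: inner_diff_right mult.commute)
      qed
    qed (use d in auto)
    then show ?thesis by simp
  qed
  with d(1) that show ?thesis by blast
qed

lemma GDERIV_convolution:
  fixes \<rho> h :: "'a::euclidean_space \<Rightarrow> real"
  assumes h: "integrable lborel h"
    and \<rho>: "\<And>x. GDERIV \<rho> x :> G x" and G: "continuous_on UNIV G"
    and s: "\<And>x. R < norm x \<Longrightarrow> \<rho> x = 0"
  shows "GDERIV (\<lambda>x. LINT y|lborel. h y * \<rho> (x - y)) x :> (LINT y|lborel. h y *\<^sub>R G (x - y))"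
proof -
  have sG: "R < norm x \<Longrightarrow> G x = 0" for x by (rule GDERIV_zero_outside[OF \<rho> s])
  have c\<rho>: "continuous_on UNIV \<rho>"
    using \<rho> unfolding gderiv_def by (metis continuous_at_imp_continuous_on has_derivative_continuous)
  obtain C where C: "\<And>x. norm (\<rho> x) \<le> C" using continuous_bounded_support_bounded[OF c\<rho> s] by metis
  obtain C' where C': "\<And>x. norm (G x) \<le> C'" using continuous_bounded_support_bounded[OF G sG] by metis
  have [measurable]: "\<rho> \<in> borel_measurable borel" "G \<in> borel_measurable borel"
    using c\<rho> G by (auto intro: borel_measurable_continuous_onI)
  have [measurable]: "h \<in> borel_measurable borel" using h by auto
  have i1: "integrable lborel (\<lambda>y. h y * \<rho> (x - y))" for x
    using integrable_mult_bounded[OF h, of "\<lambda>y. \<rho> (x - y)" C] C by simp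
  have i2: "integrable lborel (\<lambda>y. h y *\<^sub>R G (x - y))" for x
    by (rule integrable_mult_bounded[OF h, of "\<lambda>y. G (x - y)" C']) (use C' in auto)
  have "\<exists>d>0. \<forall>y. norm (y - x) < d \<longrightarrow>
      norm ((LINT z|lborel. h z * \<rho> (y - z)) - (LINT z|lborel. h z * \<rho> (x - z))
        - (y - x) \<bullet> (LINT z|lborel. h z *\<^sub>R G (x - z))) \<le> e * norm (y - x)" if "e > 0" for e
  proof -
    define H where "H = (LINT z|lborel. \<bar>h z\<bar>)"
    have "H \<ge> 0" unfolding H_def by simp
    have "e / (H + 1) > 0" using \<open>e > 0\<close> \<open>H \<ge> 0\<close> by simp
    obtain d where d: "0 < d"
      and lin: "\<And>p w. norm w < d \<Longrightarrow> \<bar>\<rho> (p + w) - \<rho> p - w \<bullet> G p\<bar> \<le> norm w * (e / (H + 1))"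
      using GDERIV_uniform_linearization[OF \<rho> G s \<open>e / (H + 1) > 0\<close>] by metis
    have "norm ((LINT z|lborel. h z * \<rho> (y - z)) - (LINT z|lborel. h z * \<rho> (x - z))
        - (y - x) \<bullet> (LINT z|lborel. h z *\<^sub>R G (x - z))) \<le> e * norm (y - x)" if y: "norm (y - x) < d" for y
    proof -
      have "(LINT z|lborel. h z * \<rho> (y - z)) - (LINT z|lborel. h z * \<rho> (x - z))
        - (y - x) \<bullet> (LINT z|lborel. h z *\<^sub>R G (x - z))
        = (LINT z|lborel. h z * \<rho> (y - z) - h z * \<rho> (x - z) - (y - x) \<bullet> (h z *\<^sub>R G (x - z)))"
      proof -
        have i3: "integrable lborel (\<lambda>z. (y - x) \<bullet> (h z *\<^sub>R G (x - z)))" using i2 by (rule integrable_inner_right)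
        have "(y - x) \<bullet> (LINT z|lborel. h z *\<^sub>R G (x - z)) = (LINT z|lborel. (y - x) \<bullet> (h z *\<^sub>R G (x - z)))"
          by (rule integral_inner_right[symmetric]) (rule i2)
        then show ?thesis
          by (simp only: Bochner_Integration.integral_diff[OF Bochner_Integration.integrable_diff[OF i1 i1] i3]
              Bochner_Integration.integral_diff[OF i1 i1])
      qed
      also have "\<dots> = (LINT z|lborel. h z * (\<rho> (y - z) - \<rho> (x - z) - (y - x) \<bullet> G (x - z)))"
        by (simp add: algebra_simps)
      also have "norm \<dots> \<le> (LINT z|lborel. norm (h z * (\<rho> (y - z) - \<rho> (x - z) - (y - x) \<bullet> G (x - z))))"
        by (rule integral_norm_bound)
      also have "\<dots> \<le> (LINT z|lborel. \<bar>h z\<bar> * (norm (y - x) * (e / (H + 1))))"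
      proof (rule integral_mono')
        show "integrable lborel (\<lambda>z. \<bar>h z\<bar> * (norm (y - x) * (e / (H + 1))))" using h by simp
        fix z
        show "norm (h z * (\<rho> (y - z) - \<rho> (x - z) - (y - x) \<bullet> G (x - z))) \<le> \<bar>h z\<bar> * (norm (y - x) * (e / (H + 1)))"
          using mult_left_mono[OF lin[OF y, of "x - z"] abs_ge_zero[of "h z"]]
          by (simp add: abs_mult[symmetric])
      qed (use \<open>e > 0\<close> \<open>H \<ge> 0\<close> in simp)
      also have "\<dots> = H / (H + 1) * (e * norm (y - x))" by (simp add: H_def)
      also have "\<dots> \<le> 1 * (e * norm (y - x))"
        using \<open>H \<ge> 0\<close> \<open>e > 0\<close> by (intro mult_right_mono) auto
      finally show ?thesis by simp
    qed
    with d show ?thesis by blast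
  qed
  then show ?thesis unfolding gderiv_def has_derivative_at_alt
    by (auto intro: bounded_linear_inner_left)
qed

lemma C_k_convolution:
  fixes h :: "real^'n \<Rightarrow> real"
  assumes h: "integrable lborel h"
  shows "(\<And>k. C_k k \<rho>) \<Longrightarrow> (\<And>x. R < norm x \<Longrightarrow> \<rho> x = 0) \<Longrightarrow>
    C_k k (\<lambda>x. LINT y|lborel. h y * \<rho> (x - y))"
proof (induction k arbitrary: \<rho>)
  case 0
  obtain G where G: "\<And>x. GDERIV \<rho> x :> G x" "\<And>k i. C_k k (\<lambda>x. G x $ i)"
    using smooth_gradient[OF 0(1)] by blast
  note D = GDERIV_convolution[OF h G(1) continuous_on_smooth[OF G(2)] 0(2)]
  then show ?case
    unfolding C_k.simps gderiv_def by (metis (no_types, lifting) continuous_at_imp_continuous_on has_derivative_continuous)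
next
  case (Suc k)
  obtain G where G: "\<And>x. GDERIV \<rho> x :> G x" "\<And>k i. C_k k (\<lambda>x. G x $ i)"
    using smooth_gradient[OF Suc.prems(1)] by blast
  have cG: "continuous_on UNIV G" by (rule continuous_on_smooth[OF G(2)])
  have sG: "R < norm x \<Longrightarrow> G x = 0" for x by (rule GDERIV_zero_outside[OF G(1) Suc.prems(2)])
  obtain C' where C': "\<And>x. norm (G x) \<le> C'" using continuous_bounded_support_bounded[OF cG sG] by metis
  have [measurable]: "G \<in> borel_measurable borel"
    using cG by (auto intro: borel_measurable_continuous_onI)
  have i2: "integrable lborel (\<lambda>y. h y *\<^sub>R G (x - y))" for x
    by (rule integrable_mult_bounded[OF h, of "\<lambda>y. G (x - y)" C']) (use C' in auto)
  have "(LINT y|lborel. h y *\<^sub>R G (x - y)) $ i = (LINT y|lborel. h y * G (x - y) $ i)" for x i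
    using integral_bounded_linear[OF bounded_linear_vec_nth[of i] i2[of x]] by simp
  moreover have "C_k k (\<lambda>x. LINT y|lborel. h y * G (x - y) $ i)" for i
    by (rule Suc.IH[of "\<lambda>x. G x $ i"]) (use G(2) sG in auto)
  ultimately show ?case
    using GDERIV_convolution[OF h G(1) cG Suc.prems(2)]
    by (intro C_k.simps(2)[THEN iffD2] exI[of _ "\<lambda>x. LINT y|lborel. h y *\<^sub>R G (x - y)"]) simp
qed

section \<open>The normalised bump and mollification at a given scale\<close>

definition bump :: "real^'n \<Rightarrow> real" where
  "bump x = exp_flat 1 (1 - x \<bullet> x) / (LINT y|lborel. exp_flat 1 (1 - (y::real^'n) \<bullet> y))"

lemma exp_flat_1: "exp_flat 1 t = (if 0 < t then exp (- (1/t)) else 0)"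
  by (simp add: exp_flat_def)

lemma exp_flat_integral:
  shows "integrable lborel (\<lambda>x::real^'n. exp_flat 1 (1 - x \<bullet> x))"
    and "0 < (LINT x|lborel. exp_flat 1 (1 - (x::real^'n) \<bullet> x))"
proof -
  let ?f = "\<lambda>x::real^'n. exp_flat 1 (1 - x \<bullet> x)"
  have c: "continuous_on UNIV ?f" using C_k_exp_flat[of 0 1] by simp
  have s: "?f x = 0" if "1 < norm x" for x
  proof -
    have "1 < (norm x)\<^sup>2" using that by (simp add: one_less_power)
    then show ?thesis by (simp add: exp_flat_def dot_square_norm)
  qed
  obtain C where C: "\<And>x. norm (?f x) \<le> C" using continuous_bounded_support_bounded[OF c s] by metis
  show int: "integrable lborel ?f"
    by (rule integrable_bounded_support[OF _ C s]) (use c in \<open>auto intro: borel_measurable_continuous_onI\<close>)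
  have "0 < exp (- 2) * measure lborel (ball (0::real^'n) (1/2))"
    by (simp add: content_ball_pos)
  also have "\<dots> = (LINT x|lborel. exp (- 2) * indicator (ball (0::real^'n) (1/2)) x)" by simp
  also have "\<dots> \<le> (LINT x|lborel. ?f x)"
  proof (rule integral_mono[OF _ int])
    show "integrable lborel (\<lambda>x. exp (- 2) * indicator (ball (0::real^'n) (1/2)) x :: real)"
      by (intro integrable_mult_right integrable_real_indicator emeasure_bounded_finite) auto
    fix x :: "real^'n"
    have "exp (- 2) \<le> ?f x" if "norm x < 1/2"
    proof -
      have "x \<bullet> x \<le> (1/2)\<^sup>2" unfolding dot_square_norm using that by (intro power_mono) auto
      then have *: "1/2 \<le> 1 - x \<bullet> x" by (simp add: power2_eq_square)
      then have "1 / (1 - x \<bullet> x) \<le> 2" by (simp add: divide_simps)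
      with * show ?thesis by (simp add: exp_flat_1)
    qed
    moreover have "0 \<le> ?f x" by (simp add: exp_flat_1)
    ultimately show "exp (- 2) * indicator (ball 0 (1/2)) x \<le> ?f x"
      unfolding indicator_def by simp
  qed
  finally show "0 < (LINT x|lborel. ?f x)" .
qed

lemma bump_nonneg: "0 \<le> bump x"
  unfolding bump_def using exp_flat_integral(2) by (intro divide_nonneg_pos) (auto simp: exp_flat_1)

lemma integrable_bump: "integrable lborel (bump :: real^'n \<Rightarrow> real)"
  and integral_bump: "(LINT x|lborel. bump (x::real^'n)) = 1"
proof -
  have "(LINT y|lborel. exp_flat 1 (1 - (y::real^'n) \<bullet> y)) \<noteq> 0"
    using exp_flat_integral(2)[where 'n = 'n] by simp
  then show "integrable lborel (bump :: real^'n \<Rightarrow> real)" "(LINT x|lborel. bump (x::real^'n)) = 1"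
    unfolding bump_def[abs_def] using exp_flat_integral(1)[where 'n = 'n] by auto
qed

lemma bump_eq_0: "1 < norm x \<Longrightarrow> bump x = 0"
proof -
  assume "1 < norm x"
  then have "1 < (norm x)\<^sup>2" by (simp add: one_less_power)
  then show ?thesis by (simp add: bump_def exp_flat_1 dot_square_norm)
qed

lemma C_k_bump: "C_k k bump"
  unfolding bump_def[abs_def] divide_inverse
  by (intro C_k_mult C_k_exp_flat C_k_const)

lemma continuous_on_bump: "continuous_on UNIV bump"
  using C_k_bump[of 0] by simp

lemma borel_measurable_bump [measurable]: "bump \<in> borel_measurable borel"
  by (rule borel_measurable_continuous_onI[OF continuous_on_bump])

text \<open>The scaled kernel stands at \<open>x - y\<close> so that the convolution lemmas apply
  directly; \<open>mollify_eq\<close> is the form with the shift inside \<open>h\<close>.\<close>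

definition mollify :: "(real^'n \<Rightarrow> real) \<Rightarrow> real \<Rightarrow> real^'n \<Rightarrow> real" where
  "mollify h \<sigma> x = (LINT y|lborel. h y * (bump ((x - y) /\<^sub>R \<sigma>) / \<sigma> ^ CARD('n)))"

lemma mollify_eq:
  fixes h :: "real^'n \<Rightarrow> real"
  assumes [measurable]: "h \<in> borel_measurable borel" and "0 < \<sigma>"
  shows "mollify h \<sigma> x = (LINT z|lborel. h (x - \<sigma> *\<^sub>R z) * bump z)"
proof -
  have "mollify h \<sigma> x = \<bar>- \<sigma>\<bar> ^ DIM(real^'n) *\<^sub>R
      (LINT z|lborel. h (x + (- \<sigma>) *\<^sub>R z) * (bump ((x - (x + (- \<sigma>) *\<^sub>R z)) /\<^sub>R \<sigma>) / \<sigma> ^ CARD('n)))"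
    unfolding mollify_def by (rule integral_affine) (use \<open>0 < \<sigma>\<close> in auto)
  then show ?thesis using \<open>0 < \<sigma>\<close> by simp
qed

lemma C_k_mollify:
  fixes h :: "real^'n \<Rightarrow> real"
  assumes h: "integrable lborel h" and "0 < \<sigma>"
  shows "C_k k (mollify h \<sigma>)"
proof -
  have *: "C_k k (\<lambda>x. bump (x /\<^sub>R \<sigma>) / \<sigma> ^ CARD('n))" for k
    using C_k_mult[OF C_k_affine[OF C_k_bump, of k "1 / \<sigma>" 0] C_k_const[of k "1 / \<sigma> ^ CARD('n)"]]
    by (simp add: divide_inverse)
  have "C_k k (\<lambda>x. LINT y|lborel. h y * (bump ((x - y) /\<^sub>R \<sigma>) / \<sigma> ^ CARD('n)))"
    by (rule C_k_convolution[OF h *, of \<sigma>]) (use \<open>0 < \<sigma>\<close> in \<open>simp add: bump_eq_0 divide_simps\<close>)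
  then show ?thesis by (simp add: mollify_def[abs_def])
qed

lemma integrable_mollify_kernel:
  fixes h :: "real^'n \<Rightarrow> real"
  assumes [measurable]: "h \<in> borel_measurable borel" and b: "\<And>x. \<bar>h x\<bar> \<le> C"
  shows "integrable lborel (\<lambda>z. h (x - \<sigma> *\<^sub>R z) * bump z)"
  using integrable_mult_bounded[OF integrable_bump, of "\<lambda>z. h (x - \<sigma> *\<^sub>R z)" C] b
  by (simp add: mult.commute)

lemma mollify_bounds:
  fixes h :: "real^'n \<Rightarrow> real"
  assumes [measurable]: "h \<in> borel_measurable borel" and b: "\<And>x. \<bar>h x\<bar> \<le> 1" and "0 < \<sigma>"
  shows "\<bar>mollify h \<sigma> x\<bar> \<le> 1"
proof -
  have "\<bar>mollify h \<sigma> x\<bar> \<le> (LINT z|lborel. \<bar>h (x - \<sigma> *\<^sub>R z) * bump z\<bar>)"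
    unfolding mollify_eq[OF assms(1,3)] by (rule integral_abs_bound)
  also have "\<dots> \<le> (LINT z|lborel. bump (z::real^'n))"
    by (intro integral_mono integrable_abs integrable_mollify_kernel integrable_bump)
      (use b bump_nonneg in \<open>auto simp: abs_mult abs_of_nonneg[OF bump_nonneg] intro!: mult_left_le_one_le\<close>)
  finally show ?thesis by (simp add: integral_bump)
qed

text \<open>A negative power of \<sigma> is traded for the L^1 norm of \<open>h\<close>. This is
  used at the coarsest scale only, where it makes the pairing quadratic in the measure of the
  superlevel set.\<close>

lemma mollify_le_integral:
  obtains C where "0 < C" "\<And>h \<sigma> x. integrable lborel h \<Longrightarrow> 0 < \<sigma> \<Longrightarrow>
    \<bar>mollify (h :: real^'n \<Rightarrow> real) \<sigma> x\<bar> \<le> C / \<sigma> ^ CARD('n) * (LINT y|lborel. \<bar>h y\<bar>)"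
proof -
  obtain C where C: "0 < C" "\<And>x. norm (bump (x::real^'n)) \<le> C"
    using continuous_bounded_support_bounded[OF continuous_on_bump bump_eq_0] by blast
  have "\<bar>mollify h \<sigma> x\<bar> \<le> C / \<sigma> ^ CARD('n) * (LINT y|lborel. \<bar>h y\<bar>)"
    if h: "integrable lborel h" and "0 < \<sigma>" for h :: "real^'n \<Rightarrow> real" and \<sigma> x
  proof -
    have "\<bar>mollify h \<sigma> x\<bar> \<le> (LINT y|lborel. \<bar>h y * (bump ((x - y) /\<^sub>R \<sigma>) / \<sigma> ^ CARD('n))\<bar>)"
      unfolding mollify_def by (rule integral_abs_bound)
    also have "\<dots> \<le> (LINT y|lborel. C / \<sigma> ^ CARD('n) * \<bar>h y\<bar>)"
    proof (rule integral_mono')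
      show "integrable lborel (\<lambda>y. C / \<sigma> ^ CARD('n) * \<bar>h y\<bar>)" using h by simp
      fix y
      show "\<bar>h y * (bump ((x - y) /\<^sub>R \<sigma>) / \<sigma> ^ CARD('n))\<bar> \<le> C / \<sigma> ^ CARD('n) * \<bar>h y\<bar>"
        using C(2)[of "(x - y) /\<^sub>R \<sigma>"] \<open>0 < \<sigma>\<close> \<open>0 < C\<close>
        by (auto simp: abs_mult mult.commute[of C] divide_simps intro!: mult_left_mono)
    qed (use \<open>0 < C\<close> \<open>0 < \<sigma>\<close> in auto)
    finally show ?thesis by simp
  qed
  with C(1) that show ?thesis by blast
qed

text \<open>Rescaling the integration variable takes the scale out of the kernel as a factor
  \<open>1 / \<sigma>\<close> and leaves the L^1 norm of the gradient of \<open>bump\<close>; hence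
  one constant for all \<open>h\<close> and \<sigma>.\<close>

lemma mollify_gradient:
  obtains C where "0 < C" "\<And>h \<sigma> x D. integrable lborel h \<Longrightarrow> (\<And>y. \<bar>h y\<bar> \<le> 1) \<Longrightarrow> 0 < \<sigma> \<Longrightarrow>
    GDERIV (mollify (h :: real^'n \<Rightarrow> real) \<sigma>) x :> D \<Longrightarrow> norm D \<le> C / \<sigma>"
proof -
  obtain G where G: "\<And>x. GDERIV (bump :: real^'n \<Rightarrow> real) x :> G x" "\<And>k i. C_k k (\<lambda>x. G x $ i)"
    using smooth_gradient[OF C_k_bump] by blast
  have cG: "continuous_on UNIV G" by (rule continuous_on_smooth[OF G(2)])
  have sG: "1 < norm x \<Longrightarrow> G x = 0" for x by (rule GDERIV_zero_outside[OF G(1) bump_eq_0])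
  obtain B where B: "\<And>x. norm (G x) \<le> B" using continuous_bounded_support_bounded[OF cG sG] by metis
  have [measurable]: "G \<in> borel_measurable borel"
    using cG by (auto intro: borel_measurable_continuous_onI)
  have iG: "integrable lborel G" by (rule integrable_bounded_support[OF _ B sG]) auto
  define C where "C = (LINT y|lborel. norm (G y)) + 1"
  have "norm D \<le> C / \<sigma>"
    if h: "integrable lborel h" "\<And>y. \<bar>h y\<bar> \<le> 1" "0 < \<sigma>" and D: "GDERIV (mollify h \<sigma>) x :> D"
    for h :: "real^'n \<Rightarrow> real" and \<sigma> x D
  proof -
    have [measurable]: "h \<in> borel_measurable borel" using h(1) by auto
    let ?K = "\<lambda>x. (1 / \<sigma> ^ CARD('n)) *\<^sub>R ((1 / \<sigma>) *\<^sub>R G ((1 / \<sigma>) *\<^sub>R x + 0))"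
    have K: "GDERIV (\<lambda>x. bump (x /\<^sub>R \<sigma>) / \<sigma> ^ CARD('n)) x :> ?K x" for x
      using GDERIV_mult[OF GDERIV_const[of "1 / \<sigma> ^ CARD('n)"] GDERIV_affine[of bump "1 / \<sigma>" x 0, OF G(1)]]
      by (simp add: divide_inverse mult.commute)
    have "GDERIV (\<lambda>x. LINT y|lborel. h y * (bump ((x - y) /\<^sub>R \<sigma>) / \<sigma> ^ CARD('n))) x :>
       (LINT y|lborel. h y *\<^sub>R ?K (x - y))"
      by (rule GDERIV_convolution[OF h(1) K, of \<sigma>])
        (use \<open>0 < \<sigma>\<close> in \<open>auto simp: bump_eq_0 divide_simps intro!: continuous_intros continuous_on_compose2[OF cG]\<close>)
    then have "D = (LINT y|lborel. h y *\<^sub>R ?K (x - y))"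
      using D GDERIV_unique by (fastforce simp: mollify_def[abs_def])
    also have "\<dots> = \<bar>- \<sigma>\<bar> ^ DIM(real^'n) *\<^sub>R
      (LINT z|lborel. h (x + (- \<sigma>) *\<^sub>R z) *\<^sub>R ?K (x - (x + (- \<sigma>) *\<^sub>R z)))"
      by (rule integral_affine) (use \<open>0 < \<sigma>\<close> in auto)
    also have "\<dots> = (LINT z|lborel. (1 / \<sigma>) *\<^sub>R (h (x - \<sigma> *\<^sub>R z) *\<^sub>R G z))"
      unfolding integral_scaleR_right[symmetric] using \<open>0 < \<sigma>\<close>
      by (intro Bochner_Integration.integral_cong) auto
    also have "norm \<dots> \<le> (LINT z|lborel. norm ((1 / \<sigma>) *\<^sub>R (h (x - \<sigma> *\<^sub>R z) *\<^sub>R G z)))"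
      by (rule integral_norm_bound)
    also have "\<dots> \<le> (LINT z|lborel. norm (G z) / \<sigma>)"
      by (rule integral_mono') (use iG h \<open>0 < \<sigma>\<close> in \<open>auto simp: divide_simps mult_left_le_one_le\<close>)
    also have "\<dots> \<le> C / \<sigma>" using \<open>0 < \<sigma>\<close> by (simp add: C_def divide_simps)
    finally show ?thesis .
  qed
  moreover have "0 < C" unfolding C_def by (simp add: add_nonneg_pos)
  ultimately show ?thesis using that by blast
qed

lemma mollify_support:
  fixes h :: "real^'n \<Rightarrow> real"
  assumes "\<And>x. R < norm x \<Longrightarrow> h x = 0" "0 < \<sigma>" "R + \<sigma> < norm x"
  shows "mollify h \<sigma> x = 0"
proof -
  have "h y * (bump ((x - y) /\<^sub>R \<sigma>) / \<sigma> ^ CARD('n)) = 0" for y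
  proof (cases "R < norm y")
    case False
    then have "\<sigma> < norm (x - y)" using assms(3) norm_triangle_ineq2[of x y] by linarith
    then show ?thesis using \<open>0 < \<sigma>\<close> by (simp add: bump_eq_0 divide_simps)
  qed (use assms in simp)
  then show ?thesis unfolding mollify_def by (simp only:) simp
qed

lemma mollify_near:
  fixes h :: "real^'n \<Rightarrow> real"
  assumes [measurable]: "h \<in> borel_measurable borel" and b: "\<And>x. \<bar>h x\<bar> \<le> 1"
    and near: "\<And>y. dist x y \<le> \<sigma> \<Longrightarrow> \<bar>h y - c\<bar> \<le> e" and "0 < \<sigma>"
  shows "\<bar>mollify h \<sigma> x - c\<bar> \<le> e"
proof -
  have "mollify h \<sigma> x - c = (LINT z|lborel. h (x - \<sigma> *\<^sub>R z) * bump z) - (LINT z|lborel. c * bump (z::real^'n))"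
    by (simp add: mollify_eq[OF assms(1) \<open>0 < \<sigma>\<close>] integral_bump)
  also have "\<dots> = (LINT z|lborel. h (x - \<sigma> *\<^sub>R z) * bump z - c * bump (z::real^'n))"
    by (rule Bochner_Integration.integral_diff[symmetric])
      (auto intro: integrable_mollify_kernel[OF assms(1) b] integrable_bump)
  also have "\<dots> = (LINT z|lborel. (h (x - \<sigma> *\<^sub>R z) - c) * bump z)" by (simp add: algebra_simps)
  also have "\<bar>\<dots>\<bar> \<le> (LINT z|lborel. \<bar>(h (x - \<sigma> *\<^sub>R z) - c) * bump z\<bar>)" by (rule integral_abs_bound)
  also have "\<dots> \<le> (LINT z|lborel. e * bump (z::real^'n))"
  proof (rule integral_mono')
    show "integrable lborel (\<lambda>z. e * bump (z::real^'n))" by (simp add: integrable_bump)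
    fix z :: "real^'n"
    have "0 \<le> e" using near[of x] \<open>0 < \<sigma>\<close> by auto
    show "0 \<le> e * bump z" using \<open>0 \<le> e\<close> bump_nonneg[of z] by simp
    show "\<bar>(h (x - \<sigma> *\<^sub>R z) - c) * bump z\<bar> \<le> e * bump z"
    proof (cases "1 < norm z")
      case False
      then have "dist x (x - \<sigma> *\<^sub>R z) \<le> \<sigma>" using \<open>0 < \<sigma>\<close> by (simp add: dist_norm)
      with near show ?thesis using bump_nonneg[of z] by (simp add: abs_mult mult_right_mono)
    qed (simp add: bump_eq_0)
  qed
  finally show ?thesis by (simp add: integral_bump)
qed

lemma integral_abs_mollify_le:
  fixes h :: "real^'n \<Rightarrow> real"
  assumes h: "integrable lborel h" and "0 < \<sigma>" and b: "\<And>x. \<bar>h x\<bar> \<le> C" and s: "\<And>x. R < norm x \<Longrightarrow> h x = 0"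
  shows "(LINT x|lborel. \<bar>mollify h \<sigma> x\<bar>) \<le> (LINT x|lborel. \<bar>h x\<bar>)"
proof -
  have [measurable]: "h \<in> borel_measurable borel" using h by auto
  let ?f = "\<lambda>p. \<bar>h (fst p - \<sigma> *\<^sub>R snd p)\<bar> * bump (snd p :: real^'n)"
  obtain B where B: "0 < B" "\<And>x. norm (bump (x::real^'n)) \<le> B"
    using continuous_bounded_support_bounded[OF continuous_on_bump bump_eq_0] by blast
  have "integrable lborel ?f"
  proof (rule integrable_bounded_support[where R = "\<bar>R\<bar> + \<sigma> + 1"])
    show "norm (?f p) \<le> C * B" for p
      using B b order_trans[OF abs_ge_zero b] by (auto simp: abs_mult intro!: mult_mono)
    show "?f p = 0" if "\<bar>R\<bar> + \<sigma> + 1 < norm p" for p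
    proof (cases "1 < norm (snd p)")
      case False
      have "norm p \<le> norm (fst p) + norm (snd p)" using norm_Pair_le[of "fst p" "snd p"] by simp
      moreover have "norm (\<sigma> *\<^sub>R snd p) \<le> \<sigma>" using False \<open>0 < \<sigma>\<close> by simp
      moreover have "norm (fst p) - norm (\<sigma> *\<^sub>R snd p) \<le> norm (fst p - \<sigma> *\<^sub>R snd p)" by (rule norm_triangle_ineq2)
      ultimately have "R < norm (fst p - \<sigma> *\<^sub>R snd p)" using False that by linarith
      then show ?thesis by (simp add: s)
    qed (simp add: bump_eq_0)
  qed (simp add: borel_prod[symmetric])
  then have int: "integrable (lborel \<Otimes>\<^sub>M lborel) (\<lambda>(x, z). \<bar>h (x - \<sigma> *\<^sub>R z)\<bar> * bump z)"
    by (simp add: lborel_prod case_prod_beta')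
  have "(LINT x|lborel. \<bar>mollify h \<sigma> x\<bar>) \<le> (LINT x|lborel. LINT z|lborel. \<bar>h (x - \<sigma> *\<^sub>R z)\<bar> * bump z)"
  proof (rule integral_mono')
    show "integrable lborel (\<lambda>x. LINT z|lborel. \<bar>h (x - \<sigma> *\<^sub>R z)\<bar> * bump z)"
      using lborel_pair.integrable_fst[OF int] .
    fix x
    have "\<bar>mollify h \<sigma> x\<bar> \<le> (LINT z|lborel. \<bar>h (x - \<sigma> *\<^sub>R z) * bump z\<bar>)"
      using mollify_eq[of h \<sigma> x] \<open>0 < \<sigma>\<close> integral_abs_bound by simp
    then show "\<bar>mollify h \<sigma> x\<bar> \<le> (LINT z|lborel. \<bar>h (x - \<sigma> *\<^sub>R z)\<bar> * bump z)"
      by (simp add: abs_mult bump_nonneg)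
  qed (simp add: bump_nonneg)
  also have "\<dots> = (LINT z|lborel. LINT x|lborel. \<bar>h (x - \<sigma> *\<^sub>R z)\<bar> * bump z)"
    using lborel_pair.Fubini_integral[OF int] by simp
  also have "\<dots> = (LINT z|lborel. (LINT x|lborel. \<bar>h x\<bar>) * bump (z::real^'n))"
  proof (rule Bochner_Integration.integral_cong[OF refl])
    fix z :: "real^'n"
    show "(LINT x|lborel. \<bar>h (x - \<sigma> *\<^sub>R z)\<bar> * bump z) = (LINT x|lborel. \<bar>h x\<bar>) * bump z"
      using integral_affine[of "\<lambda>x. \<bar>h x\<bar>" 1 "- \<sigma> *\<^sub>R z"] by (simp add: add.commute)
  qed
  finally show ?thesis by (simp add: integral_bump)
qed

subsection \<open>Averages of translations\<close>

text \<open>The bound is required everywhere rather than almost everywhere: averages along a single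
  direction see sets of measure zero. With bounded support added (\<open>bsfun\<close>) the
  functions are integrable and can be paired with each other.\<close>

definition bfun :: "('a::euclidean_space \<Rightarrow> real) \<Rightarrow> bool" where
  "bfun g \<longleftrightarrow> g \<in> borel_measurable borel \<and> (\<exists>C. \<forall>x. \<bar>g x\<bar> \<le> C)"

definition bsfun :: "('a::euclidean_space \<Rightarrow> real) \<Rightarrow> bool" where
  "bsfun g \<longleftrightarrow> bfun g \<and> (\<exists>R. \<forall>x. R < norm x \<longrightarrow> g x = 0)"

text \<open>Convolution with the law of \<open>- z\<close>, written as the expectation of a randomly
  translated function.\<close>

definition avg :: "'w measure \<Rightarrow> ('w \<Rightarrow> 'a) \<Rightarrow> ('a \<Rightarrow> real) \<Rightarrow> 'a::euclidean_space \<Rightarrow> real" where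
  "avg M z g x = (LINT \<omega>|M. g (x + z \<omega>))"

lemma bfun_measurable [measurable_dest]: "bfun g \<Longrightarrow> g \<in> borel_measurable borel"
  by (simp add: bfun_def)

lemma bsfunD: "bsfun g \<Longrightarrow> bfun g"
  by (simp add: bsfun_def)

lemma bfunE:
  assumes "bfun g" obtains C where "0 \<le> C" "\<And>x. \<bar>g x\<bar> \<le> C"
  using assms unfolding bfun_def by (metis abs_ge_zero order_trans)

lemma bsfun_integrable: "bsfun g \<Longrightarrow> integrable lborel g"
  unfolding bsfun_def bfun_def by (metis integrable_bounded_support real_norm_def)

lemma bsfun_mult: "bsfun g \<Longrightarrow> bfun h \<Longrightarrow> bsfun (\<lambda>x. g x * h x)"
proof -
  assume g: "bsfun g" and h: "bfun h"
  obtain C D where "\<And>x. \<bar>g x\<bar> \<le> C" "\<And>x. \<bar>h x\<bar> \<le> D" using bfunE[OF bsfunD[OF g]] bfunE[OF h] by metis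
  then have "\<bar>g x * h x\<bar> \<le> C * D" for x
    by (auto simp: abs_mult intro!: mult_mono order_trans[OF abs_ge_zero])
  with g h show ?thesis unfolding bsfun_def bfun_def by (fastforce intro: borel_measurable_times)
qed

lemma bfun_shift: "bfun g \<Longrightarrow> bfun (\<lambda>x. g (x + y))"
  unfolding bfun_def by (auto intro!: measurable_compose[of "\<lambda>x. x + y" borel borel g])

lemma (in prob_space) integrable_bfun:
  assumes "bfun g" "X \<in> borel_measurable M" shows "integrable M (\<lambda>\<omega>. g (X \<omega>))"
proof -
  obtain C where "\<And>x. \<bar>g x\<bar> \<le> C" using bfunE[OF assms(1)] by metis
  then show ?thesis
    by (intro integrable_const_bound[where B = C]) (use assms in \<open>auto dest: bfun_measurable\<close>)
qed

lemma (in prob_space) integral_le_bound: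
  assumes "\<And>\<omega>. \<bar>f \<omega>\<bar> \<le> (C::real)"
  shows "\<bar>LINT \<omega>|M. f \<omega>\<bar> \<le> C"
proof -
  have "\<bar>LINT \<omega>|M. f \<omega>\<bar> \<le> (LINT \<omega>|M. \<bar>f \<omega>\<bar>)" by (rule integral_abs_bound)
  also have "\<dots> \<le> (LINT \<omega>|M. C)"
    by (rule integral_mono') (use assms order_trans[OF abs_ge_zero assms] in auto)
  finally show ?thesis by (simp add: prob_space)
qed

lemma avg_measurable:
  assumes "prob_space M" and [measurable]: "z \<in> borel_measurable M" "g \<in> borel_measurable borel"
  shows "avg M z g \<in> borel_measurable borel"
proof -
  interpret prob_space M by fact
  show ?thesis unfolding avg_def[abs_def] by measurable
qed

lemma avg_bound:
  assumes "prob_space M" "\<And>x. \<bar>g x\<bar> \<le> C" shows "\<bar>avg M z g x\<bar> \<le> C"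
  unfolding avg_def by (rule prob_space.integral_le_bound[OF assms(1)]) (rule assms(2))

lemma bfun_avg:
  assumes "prob_space M" "z \<in> borel_measurable M" "bfun g" shows "bfun (avg M z g)"
  using assms avg_measurable[OF assms(1,2)] avg_bound[OF assms(1)] unfolding bfun_def by metis

lemma bsfun_avg:
  assumes "prob_space M" "z \<in> borel_measurable M" "\<And>\<omega>. norm (z \<omega>) \<le> Z" "bsfun g"
  shows "bsfun (avg M z g)"
proof -
  obtain R where R: "\<And>x. R < norm x \<Longrightarrow> g x = 0" using assms(4) by (auto simp: bsfun_def)
  have "avg M z g x = 0" if "R + Z < norm x" for x
  proof -
    have "g (x + z \<omega>) = 0" for \<omega>
      using R[of "x + z \<omega>"] norm_diff_ineq[of x "z \<omega>"] assms(3)[of \<omega>] that by linarith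
    then show ?thesis by (simp add: avg_def)
  qed
  with bfun_avg[OF assms(1,2) bsfunD[OF assms(4)]] show ?thesis unfolding bsfun_def by blast
qed

text \<open>Translations commute, and Fubini exchanges the two expectations. This allows one
  direction to be peeled off an iterated average, and mollification to be moved through it.\<close>

lemma avg_commute:
  assumes "prob_space M" "prob_space N" and [measurable]: "z \<in> borel_measurable M" "w \<in> borel_measurable N"
    and g: "bfun g"
  shows "avg M z (avg N w g) = avg N w (avg M z g)"
proof
  fix x
  interpret M: prob_space M by fact
  interpret N: prob_space N by fact
  interpret MN: pair_prob_space M N ..
  have "integrable (M \<Otimes>\<^sub>M N) (\<lambda>(\<omega>, \<nu>). g (x + z \<omega> + w \<nu>))"
    using MN.integrable_bfun[OF g, of "\<lambda>(\<omega>, \<nu>). x + z \<omega> + w \<nu>"] by (simp add: case_prod_beta')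
  from MN.Fubini_integral[OF this] show "avg M z (avg N w g) x = avg N w (avg M z g) x"
    by (simp add: avg_def add.commute add.left_commute)
qed

lemma avg_pair:
  assumes "prob_space M" "prob_space N" and [measurable]: "(\<lambda>(v, \<omega>). z v \<omega>) \<in> borel_measurable (M \<Otimes>\<^sub>M N)"
    and g: "bfun g"
  shows "avg (M \<Otimes>\<^sub>M N) (\<lambda>(v, \<omega>). z v \<omega>) g x = (LINT v|M. avg N (z v) g x)"
proof -
  interpret M: prob_space M by fact
  interpret N: prob_space N by fact
  interpret MN: pair_prob_space M N ..
  have "integrable (M \<Otimes>\<^sub>M N) (\<lambda>(v, \<omega>). g (x + z v \<omega>))"
    using MN.integrable_bfun[OF g, of "\<lambda>(v, \<omega>). x + z v \<omega>"] by (simp add: case_prod_beta')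
  from MN.integral_fst[OF this] show ?thesis
    by (simp add: avg_def case_prod_beta')
qed

lemma integral_translate:
  fixes f :: "'a::euclidean_space \<Rightarrow> real"
  assumes "f \<in> borel_measurable borel"
  shows "(LINT x|lborel. f (x + t)) = (LINT x|lborel. f x)"
  using integral_affine[OF assms, of 1 t] by (simp add: add.commute)

lemma bsfun_pair_integrable:
  fixes z w :: "'w \<Rightarrow> 'a::euclidean_space" and M :: "'w measure"
  assumes "prob_space M" and [measurable]: "z \<in> borel_measurable M" "w \<in> borel_measurable M"
    and b: "\<And>\<omega>. norm (z \<omega>) \<le> Z" and g: "bsfun g" and h: "bfun h"
  shows "integrable (lborel \<Otimes>\<^sub>M M) (\<lambda>(x, \<omega>). g (x + z \<omega>) * h (x + w \<omega>))"
proof -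
  interpret M: prob_space M by fact
  interpret P: pair_sigma_finite lborel M ..
  obtain C D where C: "\<And>x. \<bar>g x\<bar> \<le> C" and D: "\<And>x. \<bar>h x\<bar> \<le> D"
    using bfunE[OF bsfunD[OF g]] bfunE[OF h] by metis
  obtain R where R: "\<And>x. R < norm x \<Longrightarrow> g x = 0" using g by (auto simp: bsfun_def)
  have [measurable]: "g \<in> borel_measurable borel" "h \<in> borel_measurable borel"
    using g h by (auto dest: bsfunD bfun_measurable)
  define B where "B = cball (0::'a) (R + Z)"
  have [measurable]: "B \<in> sets borel" by (simp add: B_def)
  have int: "integrable (lborel \<Otimes>\<^sub>M M) (\<lambda>p. (C * D) * indicator (B \<times> space M) p :: real)"
  proof (intro integrable_mult_right integrable_real_indicator)
    have "emeasure lborel B < \<infinity>" unfolding B_def by (intro emeasure_bounded_finite) auto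
    then show "emeasure (lborel \<Otimes>\<^sub>M M) (B \<times> space M) < \<infinity>"
      by (subst M.emeasure_pair_measure_Times) (auto simp: M.emeasure_space_1)
  qed auto
  have "norm (g (x + z \<omega>) * h (x + w \<omega>)) \<le> norm (C * D * indicator (B \<times> space M) (x, \<omega>))"
    if "\<omega> \<in> space M" for x \<omega>
  proof (cases "norm x \<le> R + Z")
    case True
    have CD: "0 \<le> C" "0 \<le> D" using order_trans[OF abs_ge_zero C] order_trans[OF abs_ge_zero D] .
    show ?thesis using True that C D CD by (auto simp: B_def abs_mult intro!: mult_mono)
  next
    case False
    then have "g (x + z \<omega>) = 0"
      using R[of "x + z \<omega>"] norm_diff_ineq[of x "z \<omega>"] b[of \<omega>] by linarith
    then show ?thesis by simp
  qed
  then show ?thesis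
    by (intro Bochner_Integration.integrable_bound[OF int] AE_I2) (auto simp: space_pair_measure)
qed

lemma integral_avg_mult:
  assumes M: "prob_space M" and z[measurable]: "z \<in> borel_measurable M" and b: "\<And>\<omega>. norm (z \<omega>) \<le> Z"
    and g: "bsfun g" and h: "bfun h"
  shows "(LINT x|lborel. avg M z g x * h x) = (LINT \<omega>|M. LINT x|lborel. g (x + z \<omega>) * h x)"
proof -
  interpret M: prob_space M by fact
  interpret P: pair_sigma_finite lborel M ..
  show ?thesis
    using P.Fubini_integral[OF bsfun_pair_integrable[OF M z _ b g h, of "\<lambda>_. 0"]]
    by (simp add: avg_def)
qed

lemma avg_adjoint:
  assumes M: "prob_space M" and z[measurable]: "z \<in> borel_measurable M" and b: "\<And>\<omega>. norm (z \<omega>) \<le> Z"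
    and g: "bsfun g" and h: "bsfun h"
  shows "(LINT x|lborel. avg M z g x * h x) = (LINT x|lborel. g x * avg M (\<lambda>\<omega>. - z \<omega>) h x)"
proof -
  have [measurable]: "g \<in> borel_measurable borel" "h \<in> borel_measurable borel"
    using g h by (auto dest: bsfunD bfun_measurable)
  have "(LINT x|lborel. avg M z g x * h x) = (LINT \<omega>|M. LINT x|lborel. g (x + z \<omega>) * h x)"
    by (rule integral_avg_mult[OF M z b g bsfunD[OF h]])
  also have "\<dots> = (LINT \<omega>|M. LINT x|lborel. h (x + - z \<omega>) * g x)"
  proof (rule Bochner_Integration.integral_cong[OF refl])
    fix \<omega>
    show "(LINT x|lborel. g (x + z \<omega>) * h x) = (LINT x|lborel. h (x + - z \<omega>) * g x)"
      using integral_translate[of "\<lambda>x. g (x + z \<omega>) * h x" "- z \<omega>"] by (simp add: mult.commute)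
  qed
  also have "\<dots> = (LINT x|lborel. avg M (\<lambda>\<omega>. - z \<omega>) h x * g x)"
    by (rule integral_avg_mult[OF M _ _ h bsfunD[OF g], symmetric]) (use b in auto)
  finally show ?thesis by (simp add: mult.commute)
qed

text \<open>The adjoint of translation by \<open>z\<close> is translation by \<open>- z\<close>.
  Symmetry of the law is expressed through integrals of bounded Borel functions, the form in which
  it is later obtained by exchanging two integration variables.\<close>

lemma avg_self_adjoint:
  assumes M: "prob_space M" and z: "z \<in> borel_measurable M" and b: "\<And>\<omega>. norm (z \<omega>) \<le> Z"
    and sym: "\<And>f. bfun f \<Longrightarrow> (LINT \<omega>|M. f (z \<omega>)) = (LINT \<omega>|M. f (- z \<omega>))"
    and g: "bsfun g" and h: "bsfun h"
  shows "(LINT x|lborel. avg M z g x * h x) = (LINT x|lborel. g x * avg M z h x)"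
proof -
  have "bfun (\<lambda>t. h (x + t))" for x using bfun_shift[OF bsfunD[OF h], of x] by (simp add: add.commute)
  from sym[OF this] have "avg M (\<lambda>\<omega>. - z \<omega>) h = avg M z h" by (simp add: avg_def fun_eq_iff)
  with avg_adjoint[OF M z b g h] show ?thesis by simp
qed

lemma integral_Cauchy_Schwarz:
  fixes f g :: "'b \<Rightarrow> real"
  assumes "integrable M (\<lambda>x. f x * f x)" "integrable M (\<lambda>x. g x * g x)" "integrable M (\<lambda>x. f x * g x)"
  shows "(LINT x|M. f x * g x)\<^sup>2 \<le> (LINT x|M. f x * f x) * (LINT x|M. g x * g x)"
proof -
  define a b c where "a = (LINT x|M. f x * f x)" and "b = (LINT x|M. f x * g x)" and "c = (LINT x|M. g x * g x)"
  have nn: "0 \<le> a" "0 \<le> c" unfolding a_def c_def by (auto intro: integral_nonneg_AE)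
  have q: "0 \<le> s\<^sup>2 * a - 2 * s * t * b + t\<^sup>2 * c" for s t
  proof -
    have "0 \<le> (LINT x|M. (s * f x - t * g x)\<^sup>2)" by simp
    also have "\<dots> = (LINT x|M. s\<^sup>2 * (f x * f x) - 2 * s * t * (f x * g x) + t\<^sup>2 * (g x * g x))"
      by (intro Bochner_Integration.integral_cong) (auto simp: power2_eq_square algebra_simps)
    also have "\<dots> = s\<^sup>2 * a - 2 * s * t * b + t\<^sup>2 * c"
      using assms by (simp add: a_def b_def c_def)
    finally show ?thesis .
  qed
  have "b\<^sup>2 \<le> a * c"
  proof (cases "c = 0")
    case True
    \<comment> \<open>If \<open>c = 0\<close> and \<open>b\<close> were nonzero, this choice would
      make the quadratic form equal to -1.\<close>
    with q[of 1 "(a + 1) / (2 * b)"] have "b = 0" using nn by (cases "b = 0") auto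
    with True show ?thesis by simp
  next
    case False
    then have "0 \<le> c * (a * c - b\<^sup>2)" using q[of c b] by (simp add: power2_eq_square algebra_simps)
    with False nn show ?thesis by (simp add: zero_le_mult_iff)
  qed
  then show ?thesis by (simp add: a_def b_def c_def)
qed

text \<open>For the self-adjoint operator T = \<open>avg M z\<close> put b n = <g, T^n g>.
  Cauchy--Schwarz gives (b n)^2 \<le> b 0 * b (2 n), because b (2 n) is the squared norm of T^n g;
  start from b 1 and square \<open>m\<close> times.\<close>

lemma avg_power_bound:
  assumes M: "prob_space M" and z: "z \<in> borel_measurable M" and b: "\<And>\<omega>. norm (z \<omega>) \<le> Z"
    and sym: "\<And>f. bfun f \<Longrightarrow> (LINT \<omega>|M. f (z \<omega>)) = (LINT \<omega>|M. f (- z \<omega>))"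
    and g: "bsfun g"
  shows "\<bar>LINT x|lborel. g x * avg M z g x\<bar> ^ (2 ^ m) \<le>
    (LINT x|lborel. g x * g x) ^ (2 ^ m - 1) * \<bar>LINT x|lborel. g x * (avg M z ^^ (2 ^ m)) g x\<bar>"
proof (induction m)
  case 0
  then show ?case by simp
next
  case (Suc m)
  define b where "b n = (LINT x|lborel. g x * (avg M z ^^ n) g x)" for n
  have T: "bsfun ((avg M z ^^ n) g)" for n
    by (induction n) (auto intro: g bsfun_avg[OF M z assms(3)])
  have b2: "(LINT x|lborel. (avg M z ^^ n) g x * (avg M z ^^ k) g x) = b (n + k)" for n k
  proof (induction n arbitrary: k)
    case (Suc n)
    have "(LINT x|lborel. (avg M z ^^ Suc n) g x * (avg M z ^^ k) g x) =
        (LINT x|lborel. (avg M z ^^ n) g x * (avg M z ^^ Suc k) g x)"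
      using avg_self_adjoint[OF M z assms(3) sym T T] by simp
    with Suc[of "Suc k"] show ?case by simp
  qed (simp add: b_def)
  have prod: "integrable lborel (\<lambda>x. (avg M z ^^ n) g x * (avg M z ^^ k) g x)" for n k
    by (intro bsfun_integrable bsfun_mult bsfunD T)
  have sq: "\<bar>b n\<bar>\<^sup>2 \<le> b 0 * \<bar>b (n + n)\<bar>" for n
  proof -
    have "(b n)\<^sup>2 \<le> b 0 * b (n + n)"
      using integral_Cauchy_Schwarz[OF prod[of 0 0] prod[of n n] prod[of 0 n]] b2[of n n] b2[of 0 0] b2[of 0 n]
      by (simp only: add_0)
    also have "\<dots> \<le> b 0 * \<bar>b (n + n)\<bar>" by (intro mult_left_mono) (auto simp: b_def)
    finally show ?thesis by simp
  qed
  have "\<bar>b 1\<bar> ^ (2 ^ Suc m) = (\<bar>b 1\<bar> ^ (2 ^ m))\<^sup>2" by (simp add: power_mult[symmetric] mult.commute)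
  also have "\<dots> \<le> (b 0 ^ (2 ^ m - 1) * \<bar>b (2 ^ m)\<bar>)\<^sup>2"
    using Suc by (intro power_mono) (simp_all add: b_def)
  also have "\<dots> = (b 0 ^ (2 ^ m - 1))\<^sup>2 * \<bar>b (2 ^ m)\<bar>\<^sup>2" by (simp add: power_mult_distrib)
  also have "\<dots> \<le> (b 0 ^ (2 ^ m - 1))\<^sup>2 * (b 0 * \<bar>b (2 ^ m + 2 ^ m)\<bar>)"
    by (intro mult_left_mono sq) simp
  also have "\<dots> = b 0 ^ (2 ^ Suc m - 1) * \<bar>b (2 ^ Suc m)\<bar>"
  proof -
    have "(2::nat) ^ Suc m - 1 = (2 ^ m - 1) * 2 + 1"
      using one_le_power[of "2::nat" m] unfolding power_Suc by linarith
    then show ?thesis by (simp only: power_add power_mult power_one_right mult.assoc mult_2[symmetric] power_Suc)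
  qed
  finally show ?case by (simp add: b_def)
qed

subsection \<open>Averaging over genuinely nonlinear velocities\<close>

text \<open>Growth of the Lipschitz constant when a direction \<open>a v\<close> joins the subspace.
  A vector y splits as w + t (a v) with |t| \<le> |y| / \<eta>, hence |w| \<le> (1 + K / \<eta>)
  |y|; the old constant acts on w and the constant \<kappa> of averaging in one direction acts on t.
  The update precedes the recursive call because a direction is absorbed into the function before
  the remaining averages are applied.\<close>

fun lip_const :: "real \<Rightarrow> real \<Rightarrow> real \<Rightarrow> nat \<Rightarrow> real \<Rightarrow> real" where
  "lip_const K \<eta> \<kappa> 0 L = L"
| "lip_const K \<eta> \<kappa> (Suc k) L = lip_const K \<eta> \<kappa> k ((1 + K / \<eta>) * L + \<kappa> / \<eta>)"

text \<open>Averaging \<open>k\<close> more times, each time in a random direction, turns Lipschitz continuity along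
  a subspace of codimension \<open>k\<close> into Lipschitz continuity in all directions, apart from an error
  that accounts for the velocities almost orthogonal to a normal of the current subspace.\<close>

lemma avg_smoothing:
  fixes a :: "'v \<Rightarrow> 'a::euclidean_space" and c :: "'w \<Rightarrow> real"
  assumes V: "prob_space V" and N: "prob_space N"
    and am[measurable]: "a \<in> borel_measurable V" and cm[measurable]: "c \<in> borel_measurable N"
    and K: "\<And>v. norm (a v) \<le> K"
    and \<kappa>: "\<And>r t. bfun r \<Longrightarrow> (\<And>s. \<bar>r s\<bar> \<le> 1) \<Longrightarrow>
      \<bar>(LINT \<omega>|N. r (c \<omega> + t)) - (LINT \<omega>|N. r (c \<omega>))\<bar> \<le> \<kappa> * \<bar>t\<bar>"
    and \<eta>: "0 < \<eta>"
    and p: "\<And>\<xi>. norm \<xi> = 1 \<Longrightarrow> measure V {v \<in> space V. \<bar>a v \<bullet> \<xi>\<bar> < \<eta>} \<le> p"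
  shows "subspace W \<Longrightarrow> dim W + k = DIM('a) \<Longrightarrow> bfun R \<Longrightarrow> (\<And>x. \<bar>R x\<bar> \<le> 1) \<Longrightarrow> 0 \<le> L \<Longrightarrow>
    (\<And>x y. y \<in> W \<Longrightarrow> \<bar>R (x + y) - R x\<bar> \<le> L * norm y) \<Longrightarrow>
    \<bar>(avg (V \<Otimes>\<^sub>M N) (\<lambda>(v, \<omega>). c \<omega> *\<^sub>R a v) ^^ k) R (x + y) - (avg (V \<Otimes>\<^sub>M N) (\<lambda>(v, \<omega>). c \<omega> *\<^sub>R a v) ^^ k) R x\<bar>
      \<le> lip_const K \<eta> \<kappa> k L * norm y + 2 * real k * p"
proof (induction k arbitrary: W R L x y)
  case 0
  then have "W = UNIV" using dim_eq_full[of W] span_eq_iff[of W] by auto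
  with 0 show ?case by simp
next
  case (Suc k)
  interpret V: prob_space V by fact
  interpret N: prob_space N by fact
  interpret VN: pair_prob_space V N ..
  let ?T = "avg (V \<Otimes>\<^sub>M N) (\<lambda>(v, \<omega>). c \<omega> *\<^sub>R a v)"
  define B where "B v = avg N (\<lambda>\<omega>. c \<omega> *\<^sub>R a v)" for v
  have VNp: "prob_space (V \<Otimes>\<^sub>M N)" by (rule VN.prob_space_axioms)
  have [measurable]: "(\<lambda>(v, \<omega>). c \<omega> *\<^sub>R a v) \<in> borel_measurable (V \<Otimes>\<^sub>M N)" by measurable
  have Tb: "bfun ((?T ^^ n) S)" if "bfun S" for n S
    using that by (induction n) (auto intro!: bfun_avg[OF VNp])
  have Tb1: "\<bar>(?T ^^ n) S x\<bar> \<le> 1" if "\<And>x. \<bar>S x\<bar> \<le> 1" for n S x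
    using that by (induction n arbitrary: x) (auto intro!: avg_bound[OF VNp])
  \<comment> \<open>The average in a single direction commutes with the full averages, so it can be
    moved onto the innermost function.\<close>
  have BT: "B v ((?T ^^ n) S) = (?T ^^ n) (B v S)" if "bfun S" for v n S
  proof (induction n)
    case (Suc n)
    have "B v ((?T ^^ Suc n) S) = ?T (B v ((?T ^^ n) S))"
      unfolding B_def by (simp add: avg_commute[OF N VNp _ _ Tb[OF that]])
    with Suc show ?case by simp
  qed simp
  \<comment> \<open>Conditioning on the velocity of one average: for fixed \<open>v\<close> the
    remaining \<open>k\<close> averages act on \<open>B v R\<close>, to which the induction
    hypothesis applies with a larger subspace.\<close>
  have TR: "(?T ^^ Suc k) R x = (LINT v|V. (?T ^^ k) (B v R) x)" for x
    using avg_pair[OF V N _ Tb[OF \<open>bfun R\<close>], of "\<lambda>v \<omega>. c \<omega> *\<^sub>R a v" k x] BT[OF \<open>bfun R\<close>]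
    by (simp add: B_def)
  have intT: "integrable V (\<lambda>v. (?T ^^ k) (B v R) x)" for x
  proof -
    have [measurable]: "(?T ^^ k) R \<in> borel_measurable borel" using Tb[OF \<open>bfun R\<close>] by (rule bfun_measurable)
    have "integrable V (\<lambda>v. LINT \<omega>|N. (?T ^^ k) R (x + c \<omega> *\<^sub>R a v))"
    proof (rule V.integrable_const_bound[where B = 1])
      show "AE v in V. norm (LINT \<omega>|N. (?T ^^ k) R (x + c \<omega> *\<^sub>R a v)) \<le> 1"
        using N.integral_le_bound Tb1[of R, OF Suc.prems(4)] by (auto intro!: AE_I2)
    qed measurable
    then show ?thesis
      unfolding BT[OF \<open>bfun R\<close>, symmetric] by (simp add: B_def avg_def[of N])
  qed
  \<comment> \<open>Choose a unit normal \<xi> of the current subspace. Velocities with normal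
    component at least \<eta> enlarge the subspace in a quantified way; all others have probability
    at most \<open>p\<close>.\<close>
  have "dim W < DIM('a)" using Suc.prems(2) by simp
  then obtain \<xi>0 where \<xi>0: "\<xi>0 \<noteq> 0" "\<And>w. w \<in> span W \<Longrightarrow> orthogonal \<xi>0 w"
    using orthogonal_to_subspace_exists by blast
  define \<xi> where "\<xi> = \<xi>0 /\<^sub>R norm \<xi>0"
  have \<xi>: "norm \<xi> = 1" "\<And>w. w \<in> W \<Longrightarrow> w \<bullet> \<xi> = 0"
    using \<xi>0 by (auto simp: \<xi>_def orthogonal_def inner_commute span_base)
  define bad where "bad = {v \<in> space V. \<bar>a v \<bullet> \<xi>\<bar> < \<eta>}"
  have [measurable]: "bad \<in> sets V" unfolding bad_def by measurable
  let ?L = "(1 + K / \<eta>) * L + \<kappa> / \<eta>"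
  have "0 \<le> K" using order_trans[OF norm_ge_zero K] .
  have "0 \<le> \<kappa>" using \<kappa>[of "\<lambda>_. 0" 1] by (auto simp: bfun_def)
  have L': "0 \<le> ?L" using \<open>0 \<le> K\<close> \<open>0 \<le> \<kappa>\<close> \<eta> Suc.prems(5) by simp
  have "0 \<le> p" using p[OF \<xi>(1)] measure_nonneg order_trans by blast
  have lipk: "0 \<le> l \<Longrightarrow> 0 \<le> lip_const K \<eta> \<kappa> j l" for j l
    using \<open>0 \<le> K\<close> \<open>0 \<le> \<kappa>\<close> \<eta> by (induction j arbitrary: l) auto
  have Bb: "bfun (B v R)" "\<bar>B v R x\<bar> \<le> 1" for v x
    unfolding B_def by (auto intro!: bfun_avg avg_bound N Suc.prems)
  have good: "\<bar>(?T ^^ k) (B v R) (x + y) - (?T ^^ k) (B v R) x\<bar>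
      \<le> lip_const K \<eta> \<kappa> k ?L * norm y + 2 * real k * p" if v: "\<not> \<bar>a v \<bullet> \<xi>\<bar> < \<eta>" for v
  proof (rule Suc.IH[where W = "span (insert (a v) W)"])
    show "subspace (span (insert (a v) W))" by simp
    have "span W = W" using Suc.prems(1) by (simp add: span_eq_iff)
    moreover have "a v \<notin> W" using \<xi>(2)[of "a v"] v \<eta> by auto
    ultimately have "a v \<notin> span W" by metis
    then show "dim (span (insert (a v) W)) + k = DIM('a)"
      using Suc.prems(2) by (simp add: dim_insert)
    show "bfun (B v R)" "\<And>x. \<bar>B v R x\<bar> \<le> 1" by (rule Bb)+
    show "0 \<le> ?L" by (rule L')
    fix x y assume "y \<in> span (insert (a v) W)"
    then obtain t where "y - t *\<^sub>R a v \<in> span W" unfolding span_breakdown_eq by blast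
    then have w: "y - t *\<^sub>R a v \<in> W" using Suc.prems(1) by (simp add: span_eq_iff[THEN iffD2])
    define w where "w = y - t *\<^sub>R a v"
    have y: "y = w + t *\<^sub>R a v" by (simp add: w_def)
    have "y \<bullet> \<xi> = t * (a v \<bullet> \<xi>)" using \<xi>(2)[OF w] by (simp add: inner_diff_left)
    then have "\<bar>t\<bar> * \<bar>a v \<bullet> \<xi>\<bar> \<le> norm y"
      using Cauchy_Schwarz_ineq2[of y \<xi>] \<xi>(1) by (simp add: abs_mult)
    then have "\<bar>t\<bar> * \<eta> \<le> norm y" using v by (smt (verit) mult_left_mono abs_ge_zero)
    then have t: "\<bar>t\<bar> \<le> norm y / \<eta>" using \<eta> by (simp add: pos_le_divide_eq)
    have "norm w \<le> norm y + \<bar>t\<bar> * norm (a v)"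
      unfolding w_def using norm_triangle_ineq4[of y "t *\<^sub>R a v"] by simp
    also have "\<dots> \<le> norm y + norm y / \<eta> * K" using t K \<eta> by (intro add_left_mono mult_mono) auto
    finally have nw: "norm w \<le> (1 + K / \<eta>) * norm y" by (simp add: algebra_simps)
    have "\<bar>B v R (x + t *\<^sub>R a v + w) - B v R (x + t *\<^sub>R a v)\<bar> \<le> L * norm w"
    proof -
      have "B v R (x + t *\<^sub>R a v + w) - B v R (x + t *\<^sub>R a v) =
        (LINT \<omega>|N. R (x + t *\<^sub>R a v + w + c \<omega> *\<^sub>R a v) - R (x + t *\<^sub>R a v + c \<omega> *\<^sub>R a v))"
        unfolding B_def avg_def
        by (rule Bochner_Integration.integral_diff[symmetric]) (intro N.integrable_bfun[OF Suc.prems(3)]; measurable)+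
      also have "\<bar>\<dots>\<bar> \<le> L * norm w"
      proof (rule N.integral_le_bound)
        fix \<omega>
        show "\<bar>R (x + t *\<^sub>R a v + w + c \<omega> *\<^sub>R a v) - R (x + t *\<^sub>R a v + c \<omega> *\<^sub>R a v)\<bar> \<le> L * norm w"
          using Suc.prems(6)[OF w, of "x + t *\<^sub>R a v + c \<omega> *\<^sub>R a v"] by (simp add: w_def[symmetric] algebra_simps)
      qed
      finally show ?thesis .
    qed
    moreover have "\<bar>B v R (x + t *\<^sub>R a v) - B v R x\<bar> \<le> \<kappa> * \<bar>t\<bar>"
    proof -
      have "bfun (\<lambda>s. R (x + s *\<^sub>R a v))"
        using Suc.prems(3,4) unfolding bfun_def by (auto intro!: exI[of _ 1])
      from \<kappa>[OF this Suc.prems(4), of t] show ?thesis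
        by (simp add: B_def avg_def algebra_simps)
    qed
    ultimately have "\<bar>B v R (x + y) - B v R x\<bar> \<le> L * norm w + \<kappa> * \<bar>t\<bar>"
      unfolding y by (simp add: algebra_simps)
    also have "\<dots> \<le> L * ((1 + K / \<eta>) * norm y) + \<kappa> * (norm y / \<eta>)"
      using nw t \<open>0 \<le> \<kappa>\<close> Suc.prems(5) by (intro add_mono mult_left_mono) auto
    finally show "\<bar>B v R (x + y) - B v R x\<bar> \<le> ?L * norm y" by (simp add: algebra_simps)
  qed
  let ?E = "lip_const K \<eta> \<kappa> k ?L * norm y + 2 * real k * p"
  have "0 \<le> ?E" using lipk[OF L'] \<open>0 \<le> p\<close> by simp
  have "\<bar>(?T ^^ Suc k) R (x + y) - (?T ^^ Suc k) R x\<bar> =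
      \<bar>LINT v|V. (?T ^^ k) (B v R) (x + y) - (?T ^^ k) (B v R) x\<bar>"
    unfolding TR by (simp add: Bochner_Integration.integral_diff[OF intT intT])
  also have "\<dots> \<le> (LINT v|V. \<bar>(?T ^^ k) (B v R) (x + y) - (?T ^^ k) (B v R) x\<bar>)"
    by (rule integral_abs_bound)
  \<comment> \<open>Bad velocities are charged the trivial bound \<open>2\<close>; repeated
    \<open>k\<close> times, this is the error \<open>2 * real k * p\<close>.\<close>
  also have "\<dots> \<le> (LINT v|V. ?E + 2 * indicator bad v)"
  proof (rule integral_mono)
    show "integrable V (\<lambda>v. ?E + 2 * indicator bad v)"
      by (intro Bochner_Integration.integrable_add integrable_mult_right integrable_real_indicator)
        (auto simp: V.emeasure_eq_measure)
    fix v assume "v \<in> space V"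
    show "\<bar>(?T ^^ k) (B v R) (x + y) - (?T ^^ k) (B v R) x\<bar> \<le> ?E + 2 * indicator bad v"
    proof (cases "v \<in> bad")
      case True
      then show ?thesis using Tb1[of "B v R", OF Bb(2), of k "x + y"] Tb1[of "B v R", OF Bb(2), of k x] \<open>0 \<le> ?E\<close>
        by simp
    next
      case False
      then show ?thesis using good \<open>v \<in> space V\<close> by (simp add: bad_def)
    qed
  qed (intro integrable_abs Bochner_Integration.integrable_diff intT)
  also have "\<dots> = ?E + 2 * measure V bad"
    by (subst Bochner_Integration.integral_add) (auto simp: V.prob_space V.emeasure_eq_measure)
  also have "\<dots> \<le> ?E + 2 * p" using p[OF \<xi>(1)] by (simp add: bad_def)
  finally show ?case by (simp add: algebra_simps)
qed

lemma lip_const_le: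
  assumes "0 \<le> K" "0 < \<eta>" "\<eta> \<le> 1" "0 \<le> \<kappa>" "0 \<le> L"
  shows "lip_const K \<eta> \<kappa> k L \<le> ((1 + K) / \<eta>) ^ k * (L + real k * \<kappa> / \<eta>)"
  using assms(5)
proof (induction k arbitrary: L)
  case (Suc k)
  let ?r = "(1 + K) / \<eta>"
  have r: "1 + K / \<eta> \<le> ?r" "1 \<le> ?r" using assms by (auto simp: field_simps)
  have "lip_const K \<eta> \<kappa> (Suc k) L \<le> ?r ^ k * ((1 + K / \<eta>) * L + \<kappa> / \<eta> + real k * \<kappa> / \<eta>)"
    using Suc.IH[of "(1 + K / \<eta>) * L + \<kappa> / \<eta>"] Suc.prems assms by simp
  also have "\<dots> \<le> ?r ^ k * (?r * L + ?r * (\<kappa> / \<eta> + real k * \<kappa> / \<eta>))"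
  proof (rule mult_left_mono)
    have "(1 + K / \<eta>) * L \<le> ?r * L" using r Suc.prems by (intro mult_right_mono) auto
    moreover have "1 * (\<kappa> / \<eta> + real k * \<kappa> / \<eta>) \<le> ?r * (\<kappa> / \<eta> + real k * \<kappa> / \<eta>)"
      using r assms by (intro mult_right_mono) auto
    ultimately show "(1 + K / \<eta>) * L + \<kappa> / \<eta> + real k * \<kappa> / \<eta> \<le> ?r * L + ?r * (\<kappa> / \<eta> + real k * \<kappa> / \<eta>)"
      unfolding add.assoc[of "(1 + K / \<eta>) * L"] mult_1 by (rule add_mono)
  qed (use assms in auto)
  also have "\<dots> = ?r ^ Suc k * (L + real (Suc k) * \<kappa> / \<eta>)"
    by (simp add: algebra_simps add_divide_distrib)
  finally show ?case .
qed simp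

lemma prob_space_uniform_interval:
  "k < l \<Longrightarrow> prob_space (uniform_measure lborel {k..l::real})"
  by (rule prob_space_uniform_measure) (auto simp: ennreal_eq_0_iff)

lemma integral_uniform_interval:
  fixes f :: "real \<Rightarrow> real"
  assumes [measurable]: "f \<in> borel_measurable borel" and "k < l"
  shows "(LINT x|uniform_measure lborel {k..l}. f x) = (LINT x|lborel. indicator {k..l} x * f x) / (l - k)"
proof -
  have "uniform_measure lborel {k..l} = density lborel (\<lambda>x. ennreal (indicator {k..l} x / (l - k)))"
    unfolding uniform_measure_def using \<open>k < l\<close>
    by (intro density_cong)
      (auto simp: indicator_def divide_ennreal ennreal_1[symmetric] simp del: ennreal_1)
  then have "(LINT x|uniform_measure lborel {k..l}. f x) = (LINT x|lborel. (indicator {k..l} x / (l - k)) *\<^sub>R f x)"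
    using \<open>k < l\<close> by (simp add: integral_density)
  then show ?thesis by simp
qed

text \<open>The two integrals differ only on the symmetric difference of an interval and its
  translate, which lies within distance |t| of the two end points. This is the smoothing supplied by
  one average over \<open>s\<close>.\<close>

lemma uniform_interval_shift:
  assumes r: "bfun r" "\<And>s. \<bar>r s\<bar> \<le> 1" and "0 < S"
  shows "\<bar>(LINT s|uniform_measure lborel {-S..S}. r (s + t)) - (LINT s|uniform_measure lborel {-S..S}. r s)\<bar> \<le> 2 / S * \<bar>t\<bar>"
proof -
  have [measurable]: "r \<in> borel_measurable borel" using r(1) by (rule bfun_measurable)
  have int: "integrable lborel (\<lambda>s. indicator {k..l} s * r s)" for k l
    by (rule integrable_bounded_support[where C = 1 and R = "max \<bar>k\<bar> \<bar>l\<bar>"])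
      (use r(2) in \<open>auto simp: indicator_def split: if_splits\<close>)
  have "(LINT s|lborel. indicator {-S..S} s * r (s + t)) = (LINT s|lborel. indicator {-S+t..S+t} s * r s)"
    using integral_translate[of "\<lambda>s. indicator {-S+t..S+t} s * r s" t] by (simp add: indicator_def)
  then have "(LINT s|uniform_measure lborel {-S..S}. r (s + t)) - (LINT s|uniform_measure lborel {-S..S}. r s)
     = (LINT s|lborel. indicator {-S+t..S+t} s * r s - indicator {-S..S} s * r s) / (2 * S)"
    using \<open>0 < S\<close> Bochner_Integration.integral_diff[OF int int, of "-S+t" "S+t" "-S" S]
    by (simp add: integral_uniform_interval diff_divide_distrib)
  also have "\<bar>\<dots>\<bar> \<le> (4 * \<bar>t\<bar>) / (2 * S)"
  proof -
    have "\<bar>LINT s|lborel. indicator {-S+t..S+t} s * r s - indicator {-S..S} s * r s\<bar> \<le>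
       (LINT s|lborel. \<bar>indicator {-S+t..S+t} s * r s - indicator {-S..S} s * r s\<bar>)" by (rule integral_abs_bound)
    also have "\<dots> \<le> (LINT s|lborel. indicator {-S-\<bar>t\<bar>..-S+\<bar>t\<bar>} s + indicator {S-\<bar>t\<bar>..S+\<bar>t\<bar>} s)"
    proof (rule integral_mono')
      show "integrable lborel (\<lambda>s. indicator {-S-\<bar>t\<bar>..-S+\<bar>t\<bar>} s + indicator {S-\<bar>t\<bar>..S+\<bar>t\<bar>} s :: real)"
        by (intro Bochner_Integration.integrable_add integrable_real_indicator) auto
      fix s
      show "\<bar>indicator {-S+t..S+t} s * r s - indicator {-S..S} s * r s\<bar> \<le> indicator {-S-\<bar>t\<bar>..-S+\<bar>t\<bar>} s + indicator {S-\<bar>t\<bar>..S+\<bar>t\<bar>} s"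
        using r(2)[of s] by (auto simp: indicator_def)
    qed simp
    also have "\<dots> = 4 * \<bar>t\<bar>"
      by (subst Bochner_Integration.integral_add) auto
    finally show ?thesis using \<open>0 < S\<close> by (simp add: abs_divide field_simps)
  qed
  finally show ?thesis using \<open>0 < S\<close> by (simp add: field_simps)
qed

text \<open>Mollification is itself an average of translations, so \<open>avg_commute\<close> moves
  it through every other average.\<close>

lemma mollify_eq_avg:
  fixes h :: "real^'n \<Rightarrow> real"
  assumes [measurable]: "h \<in> borel_measurable borel" and "0 < \<sigma>"
  shows "mollify h \<sigma> = avg (density lborel bump) (\<lambda>z. - (\<sigma> *\<^sub>R z)) h"
  unfolding avg_def fun_eq_iff
  by (simp add: mollify_eq[OF assms] integral_density bump_nonneg mult.commute)

lemma prob_space_bump: "prob_space (density lborel (bump :: real^'n \<Rightarrow> real))"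
proof
  have "emeasure (density lborel (bump :: real^'n \<Rightarrow> real)) UNIV = (\<integral>\<^sup>+x. ennreal (bump (x::real^'n)) \<partial>lborel)"
    by (subst emeasure_density) auto
  also have "\<dots> = 1"
    by (subst nn_integral_eq_integral) (auto simp: integrable_bump integral_bump bump_nonneg)
  finally show "emeasure (density lborel (bump :: real^'n \<Rightarrow> real)) (space (density lborel bump)) = 1" by simp
qed

lemma bfun_mollify:
  fixes h :: "real^'n \<Rightarrow> real"
  assumes "bfun h" "0 < \<sigma>" shows "bfun (mollify h \<sigma>)"
  unfolding mollify_eq_avg[OF bfun_measurable[OF assms(1)] assms(2)]
  by (rule bfun_avg[OF prob_space_bump]) (use assms in auto)

lemma bsfun_mollify:
  fixes h :: "real^'n \<Rightarrow> real"
  assumes "bsfun h" "0 < \<sigma>" shows "bsfun (mollify h \<sigma>)"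
  using bfun_mollify[OF bsfunD[OF assms(1)] assms(2)] assms mollify_support
  unfolding bsfun_def by metis

lemma bsfun_diff: "bsfun f \<Longrightarrow> bsfun g \<Longrightarrow> bsfun (\<lambda>x. f x - g x)"
proof -
  assume f: "bsfun f" and g: "bsfun g"
  obtain C D where CD: "\<And>x. \<bar>f x\<bar> \<le> C" "\<And>x. \<bar>g x\<bar> \<le> D"
    using bfunE[OF bsfunD[OF f]] bfunE[OF bsfunD[OF g]] by metis
  obtain R Q where RQ: "\<And>x. R < norm x \<Longrightarrow> f x = 0" "\<And>x. Q < norm x \<Longrightarrow> g x = 0"
    using f g by (auto simp: bsfun_def)
  have "\<bar>f x - g x\<bar> \<le> C + D" for x using CD(1)[of x] CD(2)[of x] by linarith
  moreover have "f x - g x = 0" if "max R Q < norm x" for x using RQ that by simp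
  ultimately show ?thesis using f g unfolding bsfun_def bfun_def
    by (intro conjI borel_measurable_diff) blast+
qed

lemma avg_power_diff:
  assumes M: "prob_space M" and z[measurable]: "z \<in> borel_measurable M" and "bfun f" "bfun g"
  shows "(avg M z ^^ n) (\<lambda>x. f x - g x) = (\<lambda>x. (avg M z ^^ n) f x - (avg M z ^^ n) g x)"
proof (induction n)
  case (Suc n)
  interpret prob_space M by fact
  have b: "bfun ((avg M z ^^ n) h)" if "bfun h" for h
    using that by (induction n) (auto intro: bfun_avg[OF M z])
  have int: "integrable M (\<lambda>\<omega>. (avg M z ^^ n) h (x + z \<omega>))" if "bfun h" for h x
    by (rule integrable_bfun[OF b[OF that]]) measurable
  have "avg M z (\<lambda>x. (avg M z ^^ n) f x - (avg M z ^^ n) g x) x =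
      avg M z ((avg M z ^^ n) f) x - avg M z ((avg M z ^^ n) g) x" for x
    unfolding avg_def[of M z "\<lambda>x. _ x - _ x"] avg_def[of M z "(avg M z ^^ n) _"]
    by (rule Bochner_Integration.integral_diff[OF int[OF assms(3)] int[OF assms(4)]])
  then show ?case unfolding funpow.simps o_apply Suc fun_eq_iff by blast
qed simp

lemma avg_power_mollify:
  fixes h :: "real^'n \<Rightarrow> real"
  assumes M: "prob_space M" and z[measurable]: "z \<in> borel_measurable M" and "bfun h" "0 < \<sigma>"
  shows "(avg M z ^^ n) (mollify h \<sigma>) = mollify ((avg M z ^^ n) h) \<sigma>"
proof (induction n)
  case (Suc n)
  have b: "bfun ((avg M z ^^ n) h)" for n
    using assms(3) by (induction n) (auto intro: bfun_avg[OF M z])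
  have "(avg M z ^^ Suc n) (mollify h \<sigma>) = avg M z (mollify ((avg M z ^^ n) h) \<sigma>)" using Suc by simp
  also have "\<dots> = mollify (avg M z ((avg M z ^^ n) h)) \<sigma>"
    using b[of n] b[of "Suc n"] \<open>0 < \<sigma>\<close>
    by (simp add: mollify_eq_avg bfun_measurable avg_commute[OF M prob_space_bump])
  finally show ?case by simp
qed simp

text \<open>After \<open>d\<close> averages \<open>h\<close> is Lipschitz up to the error
  \<open>B\<close>, so mollifying it at a scale at most \<tau> moves it by at most A \<tau> + B.
  Mollification commutes with the averages, and the remaining \<open>n - d\<close> averages do not
  increase the supremum.\<close>

lemma mollify_difference_decay:
  fixes h :: "real^'n \<Rightarrow> real"
  assumes M: "prob_space M" and z[measurable]: "z \<in> borel_measurable M" and h: "bfun h" "\<And>x. \<bar>h x\<bar> \<le> 1"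
    and near: "\<And>x y. \<bar>(avg M z ^^ d) h (x + y) - (avg M z ^^ d) h x\<bar> \<le> A * norm y + B"
    and "0 \<le> A" "0 < \<sigma>" "\<sigma> \<le> \<tau>" "0 < \<sigma>'" "\<sigma>' \<le> \<tau>" "d \<le> n"
  shows "\<bar>(avg M z ^^ n) (\<lambda>x. mollify h \<sigma> x - mollify h \<sigma>' x) x\<bar> \<le> 2 * (A * \<tau> + B)"
proof -
  have b: "bfun ((avg M z ^^ n) h)" for n
    using h(1) by (induction n) (auto intro: bfun_avg[OF M z])
  have b1: "\<bar>(avg M z ^^ n) h x\<bar> \<le> 1" for n x
    by (induction n arbitrary: x) (auto intro!: avg_bound[OF M] h(2))
  have m: "\<bar>mollify ((avg M z ^^ d) h) s x - (avg M z ^^ d) h x\<bar> \<le> A * \<tau> + B" if "0 < s" "s \<le> \<tau>" for s x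
  proof (rule mollify_near[OF bfun_measurable[OF b] b1 _ \<open>0 < s\<close>])
    fix y assume y: "dist x y \<le> s"
    have "\<bar>(avg M z ^^ d) h y - (avg M z ^^ d) h x\<bar> \<le> A * norm (y - x) + B" using near[of x "y - x"] by simp
    also have "\<dots> \<le> A * \<tau> + B"
      using y that \<open>0 \<le> A\<close> by (intro add_right_mono mult_left_mono) (auto simp: dist_norm norm_minus_commute)
    finally show "\<bar>(avg M z ^^ d) h y - (avg M z ^^ d) h x\<bar> \<le> A * \<tau> + B" .
  qed
  have d: "\<bar>(avg M z ^^ d) (\<lambda>x. mollify h \<sigma> x - mollify h \<sigma>' x) x\<bar> \<le> 2 * (A * \<tau> + B)" for x
    using m[OF \<open>0 < \<sigma>\<close> \<open>\<sigma> \<le> \<tau>\<close>, of x] m[OF \<open>0 < \<sigma>'\<close> \<open>\<sigma>' \<le> \<tau>\<close>, of x]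
    unfolding avg_power_diff[OF M z bfun_mollify[OF h(1) \<open>0 < \<sigma>\<close>] bfun_mollify[OF h(1) \<open>0 < \<sigma>'\<close>]]
      avg_power_mollify[OF M z h(1) \<open>0 < \<sigma>\<close>] avg_power_mollify[OF M z h(1) \<open>0 < \<sigma>'\<close>]
    by (smt (verit))
  have "\<bar>(avg M z ^^ (k + d)) (\<lambda>x. mollify h \<sigma> x - mollify h \<sigma>' x) x\<bar> \<le> 2 * (A * \<tau> + B)" for k x
  proof (induction k arbitrary: x)
    case (Suc k)
    show ?case unfolding add_Suc funpow.simps o_apply by (rule avg_bound[OF M Suc])
  qed (simp only: add_0 d)
  from this[of "n - d"] \<open>d \<le> n\<close> show ?thesis by simp
qed

lemma bfun_correlation:
  assumes g: "bsfun g" and h: "bsfun h"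
  shows "bfun (\<lambda>t. LINT x|lborel. g (x + t) * h x)"
proof -
  have [measurable]: "g \<in> borel_measurable borel" "h \<in> borel_measurable borel"
    using g h by (auto dest: bsfunD bfun_measurable)
  obtain C where C: "0 \<le> C" "\<And>x. \<bar>g x\<bar> \<le> C" using bfunE[OF bsfunD[OF g]] by metis
  have "(\<lambda>t. LINT x|lborel. g (x + t) * h x) \<in> borel_measurable borel" by measurable
  moreover have "\<bar>LINT x|lborel. g (x + t) * h x\<bar> \<le> (LINT x|lborel. C * \<bar>h x\<bar>)" for t
  proof -
  have "\<bar>LINT x|lborel. g (x + t) * h x\<bar> \<le> (LINT x|lborel. \<bar>g (x + t) * h x\<bar>)" by (rule integral_abs_bound)
  also have "\<dots> \<le> (LINT x|lborel. C * \<bar>h x\<bar>)"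
    by (rule integral_mono') (use C bsfun_integrable[OF h] in \<open>auto simp: abs_mult intro!: mult_right_mono\<close>)
  finally show ?thesis .
  qed
  ultimately show ?thesis unfolding bfun_def by blast
qed

text \<open>A uniform measure on \<open>{-S..S}\<close> still has the whole line as its space.
  Clipping makes the random shift bounded everywhere, as the lemmas on \<open>avg\<close> require,
  and changes it only on a null set.\<close>

definition clip :: "real \<Rightarrow> real \<Rightarrow> real" where
  "clip S s = max (-S) (min S s)"

lemma clip_measurable [measurable]: "clip S \<in> borel_measurable borel"
  unfolding clip_def[abs_def] by measurable

lemma abs_clip_le: "0 < S \<Longrightarrow> \<bar>clip S s\<bar> \<le> S"
  by (auto simp: clip_def)

lemma AE_clip_eq: "AE s in uniform_measure lborel {-S..S}. clip S s = s"
  by (rule AE_uniform_measureI) (auto simp: clip_def)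

text \<open>The power \<open>2 ^ CARD('n)\<close> makes repeated squaring available and exceeds the dimension, so
  that enough averages are taken for the smoothing to act in all directions.\<close>

lemma directional_average_decay:
  fixes h :: "real^'n \<Rightarrow> real" and a :: "real \<Rightarrow> real^'n"
  assumes kl: "k < l" and S: "0 < S" and am[measurable]: "a \<in> borel_measurable borel" and K: "\<And>v. norm (a v) \<le> K"
    and \<eta>: "0 < \<eta>" "\<eta> \<le> 1"
    and q: "\<And>\<xi>. norm \<xi> = 1 \<Longrightarrow> measure lborel {v \<in> {k..l}. \<bar>a v \<bullet> \<xi>\<bar> < \<eta>} \<le> q"
    and h: "bsfun h" "\<And>x. \<bar>h x\<bar> \<le> 1"
    and \<sigma>: "0 < \<sigma>" "\<sigma> \<le> \<tau>" "0 < \<sigma>'" "\<sigma>' \<le> \<tau>"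
  defines "g \<equiv> \<lambda>x. mollify h \<sigma> x - mollify h \<sigma>' x"
  defines "X \<equiv> LINT v|uniform_measure lborel {k..l}. LINT x|lborel.
      (avg (uniform_measure lborel {-S..S}) (\<lambda>s. clip S s *\<^sub>R a v) g x)\<^sup>2"
  shows "X ^ (2 ^ CARD('n)) \<le> (4 * (LINT x|lborel. \<bar>h x\<bar>)) ^ (2 ^ CARD('n)) *
     (2 * (((1 + K) / \<eta>) ^ CARD('n) * (real CARD('n) * (2 / S) / \<eta>) * \<tau> + 2 * real CARD('n) * (q / (l - k))))"
proof -
  define V where "V = uniform_measure lborel {k..l}"
  define U where "U = uniform_measure lborel {-S..S}"
  define N where "N = U \<Otimes>\<^sub>M U"
  \<comment> \<open>Let B be the average over \<open>s\<close> in direction \<open>a v\<close>. Then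
    B* B averages over translations by (s' - s) (a v) with \<open>s\<close>, \<open>s'\<close>
    independent. The law of s' - s is symmetric, and \<open>X\<close> becomes <g, T g> for T =
    \<open>avg M z\<close>.\<close>
  define c where "c \<omega> = clip S (snd \<omega>) - clip S (fst \<omega>)" for \<omega> :: "real \<times> real"
  define M where "M = V \<Otimes>\<^sub>M N"
  define z where "z = (\<lambda>(v, \<omega>). c \<omega> *\<^sub>R a v)"
  have V: "prob_space V" unfolding V_def by (rule prob_space_uniform_interval[OF kl])
  have U: "prob_space U" unfolding U_def by (rule prob_space_uniform_interval) (use S in simp)
  interpret V: prob_space V by fact
  interpret U: prob_space U by fact
  interpret UU: pair_prob_space U U ..
  have N: "prob_space N" unfolding N_def by (rule UU.prob_space_axioms)
  interpret N: prob_space N by fact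
  interpret VN: pair_prob_space V N ..
  have M: "prob_space M" unfolding M_def by (rule VN.prob_space_axioms)
  have sV[measurable_cong]: "sets V = sets borel" and sU[measurable_cong]: "sets U = sets borel"
    by (simp_all add: V_def U_def)
  have cm[measurable]: "c \<in> borel_measurable N"
    unfolding c_def[abs_def] N_def by measurable
  have [measurable]: "a \<in> borel_measurable V" by measurable
  have zm[measurable]: "z \<in> borel_measurable M" unfolding z_def M_def by measurable
  have K0: "0 \<le> K" using order_trans[OF norm_ge_zero K] .
  have cb: "\<bar>c \<omega>\<bar> \<le> 2 * S" for \<omega> using abs_clip_le[OF S, of "snd \<omega>"] abs_clip_le[OF S, of "fst \<omega>"] by (simp add: c_def)
  have zb: "norm (z \<omega>) \<le> 2 * S * K" for \<omega>
    unfolding z_def split_beta norm_scaleR using cb[of "snd \<omega>"] K S by (intro mult_mono) auto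
  have g: "bsfun g" unfolding g_def by (intro bsfun_diff bsfun_mollify h \<sigma>)
  have Nint: "(LINT \<omega>|N. f (c \<omega>)) = (LINT s|U. LINT s'|U. f (clip S s' - clip S s))" if f: "bfun f" for f
    using UU.integral_fst[of "\<lambda>s s'. f (clip S s' - clip S s)"] UU.integrable_bfun[OF f cm[unfolded N_def]]
    by (simp add: N_def c_def case_prod_beta')
  have Mint: "(LINT \<omega>|M. f (z \<omega>)) = (LINT v|V. LINT \<omega>|N. f (c \<omega> *\<^sub>R a v))" if f: "bfun f" for f
    using VN.integral_fst[of "\<lambda>v \<omega>. f (c \<omega> *\<^sub>R a v)"] VN.integrable_bfun[OF f, of z]
    by (simp add: M_def z_def case_prod_beta')
  have \<kappa>: "\<bar>(LINT \<omega>|N. r (c \<omega> + t)) - (LINT \<omega>|N. r (c \<omega>))\<bar> \<le> 2 / S * \<bar>t\<bar>"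
    if r: "bfun r" "\<And>s. \<bar>r s\<bar> \<le> 1" for r t
  proof -
    have [measurable]: "r \<in> borel_measurable borel" using r(1) by (rule bfun_measurable)
    have "(LINT \<omega>|N. r (c \<omega> + t)) - (LINT \<omega>|N. r (c \<omega>)) = (LINT \<omega>|N. r (c \<omega> + t) - r (c \<omega>))"
      by (rule Bochner_Integration.integral_diff[symmetric]; rule N.integrable_bfun[OF r(1)]) measurable
    also have "\<dots> = (LINT s|U. LINT s'|U. r (clip S s' - clip S s + t) - r (clip S s' - clip S s))"
    proof (rule Nint[of "\<lambda>y. r (y + t) - r y"])
      have "\<bar>r (y + t) - r y\<bar> \<le> 2" for y using r(2)[of y] r(2)[of "y + t"] by linarith
      then show "bfun (\<lambda>y. r (y + t) - r y)" unfolding bfun_def by auto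
    qed
    \<comment> \<open>The average over s' alone gives the bound; for fixed \<open>s\<close> the
      other shift is absorbed into the function.\<close>
    also have "\<bar>\<dots>\<bar> \<le> 2 / S * \<bar>t\<bar>"
    proof (rule U.integral_le_bound)
      fix s
      have b: "bfun (\<lambda>y. r (y - clip S s))" using bfun_shift[OF r(1), of "- clip S s"] by simp
      have [simp]: "(LINT s'|U. r (clip S s' - clip S s + t)) = (LINT s'|U. r (s' + t - clip S s))"
        "(LINT s'|U. r (clip S s' - clip S s)) = (LINT s'|U. r (s' - clip S s))"
        using AE_clip_eq[of S] unfolding U_def[symmetric]
        by (auto intro!: integral_cong_AE simp: algebra_simps)
      have "(LINT s'|U. r (clip S s' - clip S s + t) - r (clip S s' - clip S s)) =
         (LINT s'|U. r (s' + t - clip S s)) - (LINT s'|U. r (s' - clip S s))"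
        by (subst Bochner_Integration.integral_diff) (auto intro!: U.integrable_bfun[OF r(1)])
      then show "\<bar>LINT s'|U. r (clip S s' - clip S s + t) - r (clip S s' - clip S s)\<bar> \<le> 2 / S * \<bar>t\<bar>"
        using uniform_interval_shift[OF b r(2) S, of t] by (simp add: U_def)
    qed
    finally show ?thesis .
  qed
  have p: "measure V {v \<in> space V. \<bar>a v \<bullet> \<xi>\<bar> < \<eta>} \<le> q / (l - k)" if "norm \<xi> = 1" for \<xi>
  proof -
    have "measure V {v \<in> space V. \<bar>a v \<bullet> \<xi>\<bar> < \<eta>} = measure lborel {v \<in> {k..l}. \<bar>a v \<bullet> \<xi>\<bar> < \<eta>} / (l - k)"
      unfolding V_def using kl
      by (subst measure_uniform_measure) (auto simp: ennreal_eq_0_iff Collect_conj_eq intro!: arg_cong[where f = "measure lborel"])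
    then show ?thesis using q[OF that] kl by (simp add: divide_right_mono)
  qed
  have sym: "(LINT \<omega>|M. f (z \<omega>)) = (LINT \<omega>|M. f (- z \<omega>))" if f: "bfun f" for f
  proof -
    have [measurable]: "f \<in> borel_measurable borel" using f by (rule bfun_measurable)
    have f': "bfun (\<lambda>x. f (- x))" "bfun (\<lambda>t. f (t *\<^sub>R a v))" "bfun (\<lambda>t. f (- (t *\<^sub>R a v)))" for v
      using f unfolding bfun_def by auto
    have "(LINT \<omega>|N. f (c \<omega> *\<^sub>R a v)) = (LINT \<omega>|N. f (- (c \<omega> *\<^sub>R a v)))" for v
    proof -
      have "integrable (U \<Otimes>\<^sub>M U) (\<lambda>(s, s'). f ((clip S s' - clip S s) *\<^sub>R a v))"
        using UU.integrable_bfun[OF f, of "\<lambda>\<omega>. c \<omega> *\<^sub>R a v"] by (simp add: c_def case_prod_beta')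
      from UU.Fubini_integral[OF this] show ?thesis
        unfolding Nint[OF f'(2)] Nint[OF f'(3)] by (simp add: scaleR_left_diff_distrib)
    qed
    then show ?thesis unfolding Mint[OF f] Mint[OF f'(1)] by simp
  qed
  have near: "\<bar>(avg M z ^^ CARD('n)) h (x + y) - (avg M z ^^ CARD('n)) h x\<bar> \<le>
     ((1 + K) / \<eta>) ^ CARD('n) * (real CARD('n) * (2 / S) / \<eta>) * norm y + 2 * real CARD('n) * (q / (l - k))" for x y
  proof -
    have "\<bar>(avg M z ^^ CARD('n)) h (x + y) - (avg M z ^^ CARD('n)) h x\<bar> \<le>
       lip_const K \<eta> (2 / S) CARD('n) 0 * norm y + 2 * real CARD('n) * (q / (l - k))"
      unfolding M_def z_def
      \<comment> \<open>The start is \<open>W = {0}\<close> with Lipschitz constant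
        \<open>0\<close>: continuity in every direction has to come from the averages.\<close>
      by (rule avg_smoothing[OF V N _ _ K \<kappa> \<eta>(1) p, where W = "{0}"]) (auto simp: h bsfunD)
    also have "\<dots> \<le> ((1 + K) / \<eta>) ^ CARD('n) * (0 + real CARD('n) * (2 / S) / \<eta>) * norm y + 2 * real CARD('n) * (q / (l - k))"
      by (intro add_right_mono mult_right_mono lip_const_le K0 \<eta>) (use S in auto)
    finally show ?thesis by simp
  qed
  let ?m = "CARD('n)" and ?H = "LINT x|lborel. \<bar>h x\<bar>"
  define \<epsilon> where "\<epsilon> = 2 * (((1 + K) / \<eta>) ^ CARD('n) * (real CARD('n) * (2 / S) / \<eta>) * \<tau> + 2 * real CARD('n) * (q / (l - k)))"
  have Tg: "\<bar>(avg M z ^^ (2 ^ ?m)) g x\<bar> \<le> \<epsilon>" for x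
    unfolding g_def \<epsilon>_def
    by (rule mollify_difference_decay[OF M zm bsfunD[OF h(1)] h(2) near _ \<sigma>]) (use K0 \<eta> S in auto)
  have "0 \<le> \<epsilon>" using order_trans[OF abs_ge_zero Tg] .
  have H0: "0 \<le> ?H" by simp
  have absg: "(LINT x|lborel. \<bar>g x\<bar>) \<le> 2 * ?H"
  proof -
    obtain R where R: "\<And>x. R < norm x \<Longrightarrow> h x = 0" using h(1) by (auto simp: bsfun_def)
    have i: "integrable lborel h" by (rule bsfun_integrable[OF h(1)])
    have "(LINT x|lborel. \<bar>g x\<bar>) \<le> (LINT x|lborel. \<bar>mollify h \<sigma> x\<bar> + \<bar>mollify h \<sigma>' x\<bar>)"
      by (rule integral_mono')
        (auto simp: g_def intro!: Bochner_Integration.integrable_add integrable_abs bsfun_integrable[OF bsfun_mollify] h \<sigma>)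
    also have "\<dots> = (LINT x|lborel. \<bar>mollify h \<sigma> x\<bar>) + (LINT x|lborel. \<bar>mollify h \<sigma>' x\<bar>)"
      by (intro Bochner_Integration.integral_add integrable_abs bsfun_integrable bsfun_mollify h \<sigma>)
    also have "\<dots> \<le> ?H + ?H"
      by (intro add_mono integral_abs_mollify_le[OF i _ h(2) R] \<sigma>)
    finally show ?thesis by simp
  qed
  have g2: "\<bar>g x\<bar> \<le> 2" for x
    using mollify_bounds[OF bfun_measurable[OF bsfunD[OF h(1)]] h(2) \<sigma>(1), of x]
      mollify_bounds[OF bfun_measurable[OF bsfunD[OF h(1)]] h(2) \<sigma>(3), of x] by (simp add: g_def)
  \<comment> \<open>The bound stays linear in the L^1 norm of \<open>h\<close>: one factor
    \<open>g\<close> is bounded pointwise by \<open>2\<close>, and mollification contracts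
    L^1.\<close>
  have gg: "(LINT x|lborel. g x * g x) \<le> 4 * ?H"
  proof -
    have "(LINT x|lborel. g x * g x) \<le> (LINT x|lborel. 2 * \<bar>g x\<bar>)"
    proof (rule integral_mono')
      show "g x * g x \<le> 2 * \<bar>g x\<bar>" for x
        using mult_right_mono[OF g2[of x] abs_ge_zero[of "g x"]] by simp
    qed (auto intro!: integrable_abs bsfun_integrable[OF g])
    then show ?thesis using absg by simp
  qed
  have XT: "X = (LINT x|lborel. g x * avg M z g x)"
  proof -
    have f: "bfun (\<lambda>t. LINT x|lborel. g (x + t) * g x)" by (rule bfun_correlation[OF g g])
    have "(LINT x|lborel. (avg U (\<lambda>s. clip S s *\<^sub>R a v) g x)\<^sup>2) = (LINT \<omega>|N. LINT x|lborel. g (x + c \<omega> *\<^sub>R a v) * g x)" for v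
    proof -
      let ?B = "avg U (\<lambda>s. clip S s *\<^sub>R a v) g"
      have bd: "norm (clip S s *\<^sub>R a v) \<le> S * K" for s
        using abs_clip_le[OF S] K S by (auto intro!: mult_mono)
      have B: "bsfun ?B" by (rule bsfun_avg[OF U _ bd g]) measurable
      have "(LINT x|lborel. (?B x)\<^sup>2) = (LINT x|lborel. ?B x * ?B x)" by (simp add: power2_eq_square)
      also have "\<dots> = (LINT x|lborel. g x * avg U (\<lambda>s. - (clip S s *\<^sub>R a v)) ?B x)"
        by (rule avg_adjoint[OF U _ bd g B]) measurable
      also have "\<dots> = (LINT x|lborel. avg N (\<lambda>\<omega>. c \<omega> *\<^sub>R a v) g x * g x)"
      proof (rule Bochner_Integration.integral_cong[OF refl])
        fix x
        have "(\<lambda>\<omega>. c \<omega> *\<^sub>R a v) = (\<lambda>(s, s'). (clip S s' - clip S s) *\<^sub>R a v)" by (auto simp: c_def)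
        moreover have "avg (U \<Otimes>\<^sub>M U) (\<lambda>(s, s'). (clip S s' - clip S s) *\<^sub>R a v) g x =
            (LINT s|U. avg U (\<lambda>s'. (clip S s' - clip S s) *\<^sub>R a v) g x)"
          by (rule avg_pair[OF U U _ bsfunD[OF g]]) measurable
        ultimately show "g x * avg U (\<lambda>s. - (clip S s *\<^sub>R a v)) ?B x = avg N (\<lambda>\<omega>. c \<omega> *\<^sub>R a v) g x * g x"
          by (simp add: N_def avg_def algebra_simps)
      qed
      also have "\<dots> = (LINT \<omega>|N. LINT x|lborel. g (x + c \<omega> *\<^sub>R a v) * g x)"
        by (rule integral_avg_mult[OF N _ _ g bsfunD[OF g], of _ "2 * S * K"])
          (use cb K S in \<open>auto simp del: split_paired_All intro!: mult_mono\<close>)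
      finally show ?thesis .
    qed
    then have "X = (LINT v|V. LINT \<omega>|N. LINT x|lborel. g (x + c \<omega> *\<^sub>R a v) * g x)"
      by (simp add: X_def U_def V_def)
    also have "\<dots> = (LINT \<omega>|M. LINT x|lborel. g (x + z \<omega>) * g x)" using Mint[OF f] by simp
    also have "\<dots> = (LINT x|lborel. avg M z g x * g x)"
      by (rule integral_avg_mult[OF M zm zb g bsfunD[OF g], symmetric])
    finally show ?thesis by (simp add: mult.commute)
  qed
  have "X ^ (2 ^ ?m) \<le> \<bar>X\<bar> ^ (2 ^ ?m)" by (metis abs_ge_self power_abs)
  also have "\<dots> \<le> (LINT x|lborel. g x * g x) ^ (2 ^ ?m - 1) * \<bar>LINT x|lborel. g x * (avg M z ^^ (2 ^ ?m)) g x\<bar>"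
    unfolding XT by (rule avg_power_bound[OF M zm zb sym g])
  also have "\<dots> \<le> (4 * ?H) ^ (2 ^ ?m - 1) * (4 * ?H * \<epsilon>)"
  proof (rule mult_mono)
    show "(LINT x|lborel. g x * g x) ^ (2 ^ ?m - 1) \<le> (4 * ?H) ^ (2 ^ ?m - 1)"
      by (rule power_mono[OF gg]) simp
    have "\<bar>LINT x|lborel. g x * (avg M z ^^ (2 ^ ?m)) g x\<bar> \<le> (LINT x|lborel. \<bar>g x * (avg M z ^^ (2 ^ ?m)) g x\<bar>)"
      by (rule integral_abs_bound)
    also have "\<dots> \<le> (LINT x|lborel. \<bar>g x\<bar> * \<epsilon>)"
      by (rule integral_mono') (use Tg \<open>0 \<le> \<epsilon>\<close> bsfun_integrable[OF g] in \<open>auto simp: abs_mult intro!: mult_left_mono\<close>)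
    also have "\<dots> \<le> 2 * ?H * \<epsilon>" using absg \<open>0 \<le> \<epsilon>\<close> by (simp add: mult_right_mono)
    also have "\<dots> \<le> 4 * ?H * \<epsilon>" using \<open>0 \<le> \<epsilon>\<close> H0 by (intro mult_right_mono) auto
    finally show "\<bar>LINT x|lborel. g x * (avg M z ^^ (2 ^ ?m)) g x\<bar> \<le> 4 * ?H * \<epsilon>" .
  qed auto
  also have "\<dots> = (4 * ?H) ^ (2 ^ ?m) * \<epsilon>"
    using power_Suc[of "4 * ?H" "2 ^ ?m - 1"] by (simp add: mult.assoc mult.left_commute)
  finally show ?thesis by (simp only: \<epsilon>_def)
qed

subsection \<open>The kinetic estimate\<close>

lemma GDERIV_Lipschitz:
  fixes \<rho> :: "'a::euclidean_space \<Rightarrow> real"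
  assumes \<rho>: "\<And>x. GDERIV \<rho> x :> G x" and B: "\<And>x. norm (G x) \<le> B"
  shows "\<bar>\<rho> x - \<rho> y\<bar> \<le> B * norm (x - y)"
proof -
  have "norm (\<rho> x - \<rho> y) \<le> B * norm (x - y)"
  proof (rule differentiable_bound[where S = UNIV and f' = "\<lambda>x h. h \<bullet> G x"])
    fix x
    show "onorm (\<lambda>h. h \<bullet> G x) \<le> B"
    proof (rule onorm_le)
      fix v
      have "norm (v \<bullet> G x) \<le> norm v * norm (G x)" using Cauchy_Schwarz_ineq2[of v "G x"] by simp
      also have "\<dots> \<le> norm v * B" by (intro mult_left_mono B) simp
      finally show "norm (v \<bullet> G x) \<le> B * norm v" by (simp add: mult.commute)
    qed
  qed (use \<rho> in \<open>auto simp: gderiv_def\<close>)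
  then show ?thesis by simp
qed

lemma sum_indicator_partition:
  fixes \<kappa> :: "nat \<Rightarrow> real"
  assumes "mono \<kappa>"
  shows "(\<Sum>i<n. indicator {\<kappa> i..<\<kappa> (Suc i)} t) = (indicator {\<kappa> 0..<\<kappa> n} t :: real)"
proof (induction n)
  case (Suc n)
  have "\<kappa> 0 \<le> \<kappa> n" "\<kappa> n \<le> \<kappa> (Suc n)" using assms by (auto simp: mono_def)
  with Suc show ?case by (auto simp: indicator_def)
qed simp

lemma test_functionI:
  assumes "\<And>k. C_k k \<phi>" "\<And>x. R < norm x \<Longrightarrow> \<phi> x = 0" "R < r"
  shows "test_function (ball 0 r) \<phi>"
proof -
  have "{x. \<phi> x \<noteq> 0} \<subseteq> cball 0 R" using assms(2) by (force simp: not_le[symmetric])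
  then have *: "closure {x. \<phi> x \<noteq> 0} \<subseteq> cball 0 R" by (intro closure_minimal) auto
  then have "compact (closure {x. \<phi> x \<noteq> 0})"
    using bounded_subset[OF bounded_cball *] by (simp add: compact_eq_bounded_closed)
  with * assms(1,3) show ?thesis unfolding test_function_def by force
qed

text \<open>Normal form of the data: a Borel function with bounds valid everywhere, set to
  \<open>0\<close> outside the ball. As \<open>0\<close> need not lie in \<open>I\<close>, all
  levels stay above some \<open>lo\<close> in \<open>I\<close>; velocities between \<open>lo\<close>
  and \<open>u x\<close> then belong to \<open>I\<close>, where \<open>a\<close> is controlled. The
  assumption \<open>entropy\<close> is the inequality for \<open>max 0 (v - \<kappa>)\<close>, with
  the flux written as a velocity integral.\<close>

locale subsolution =
  fixes a :: "real \<Rightarrow> real^'n" and u :: "real^'n \<Rightarrow> real" and K M lo :: real and I :: "real set"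
  assumes a_cont: "continuous_on UNIV a"
    and u_meas [measurable]: "u \<in> borel_measurable borel"
    and u_nonneg: "\<And>x. 0 \<le> u x" and u_le: "\<And>x. u x \<le> M"
    and u_outside: "\<And>x. 2 \<le> norm x \<Longrightarrow> u x = 0"
    and I: "is_interval I" "lo \<in> I" and u_in: "\<And>x. lo < u x \<Longrightarrow> u x \<in> I" and lo: "0 \<le> lo"
    and a_bound: "\<And>v. v \<in> I \<Longrightarrow> norm (a v) \<le> K"
    and a_Lipschitz: "\<And>v w. v \<in> I \<Longrightarrow> w \<in> I \<Longrightarrow> norm (a v - a w) \<le> K * \<bar>v - w\<bar>"
    and entropy: "\<And>\<kappa> \<phi> D\<phi>. lo \<le> \<kappa> \<Longrightarrow> test_function (ball 0 2) \<phi> \<Longrightarrow> (\<And>x. 0 \<le> \<phi> x) \<Longrightarrow>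
      (\<And>x. GDERIV \<phi> x :> D\<phi> x) \<Longrightarrow>
      0 \<le> (LINT x|lborel. (LINT t|lborel. indicator {\<kappa>..u x} t *\<^sub>R a t) \<bullet> D\<phi> x)"
begin

lemma K_nonneg: "0 \<le> K"
  using order_trans[OF norm_ge_zero a_bound[OF I(2)]] .

lemma a_meas [measurable]: "a \<in> borel_measurable borel"
  by (rule borel_measurable_continuous_onI[OF a_cont])

lemma between_in_I: "lo \<le> t \<Longrightarrow> t \<le> u x \<Longrightarrow> t \<in> I"
proof (cases "lo < u x")
  case True
  assume "lo \<le> t" "t \<le> u x"
  then show "t \<in> I" using mem_is_interval_1_I[OF I(1) I(2) u_in[OF True]] by blast
next
  case False
  assume "lo \<le> t" "t \<le> u x"
  with False have "t = lo" by linarith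
  with I(2) show "t \<in> I" by simp
qed

text \<open>The kinetic function of \<open>u\<close> above the level \<kappa>, on the phase space of
  pairs (x, v).\<close>

definition wt :: "real \<Rightarrow> (real^'n) \<times> real \<Rightarrow> real" where
  "wt \<kappa> p = indicator {\<kappa>..u (fst p)} (snd p)"

lemma wt_meas [measurable]: "wt \<kappa> \<in> borel_measurable borel"
proof -
  have "wt \<kappa> = (\<lambda>p. if \<kappa> \<le> snd p \<and> snd p \<le> u (fst p) then 1 else 0)"
    by (rule ext) (simp add: wt_def indicator_def)
  then show ?thesis by (simp add: borel_prod[symmetric])
qed

lemma wt_nonneg: "0 \<le> wt \<kappa> p" and wt_le_1: "wt \<kappa> p \<le> 1"
  unfolding wt_def by simp_all

lemma wt_neq_0D:
  assumes "wt \<kappa> p \<noteq> 0" "lo \<le> \<kappa>"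
  shows "\<kappa> \<le> snd p" "snd p \<le> u (fst p)" "snd p \<in> I" "0 \<le> snd p" "snd p \<le> M"
proof -
  show *: "\<kappa> \<le> snd p" "snd p \<le> u (fst p)" using assms by (auto simp: wt_def indicator_def split: if_splits)
  then show "snd p \<in> I" "0 \<le> snd p" "snd p \<le> M"
    using assms(2) lo u_le[of "fst p"] between_in_I[of "snd p" "fst p"] by auto
qed

lemma integrable_wt:
  assumes \<kappa>: "lo \<le> \<kappa>" and [measurable]: "F \<in> borel_measurable borel"
    and b: "\<And>p. wt \<kappa> p \<noteq> 0 \<Longrightarrow> \<bar>F p\<bar> \<le> C" and s: "\<And>p. R < norm (fst p) \<Longrightarrow> F p = 0"
  shows "integrable lborel (\<lambda>p. wt \<kappa> p * F p)"
proof (rule integrable_bounded_support[where C = "\<bar>C\<bar>" and R = "R + M"])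
  fix p
  show "norm (wt \<kappa> p * F p) \<le> \<bar>C\<bar>"
  proof (cases "wt \<kappa> p = 0")
    case False
    then have "\<bar>F p\<bar> \<le> \<bar>C\<bar>" using b[OF False] by linarith
    then show ?thesis using wt_nonneg[of \<kappa> p] wt_le_1[of \<kappa> p] mult_mono[of "wt \<kappa> p" 1 "\<bar>F p\<bar>" "\<bar>C\<bar>"]
      by (simp add: abs_mult)
  qed simp
  show "wt \<kappa> p * F p = 0" if "R + M < norm p"
  proof (rule ccontr)
    assume *: "wt \<kappa> p * F p \<noteq> 0"
    then have "wt \<kappa> p \<noteq> 0" "F p \<noteq> 0" by simp_all
    then have "norm (fst p) \<le> R" using s[of p] by linarith
    moreover have "norm (snd p) \<le> M" using wt_neq_0D(4,5)[OF \<open>wt \<kappa> p \<noteq> 0\<close> \<kappa>] by simp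
    moreover have "norm p \<le> norm (fst p) + norm (snd p)" using norm_Pair_le[of "fst p" "snd p"] by simp
    ultimately show False using that by linarith
  qed
qed measurable

lemma measure_Times_interval:
  assumes "E \<in> sets borel" "bounded E" "c \<le> (m::real)"
  shows "measure lborel (E \<times> {c..m}) = measure lborel (E :: (real^'n) set) * (m - c)"
    and "emeasure lborel (E \<times> {c..m}) < \<infinity>" and "E \<times> {c..m} \<in> sets borel"
proof -
  have "emeasure lborel (E \<times> {c..m}) = emeasure lborel E * ennreal (m - c)"
    using assms by (subst lborel_prod[symmetric], subst lborel.emeasure_pair_measure_Times) auto
  moreover have "emeasure lborel E < \<infinity>" by (rule emeasure_bounded_finite[OF assms(2)])
  ultimately show "measure lborel (E \<times> {c..m}) = measure lborel E * (m - c)" "emeasure lborel (E \<times> {c..m}) < \<infinity>"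
    using assms(3) by (simp_all add: measure_def enn2real_mult ennreal_mult_less_top)
  show "E \<times> {c..m} \<in> sets borel" using assms(1) by (simp add: borel_prod[symmetric])
qed

text \<open>Only points with \<open>u x \<ge> k\<close> contribute, each over velocities in an
  interval of length \<open>M\<close>. Through this bound every error term becomes linear in the
  measure of a superlevel set; the fixed lower level \<open>k\<close> lets one set serve all
  \<kappa> \<ge> k.\<close>

lemma integral_wt_bound:
  assumes \<kappa>: "lo \<le> \<kappa>" "k \<le> \<kappa>"
    and b: "\<And>p. wt \<kappa> p \<noteq> 0 \<Longrightarrow> \<bar>F p\<bar> \<le> C" and "0 \<le> C" and s: "\<And>p. R < norm (fst p) \<Longrightarrow> F p = 0"
  shows "\<bar>LINT p|lborel. wt \<kappa> p * F p\<bar> \<le> C * (M * measure lborel {x \<in> cball 0 R. k \<le> u x})"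
proof -
  let ?E = "{x \<in> cball 0 R. k \<le> u x}"
  have M: "0 \<le> M" using order_trans[OF u_nonneg u_le] .
  have E: "?E \<in> sets borel" "bounded ?E"
    by (auto intro: bounded_subset[OF bounded_cball[of 0 R]])
  note ms = measure_Times_interval[OF E M]
  have "\<bar>LINT p|lborel. wt \<kappa> p * F p\<bar> \<le> (LINT p|lborel. \<bar>wt \<kappa> p * F p\<bar>)" by (rule integral_abs_bound)
  also have "\<dots> \<le> (LINT p|lborel. C * indicator (?E \<times> {0..M}) p)"
  proof (rule integral_mono')
    show "integrable lborel (\<lambda>p. C * indicator (?E \<times> {0..M}) p)"
      using ms by (intro integrable_mult_right integrable_real_indicator) auto
    fix p
    show "\<bar>wt \<kappa> p * F p\<bar> \<le> C * indicator (?E \<times> {0..M}) p"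
    proof (cases "wt \<kappa> p * F p = 0")
      case False
      then have nz: "wt \<kappa> p \<noteq> 0" "F p \<noteq> 0" by auto
      have "fst p \<in> ?E" using s[of p] nz wt_neq_0D(1,2)[OF nz(1) \<kappa>(1)] \<kappa>(2) by (cases "R < norm (fst p)") auto
      then have "p \<in> ?E \<times> {0..M}" using wt_neq_0D[OF nz(1) \<kappa>(1)] by (auto simp: mem_Times_iff)
      moreover have "\<bar>wt \<kappa> p * F p\<bar> \<le> C"
        using b[OF nz(1)] wt_nonneg[of \<kappa> p] wt_le_1[of \<kappa> p] mult_mono[of "wt \<kappa> p" 1 "\<bar>F p\<bar>" C]
        by (simp add: abs_mult)
      ultimately show ?thesis by simp
    qed (use \<open>0 \<le> C\<close> in auto)
  qed (use \<open>0 \<le> C\<close> in auto)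
  also have "\<dots> = C * (M * measure lborel ?E)" using ms by (simp add: mult.commute)
  finally show ?thesis .
qed

text \<open>By Fubini the flux becomes a phase-space integral in which \<kappa> occurs only in the
  kinetic function, so that different levels can be compared.\<close>

lemma flux_integral:
  assumes \<kappa>: "lo \<le> \<kappa>" and Y: "continuous_on UNIV Y" "\<And>x. R < norm x \<Longrightarrow> Y x = (0::real^'n)"
  shows "(LINT x|lborel. (LINT t|lborel. indicator {\<kappa>..u x} t *\<^sub>R a t) \<bullet> Y x)
    = (LINT p|lborel. wt \<kappa> p * (a (snd p) \<bullet> Y (fst p)))"
proof -
  have [measurable]: "Y \<in> borel_measurable borel" by (rule borel_measurable_continuous_onI[OF Y(1)])
  obtain C where C: "\<And>x. norm (Y x) \<le> C" using continuous_bounded_support_bounded[OF Y] by blast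
  have "integrable lborel (\<lambda>p. wt \<kappa> p * (a (snd p) \<bullet> Y (fst p)))"
  proof (rule integrable_wt[OF \<kappa>, where C = "K * C" and R = R])
    show "(\<lambda>p. a (snd p) \<bullet> Y (fst p)) \<in> borel_measurable borel" by (simp add: borel_prod[symmetric])
    fix p assume "wt \<kappa> p \<noteq> 0"
    then have "norm (a (snd p)) \<le> K" using wt_neq_0D[OF _ \<kappa>] a_bound by blast
    then have "norm (a (snd p)) * norm (Y (fst p)) \<le> K * C" by (intro mult_mono C K_nonneg) auto
    then show "\<bar>a (snd p) \<bullet> Y (fst p)\<bar> \<le> K * C"
      using Cauchy_Schwarz_ineq2[of "a (snd p)" "Y (fst p)"] by linarith
  qed (use Y(2) in simp)
  then have "integrable (lborel \<Otimes>\<^sub>M lborel) (\<lambda>(x, t). indicator {\<kappa>..u x} t * (a t \<bullet> Y x))"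
    by (simp add: lborel_prod wt_def case_prod_beta')
  from lborel_pair.integral_fst[OF this]
  have "(LINT p|lborel. wt \<kappa> p * (a (snd p) \<bullet> Y (fst p)))
     = (LINT x|lborel. LINT t|lborel. indicator {\<kappa>..u x} t * (a t \<bullet> Y x))"
    by (simp add: lborel_prod wt_def case_prod_beta')
  also have "\<dots> = (LINT x|lborel. (LINT t|lborel. indicator {\<kappa>..u x} t *\<^sub>R a t) \<bullet> Y x)"
  proof (rule Bochner_Integration.integral_cong[OF refl])
    fix x
    have "integrable lborel (\<lambda>t. indicator {\<kappa>..u x} t *\<^sub>R a t)"
    proof (rule integrable_bounded_support[where C = K and R = M])
      fix t
      show "norm (indicator {\<kappa>..u x} t *\<^sub>R a t) \<le> K"
        using a_bound between_in_I[of t x] \<kappa> K_nonneg by (auto simp: indicator_def)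
      show "M < norm t \<Longrightarrow> indicator {\<kappa>..u x} t *\<^sub>R a t = 0"
        using \<kappa> lo u_le[of x] by (auto simp: indicator_def)
    qed simp
    from integral_inner_left[OF this, of "Y x"]
    show "(LINT t|lborel. indicator {\<kappa>..u x} t * (a t \<bullet> Y x)) = (LINT t|lborel. indicator {\<kappa>..u x} t *\<^sub>R a t) \<bullet> Y x"
      by simp
  qed
  finally show ?thesis by simp
qed

lemma entropy_integral:
  assumes \<kappa>: "lo \<le> \<kappa>" and \<phi>: "\<And>k. C_k k \<phi>" "\<And>x. GDERIV \<phi> x :> Y x" "\<And>x. 0 \<le> \<phi> x"
    and s: "\<And>x. R < norm x \<Longrightarrow> \<phi> x = 0" "R < 2"
  shows "0 \<le> (LINT p|lborel. wt \<kappa> p * (a (snd p) \<bullet> Y (fst p)))"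
proof -
  obtain Y' where Y': "\<And>x. GDERIV \<phi> x :> Y' x" "\<And>k i. C_k k (\<lambda>x. Y' x $ i)"
    using smooth_gradient[OF \<phi>(1)] by blast
  have "Y = Y'" using GDERIV_unique \<phi>(2) Y'(1) by blast
  then have Y: "continuous_on UNIV Y" using continuous_on_smooth[OF Y'(2)] by simp
  have Yz: "R < norm x \<Longrightarrow> Y x = 0" for x by (rule GDERIV_zero_outside[OF \<phi>(2) s(1)])
  show ?thesis
    using entropy[OF \<kappa> test_functionI[OF \<phi>(1) s] \<phi>(3,2)] flux_integral[OF \<kappa> Y Yz] by simp
qed

end

text \<open>\<open>w\<close> is the function to be translated and \<open>S\<close> bounds the
  translation parameter. The cutoff \<zeta> serves for domination: it equals 1 wherever a translate
  of \<open>w\<close> can be nonzero, since \<open>R1 + S * K \<le> R2\<close>, and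
  \<open>R3 < 2\<close> makes combinations of the two admissible test functions. \<open>A\<close>,
  \<open>B\<close>, \<open>X\<close> bound \<open>w\<close>, its gradient and the gradient of
  \<zeta>.\<close>

locale kinetic_test = subsolution a u K M lo I
  for a :: "real \<Rightarrow> real^'n" and u K M lo I +
  fixes k l S A B R1 R2 R3 X :: real and w \<zeta> :: "real^'n \<Rightarrow> real" and Dw D\<zeta> :: "real^'n \<Rightarrow> real^'n"
  assumes kl: "k < l" "lo \<le> k" "l \<in> I" and S: "0 \<le> S"
    and w: "\<And>k. C_k k w" "\<And>x. GDERIV w x :> Dw x" "\<And>x. R1 < norm x \<Longrightarrow> w x = 0"
      "\<And>x. \<bar>w x\<bar> \<le> A" "\<And>x. norm (Dw x) \<le> B"
    and \<zeta>: "\<And>k. C_k k \<zeta>" "\<And>x. GDERIV \<zeta> x :> D\<zeta> x" "\<And>x. R3 < norm x \<Longrightarrow> \<zeta> x = 0" "\<And>x. 0 \<le> \<zeta> x"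
      "\<And>x. norm x \<le> R2 \<Longrightarrow> \<zeta> x = 1" "\<And>x. norm (D\<zeta> x) \<le> X"
    and R: "R1 + S * K \<le> R2" "R2 \<le> R3" "R3 < 2"
begin

text \<open>The zeros at both ends of the velocity interval remove the boundary terms in the
  summation by parts.\<close>

definition \<psi> :: "real \<Rightarrow> real" where "\<psi> t = (t - k) * (l - t)"

lemma \<psi>_bounds: "k \<le> t \<Longrightarrow> t \<le> l \<Longrightarrow> 0 \<le> \<psi> t" "k \<le> t \<Longrightarrow> t \<le> l \<Longrightarrow> \<psi> t \<le> (l - k)\<^sup>2"
  unfolding \<psi>_def power2_eq_square by (auto intro!: mult_mono)

lemma \<psi>_Lipschitz:
  assumes "k \<le> t" "t \<le> l" "k \<le> t'" "t' \<le> l"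
  shows "\<bar>\<psi> t - \<psi> t'\<bar> \<le> (l - k) * \<bar>t - t'\<bar>"
proof -
  have "\<psi> t - \<psi> t' = (l + k - t - t') * (t - t')" unfolding \<psi>_def by (simp add: algebra_simps)
  then show ?thesis using assms by (auto simp: abs_mult intro!: mult_right_mono)
qed

lemma in_I: "k \<le> t \<Longrightarrow> t \<le> l \<Longrightarrow> t \<in> I"
  using mem_is_interval_1_I[OF I(1) I(2) kl(3)] kl(2) by (metis order_trans)

lemma X_nonneg: "0 \<le> X" and A_nonneg: "0 \<le> A" and B_nonneg: "0 \<le> B"
  using order_trans[OF norm_ge_zero \<zeta>(6)] order_trans[OF abs_ge_zero w(4)] order_trans[OF norm_ge_zero w(5)] by blast+

lemma cont_Dw: "continuous_on UNIV Dw"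
proof -
  obtain Y' where Y': "\<And>x. GDERIV w x :> Y' x" "\<And>k i. C_k k (\<lambda>x. Y' x $ i)"
    using smooth_gradient[OF w(1)] by blast
  have "Dw = Y'" using GDERIV_unique w(2) Y'(1) by blast
  then show ?thesis using continuous_on_smooth[OF Y'(2)] by simp
qed

lemma Dw_zero: "R1 < norm x \<Longrightarrow> Dw x = 0"
  by (rule GDERIV_zero_outside[OF w(2,3)])

lemma Dw_meas [measurable]: "Dw \<in> borel_measurable borel"
  and w_meas [measurable]: "w \<in> borel_measurable borel"
  using cont_Dw w(1)[of 0] by (auto intro: borel_measurable_continuous_onI)

lemma shift_outside:
  assumes "R2 < norm x" "\<bar>s\<bar> \<le> S" "t \<in> I"
  shows "R1 < norm (x + s *\<^sub>R a t)"
proof -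
  have "norm (s *\<^sub>R a t) \<le> S * K" using a_bound[OF assms(3)] assms(2) S by (auto intro!: mult_mono)
  then show ?thesis using norm_diff_ineq[of x "s *\<^sub>R a t"] assms(1) R(1) by linarith
qed

text \<open>Uniform continuity in the velocity, with a modulus independent of \<open>x\<close> and
  \<open>s\<close>; it controls the passage from a finite partition of velocities to the integral.
  Half of \<open>e\<close> pays for moving the argument of \<open>Dw\<close> and half for changing
  \<psi>.\<close>

lemma Dw_shift_uniform:
  assumes "0 < e"
  obtains d where "0 < d" "\<And>t t' x s. k \<le> t \<Longrightarrow> t \<le> l \<Longrightarrow> k \<le> t' \<Longrightarrow> t' \<le> l \<Longrightarrow> \<bar>t - t'\<bar> < d \<Longrightarrow> \<bar>s\<bar> \<le> S \<Longrightarrow>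
    norm (\<psi> t *\<^sub>R Dw (x + s *\<^sub>R a t) - \<psi> t' *\<^sub>R Dw (x + s *\<^sub>R a t')) \<le> e"
proof -
  define e' where "e' = e / (2 * ((l - k)\<^sup>2 + 1))"
  have e': "0 < e'" using assms by (simp add: e'_def add_nonneg_pos)
  obtain d where d: "0 < d" "\<And>x y. dist x y < d \<Longrightarrow> dist (Dw x) (Dw y) < e'"
    using continuous_bounded_support_uniformly[OF cont_Dw Dw_zero e'] by metis
  define d' where "d' = min (d / (S * K + 1)) (e / (2 * ((l - k) * B + 1)))"
  have SK: "0 \<le> S * K" using S K_nonneg by simp
  have lkB: "0 \<le> (l - k) * B" using kl B_nonneg by simp
  have "0 < d'" using d(1) assms SK lkB by (auto simp: d'_def intro!: divide_pos_pos)
  moreover have "norm (\<psi> t *\<^sub>R Dw (x + s *\<^sub>R a t) - \<psi> t' *\<^sub>R Dw (x + s *\<^sub>R a t')) \<le> e"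
    if t: "k \<le> t" "t \<le> l" "k \<le> t'" "t' \<le> l" "\<bar>t - t'\<bar> < d'" "\<bar>s\<bar> \<le> S" for t t' x s
  proof -
    let ?y = "x + s *\<^sub>R a t" and ?y' = "x + s *\<^sub>R a t'"
    have "dist ?y ?y' = \<bar>s\<bar> * norm (a t - a t')" by (simp add: dist_norm scaleR_diff_right[symmetric])
    also have "\<dots> \<le> S * (K * \<bar>t - t'\<bar>)"
      using t a_Lipschitz[OF in_I[OF t(1,2)] in_I[OF t(3,4)]] S by (intro mult_mono) auto
    also have "\<dots> \<le> (S * K + 1) * \<bar>t - t'\<bar>" by (simp add: algebra_simps)
    also have "\<dots> < d" using t(5) SK unfolding d'_def by (simp add: pos_less_divide_eq mult.commute)
    finally have "dist ?y ?y' < d" .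
    from d(2)[OF this] have 1: "norm (Dw ?y - Dw ?y') \<le> e'" by (simp add: dist_norm)
    have "\<psi> t *\<^sub>R Dw ?y - \<psi> t' *\<^sub>R Dw ?y' = \<psi> t *\<^sub>R (Dw ?y - Dw ?y') + (\<psi> t - \<psi> t') *\<^sub>R Dw ?y'"
      by (simp add: algebra_simps)
    also have "norm \<dots> \<le> \<bar>\<psi> t\<bar> * norm (Dw ?y - Dw ?y') + \<bar>\<psi> t - \<psi> t'\<bar> * norm (Dw ?y')"
      by (rule norm_triangle_le) simp
    also have "\<dots> \<le> (l - k)\<^sup>2 * e' + ((l - k) * \<bar>t - t'\<bar>) * B"
      using \<psi>_bounds[OF t(1,2)] \<psi>_Lipschitz[OF t(1-4)] 1 w(5) kl by (intro add_mono mult_mono) auto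
    also have "\<dots> \<le> e / 2 + e / 2"
    proof (rule add_mono)
      have "(l - k)\<^sup>2 * e' = (l - k)\<^sup>2 / ((l - k)\<^sup>2 + 1) * (e / 2)" by (simp add: e'_def)
      also have "\<dots> \<le> 1 * (e / 2)"
        using assms by (intro mult_right_mono) (auto simp: divide_le_eq_1 add_nonneg_pos)
      finally show "(l - k)\<^sup>2 * e' \<le> e / 2" by simp
      have "(l - k) * \<bar>t - t'\<bar> * B \<le> ((l - k) * B + 1) * \<bar>t - t'\<bar>" by (simp add: algebra_simps)
      also have "\<dots> \<le> e / 2" using t(5) lkB unfolding d'_def by (simp add: field_simps)
      finally show "(l - k) * \<bar>t - t'\<bar> * B \<le> e / 2" .
    qed
    finally show ?thesis by simp
  qed
  ultimately show ?thesis using that by blast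
qed

text \<open>The Lipschitz constant in \<open>t\<close> of
  \<open>\<psi> t * w (x + s *\<^sub>R a t)\<close>. The first summand comes from \<psi>; in the
  second, differentiating the shift \<open>s *\<^sub>R a t\<close> produces the factor
  \<open>S * K\<close>.\<close>

definition P :: real where "P = (l - k) * A + (l - k)\<^sup>2 * (S * K * B)"

lemma P_nonneg: "0 \<le> P"
  unfolding P_def using kl A_nonneg B_nonneg S K_nonneg by simp

lemma w_shift_Lipschitz:
  assumes t: "k \<le> t" "t \<le> l" "k \<le> t'" "t' \<le> l" and s: "\<bar>s\<bar> \<le> S"
  shows "\<bar>\<psi> t * w (x + s *\<^sub>R a t) - \<psi> t' * w (x + s *\<^sub>R a t')\<bar> \<le> P * \<bar>t - t'\<bar>"
proof -
  let ?y = "x + s *\<^sub>R a t" and ?y' = "x + s *\<^sub>R a t'"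
  have "\<bar>w ?y - w ?y'\<bar> \<le> B * norm (?y - ?y')" by (rule GDERIV_Lipschitz[OF w(2,5)])
  also have "norm (?y - ?y') = \<bar>s\<bar> * norm (a t - a t')" by (simp add: scaleR_diff_right[symmetric])
  also have "B * \<dots> \<le> B * (S * (K * \<bar>t - t'\<bar>))"
    using s a_Lipschitz[OF in_I[OF t(1,2)] in_I[OF t(3,4)]] S B_nonneg by (intro mult_left_mono mult_mono) auto
  finally have 1: "\<bar>w ?y - w ?y'\<bar> \<le> S * K * B * \<bar>t - t'\<bar>" by (simp add: algebra_simps)
  have "\<psi> t * w ?y - \<psi> t' * w ?y' = \<psi> t * (w ?y - w ?y') + (\<psi> t - \<psi> t') * w ?y'"
    by (simp add: algebra_simps)
  also have "\<bar>\<dots>\<bar> \<le> \<bar>\<psi> t\<bar> * \<bar>w ?y - w ?y'\<bar> + \<bar>\<psi> t - \<psi> t'\<bar> * \<bar>w ?y'\<bar>"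
    unfolding abs_mult[symmetric] by (rule abs_triangle_ineq)
  also have "\<dots> \<le> (l - k)\<^sup>2 * (S * K * B * \<bar>t - t'\<bar>) + ((l - k) * \<bar>t - t'\<bar>) * A"
    using \<psi>_bounds[OF t(1,2)] \<psi>_Lipschitz[OF t] 1 w(4) kl by (intro add_mono mult_mono) auto
  also have "\<dots> = P * \<bar>t - t'\<bar>" by (simp add: P_def algebra_simps)
  finally show ?thesis .
qed

abbreviation mass :: real where "mass \<equiv> measure lborel {x \<in> cball 0 R3. k \<le> u x}"

text \<open>The integrand of the \<open>s\<close>-derivative of the weighted translate, which is
  called \<open>moved\<close> below. The interval is half-open to match the slabs of the
  partition.\<close>

definition flow :: "real \<Rightarrow> (real^'n) \<times> real \<Rightarrow> real" where
  "flow s p = indicator {k..<l} (snd p) * (\<psi> (snd p) * (a (snd p) \<bullet> Dw (fst p + s *\<^sub>R a (snd p))))"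

lemma flow_meas [measurable]: "flow s \<in> borel_measurable borel"
  unfolding flow_def[abs_def] \<psi>_def borel_prod[symmetric] by measurable

text \<open>The entropies \<open>(v - \<kappa>)\<^sub>+\<close> are tested with \<open>P \<Delta> \<zeta> \<plusminus> (\<psi>(\<kappa>') w(x + s a(\<kappa>')) - \<psi>(\<kappa>) w(x + s a(\<kappa>)))\<close>
  for consecutive points \<open>\<kappa> < \<kappa>' = \<kappa> + \<Delta>\<close> of a partition; the constant \<open>P\<close> makes these test functions
  non-negative.  Summation by parts then transfers the difference in \<open>\<kappa>\<close> to the flux.\<close>

lemma flow_integral_bound:
  assumes s: "\<bar>s\<bar> \<le> S"
  shows "\<bar>LINT p|lborel. wt k p * flow s p\<bar> \<le> P * (l - k) * (K * X * (M * mass))"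
proof (rule field_le_epsilon)
  fix e :: real assume "0 < e"
  define vol where "vol = M * measure lborel {x \<in> cball 0 R2. k \<le> u x}"
  have M: "0 \<le> M" using order_trans[OF u_nonneg u_le] .
  have "0 \<le> vol" unfolding vol_def using M by simp
  define e' where "e' = e / (K * vol + 1)"
  have "0 < e'" unfolding e'_def using \<open>0 < e\<close> K_nonneg \<open>0 \<le> vol\<close> by (auto intro!: divide_pos_pos add_nonneg_pos)
  then obtain d where d: "0 < d" "\<And>t t' x s. k \<le> t \<Longrightarrow> t \<le> l \<Longrightarrow> k \<le> t' \<Longrightarrow> t' \<le> l \<Longrightarrow> \<bar>t - t'\<bar> < d \<Longrightarrow> \<bar>s\<bar> \<le> S \<Longrightarrow>
    norm (\<psi> t *\<^sub>R Dw (x + s *\<^sub>R a t) - \<psi> t' *\<^sub>R Dw (x + s *\<^sub>R a t')) \<le> e'"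
    using Dw_shift_uniform by metis
  obtain n :: nat where n: "(l - k) / d < real n" using reals_Archimedean2 by blast
  have n0: "0 < real n" using n kl d(1) by (smt (verit) divide_pos_pos)
  define \<Delta> where "\<Delta> = (l - k) / real n"
  have \<Delta>: "0 < \<Delta>" "\<Delta> < d" "real n * \<Delta> = l - k"
    using n n0 kl d(1) by (auto simp: \<Delta>_def field_simps)
  define \<kappa> where "\<kappa> i = k + real i * \<Delta>" for i
  have mono: "mono \<kappa>" unfolding \<kappa>_def using \<Delta> by (auto simp: mono_def)
  have \<kappa>0: "\<kappa> 0 = k" "\<kappa> n = l" using \<Delta>(3) by (auto simp: \<kappa>_def)
  have \<kappa>b: "k \<le> \<kappa> i" "\<kappa> i \<le> l" if "i \<le> n" for i
    using monoD[OF mono, of 0 i] monoD[OF mono, of i n] that \<kappa>0 by auto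
  have \<kappa>S: "\<kappa> (Suc i) = \<kappa> i + \<Delta>" for i by (simp add: \<kappa>_def algebra_simps)
  define V where "V t x = \<psi> t *\<^sub>R Dw (x + s *\<^sub>R a t)" for t x
  have V0: "V (\<kappa> 0) x = 0" "V (\<kappa> n) x = 0" for x by (auto simp: V_def \<psi>_def \<kappa>0)
  have cV: "continuous_on UNIV (V t)" for t
    unfolding V_def by (intro continuous_intros continuous_on_compose2[OF cont_Dw]) auto
  have [measurable]: "V t \<in> borel_measurable borel" for t by (rule borel_measurable_continuous_onI[OF cV])
  have Vz: "V t x = 0" if "R2 < norm x" "k \<le> t" "t \<le> l" for t x
    using Dw_zero[OF shift_outside[OF that(1) s in_I[OF that(2,3)]]] by (simp add: V_def)
  have Vb: "norm (V t x) \<le> (l - k)\<^sup>2 * B" if "k \<le> t" "t \<le> l" for t x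
    using \<psi>_bounds[OF that] w(5) by (auto simp: V_def intro!: mult_mono)
  have cauchy: "\<bar>a t \<bullet> y\<bar> \<le> K * c" if "t \<in> I" "norm y \<le> c" for t y c
  proof -
    have "norm (a t) * norm y \<le> K * c" using a_bound[OF that(1)] that(2) K_nonneg by (intro mult_mono) auto
    then show ?thesis using Cauchy_Schwarz_ineq2[of "a t" y] by linarith
  qed
  let ?D\<zeta> = "\<lambda>i. LINT p|lborel. wt (\<kappa> i) p * (a (snd p) \<bullet> D\<zeta> (fst p))"
  let ?DV = "\<lambda>i. LINT p|lborel. wt (\<kappa> i) p * (a (snd p) \<bullet> (V (\<kappa> (Suc i)) (fst p) - V (\<kappa> i) (fst p)))"
  obtain Y' where Y': "\<And>x. GDERIV \<zeta> x :> Y' x" "\<And>k i. C_k k (\<lambda>x. Y' x $ i)"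
    using smooth_gradient[OF \<zeta>(1)] by blast
  have "D\<zeta> = Y'" using GDERIV_unique \<zeta>(2) Y'(1) by blast
  then have "continuous_on UNIV D\<zeta>" using continuous_on_smooth[OF Y'(2)] by simp
  then have [measurable]: "D\<zeta> \<in> borel_measurable borel" by (rule borel_measurable_continuous_onI)
  have D\<zeta>z: "R3 < norm x \<Longrightarrow> D\<zeta> x = 0" for x by (rule GDERIV_zero_outside[OF \<zeta>(2,3)])
  have lo\<kappa>: "lo \<le> \<kappa> i" if "i \<le> n" for i using \<kappa>b[OF that] kl(2) by linarith
  have int\<zeta>: "integrable lborel (\<lambda>p. wt (\<kappa> i) p * (a (snd p) \<bullet> D\<zeta> (fst p)))" if "i \<le> n" for i
    by (rule integrable_wt[OF lo\<kappa>[OF that], where C = "K * X" and R = R3])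
      (use D\<zeta>z cauchy[OF _ \<zeta>(6)] wt_neq_0D[OF _ lo\<kappa>[OF that]] in \<open>auto simp: borel_prod[symmetric] simp del: split_paired_All\<close>)
  have intV: "integrable lborel (\<lambda>p. wt (\<kappa> i) p * (a (snd p) \<bullet> V (\<kappa> j) (fst p)))" if "i \<le> n" "j \<le> n" for i j
    by (rule integrable_wt[OF lo\<kappa>[OF that(1)], where C = "K * ((l - k)\<^sup>2 * B)" and R = R2])
      (use Vz[OF _ \<kappa>b[OF that(2)]] cauchy[OF _ Vb[OF \<kappa>b[OF that(2)]]] wt_neq_0D[OF _ lo\<kappa>[OF that(1)]] in \<open>auto simp: borel_prod[symmetric] simp del: split_paired_All\<close>)
  have intDV: "integrable lborel (\<lambda>p. wt (\<kappa> i) p * (a (snd p) \<bullet> (V (\<kappa> (Suc i)) (fst p) - V (\<kappa> i) (fst p))))"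
    if "i < n" for i
    unfolding inner_diff_right right_diff_distrib
    by (intro Bochner_Integration.integrable_diff intV) (use that in auto)
  have step: "\<bar>?DV i\<bar> \<le> P * \<Delta> * ?D\<zeta> i" if "i < n" for i
  proof -
    have b: "k \<le> \<kappa> (Suc i)" "\<kappa> (Suc i) \<le> l" "k \<le> \<kappa> i" "\<kappa> i \<le> l" using that \<kappa>b[of i] \<kappa>b[of "Suc i"] by auto
    \<comment> \<open>Non-negative test functions yield one-sided inequalities; the two signs of
      \<epsilon> combine them into a bound on the absolute value.\<close>
    have "0 \<le> P * \<Delta> * ?D\<zeta> i + \<epsilon> * ?DV i" if \<epsilon>: "\<bar>\<epsilon>\<bar> = 1" for \<epsilon> :: real
    proof -
      let ?\<phi> = "\<lambda>x. (P * \<Delta>) * \<zeta> x + (\<epsilon> * \<psi> (\<kappa> (Suc i))) * w (1 *\<^sub>R x + s *\<^sub>R a (\<kappa> (Suc i))) + (- \<epsilon> * \<psi> (\<kappa> i)) * w (1 *\<^sub>R x + s *\<^sub>R a (\<kappa> i))"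
      let ?Y = "\<lambda>x. (P * \<Delta>) *\<^sub>R D\<zeta> x + \<epsilon> *\<^sub>R (V (\<kappa> (Suc i)) x - V (\<kappa> i) x)"
      have "0 \<le> (LINT p|lborel. wt (\<kappa> i) p * (a (snd p) \<bullet> ?Y (fst p)))"
      proof (rule entropy_integral[of _ ?\<phi> _ R3])
        show "lo \<le> \<kappa> i" using lo\<kappa> \<open>i < n\<close> by simp
        show "C_k k ?\<phi>" for k by (intro C_k_add C_k_cmult C_k_affine \<zeta>(1) w(1))
        show "GDERIV ?\<phi> x :> ?Y x" for x
        proof -
          have cm: "GDERIV (\<lambda>x. c * f x) x :> c *\<^sub>R D" if "GDERIV f x :> D" for c :: real and f and D :: "real^'n"
            using GDERIV_mult[OF GDERIV_const that, of c] by simp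
          show ?thesis
            by (rule GDERIV_eqI[OF GDERIV_add[OF GDERIV_add[OF cm[OF \<zeta>(2)] cm[OF GDERIV_affine[OF w(2)]]] cm[OF GDERIV_affine[OF w(2)]]]])
              (simp add: V_def algebra_simps)
        qed
        have far: "w (1 *\<^sub>R x + s *\<^sub>R a (\<kappa> (Suc i))) = 0" "w (1 *\<^sub>R x + s *\<^sub>R a (\<kappa> i)) = 0" if "R2 < norm x" for x
          using w(3)[OF shift_outside[OF that s in_I[OF b(1,2)]]] w(3)[OF shift_outside[OF that s in_I[OF b(3,4)]]] by auto
        show "?\<phi> x = 0" if "R3 < norm x" for x
        proof -
          have "R2 < norm x" using R(2) that by linarith
          with far that show ?thesis by (simp add: \<zeta>(3))
        qed
        show "0 \<le> ?\<phi> x" for x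
        proof (cases "norm x \<le> R2")
          case True
          have "\<bar>\<epsilon> * (\<psi> (\<kappa> (Suc i)) * w (x + s *\<^sub>R a (\<kappa> (Suc i))) - \<psi> (\<kappa> i) * w (x + s *\<^sub>R a (\<kappa> i)))\<bar> \<le> P * \<Delta>"
            using w_shift_Lipschitz[OF b s, of x] \<epsilon> \<Delta> by (simp add: abs_mult \<kappa>S)
          then have "- (P * \<Delta>) \<le> \<epsilon> * (\<psi> (\<kappa> (Suc i)) * w (x + s *\<^sub>R a (\<kappa> (Suc i))) - \<psi> (\<kappa> i) * w (x + s *\<^sub>R a (\<kappa> i)))"
            by linarith
          then show ?thesis using \<zeta>(5)[OF True] by (simp add: algebra_simps)
        next
          case False
          then have "R2 < norm x" by simp
          from far[OF this] show ?thesis using P_nonneg \<Delta> \<zeta>(4) by simp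
        qed
      qed (rule R(3))
      also have "(LINT p|lborel. wt (\<kappa> i) p * (a (snd p) \<bullet> ?Y (fst p))) =
         (LINT p|lborel. (P * \<Delta>) * (wt (\<kappa> i) p * (a (snd p) \<bullet> D\<zeta> (fst p))) +
            \<epsilon> * (wt (\<kappa> i) p * (a (snd p) \<bullet> (V (\<kappa> (Suc i)) (fst p) - V (\<kappa> i) (fst p)))))"
        by (intro Bochner_Integration.integral_cong refl) (simp add: inner_add_right algebra_simps)
      also have "\<dots> = P * \<Delta> * ?D\<zeta> i + \<epsilon> * ?DV i"
        using int\<zeta>[of i] intDV[OF \<open>i < n\<close>] \<open>i < n\<close>
        by (subst Bochner_Integration.integral_add) auto
      finally show ?thesis .
    qed
    from this[of 1] this[of "-1"] show ?thesis by (simp add: abs_le_iff)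
  qed
  \<comment> \<open>The dissipation localised by \<zeta> is bounded uniformly over the levels of the
    partition, linearly in \<open>mass\<close>.\<close>
  have \<zeta>b: "?D\<zeta> i \<le> K * X * (M * mass)" if "i < n" for i
  proof -
    have "\<bar>?D\<zeta> i\<bar> \<le> K * X * (M * mass)"
      by (rule integral_wt_bound[OF lo\<kappa> \<kappa>b(1)])
        (use that D\<zeta>z cauchy[OF _ \<zeta>(6)] wt_neq_0D[OF _ lo\<kappa>[of i]] K_nonneg X_nonneg in \<open>auto simp del: split_paired_All\<close>)
    then show ?thesis by simp
  qed
  have abel: "(\<Sum>i<n. wt (\<kappa> i) p * (a (snd p) \<bullet> (V (\<kappa> (Suc i)) (fst p) - V (\<kappa> i) (fst p)))) =
      wt k p * (\<Sum>i<n. indicator {\<kappa> i..<\<kappa> (Suc i)} (snd p) * (a (snd p) \<bullet> V (\<kappa> (Suc i)) (fst p)))" for p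
  proof -
    let ?c = "\<lambda>i. a (snd p) \<bullet> V (\<kappa> i) (fst p)"
    \<comment> \<open>Consecutive kinetic functions differ exactly by \<open>wt k\<close> on one
      slab, closed below and open above.\<close>
    have diff: "wt (\<kappa> i) p - wt (\<kappa> (Suc i)) p = wt k p * indicator {\<kappa> i..<\<kappa> (Suc i)} (snd p)" if "i < n" for i
      using \<kappa>b(1)[of i] \<kappa>S[of i] \<Delta>(1) that by (auto simp: wt_def indicator_def)
    have "(\<Sum>i<n. wt (\<kappa> i) p * (?c (Suc i) - ?c i)) =
        (\<Sum>i<n. (wt (\<kappa> i) p - wt (\<kappa> (Suc i)) p) * ?c (Suc i)) + (\<Sum>i<n. wt (\<kappa> (Suc i)) p * ?c (Suc i) - wt (\<kappa> i) p * ?c i)"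
      unfolding sum.distrib[symmetric] by (intro sum.cong refl) (simp add: algebra_simps)
    also have "(\<Sum>i<n. wt (\<kappa> (Suc i)) p * ?c (Suc i) - wt (\<kappa> i) p * ?c i) = wt (\<kappa> n) p * ?c n - wt (\<kappa> 0) p * ?c 0"
      by (rule sum_lessThan_telescope)
    also have "\<dots> = 0" by (simp add: V0)
    also have "(\<Sum>i<n. (wt (\<kappa> i) p - wt (\<kappa> (Suc i)) p) * ?c (Suc i)) =
        (\<Sum>i<n. wt k p * (indicator {\<kappa> i..<\<kappa> (Suc i)} (snd p) * ?c (Suc i)))"
      by (intro sum.cong refl) (simp only: diff lessThan_iff mult.assoc)
    finally show ?thesis by (simp only: inner_diff_right sum_distrib_left add_0_right)
  qed
  have "\<bar>LINT p|lborel. (\<Sum>i<n. wt (\<kappa> i) p * (a (snd p) \<bullet> (V (\<kappa> (Suc i)) (fst p) - V (\<kappa> i) (fst p))))\<bar> =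
      \<bar>\<Sum>i<n. ?DV i\<bar>"
    by (subst Bochner_Integration.integral_sum) (auto intro: intDV)
  also have "\<dots> \<le> (\<Sum>i<n. \<bar>?DV i\<bar>)" by (rule sum_abs)
  also have "\<dots> \<le> (\<Sum>i<n. P * \<Delta> * (K * X * (M * mass)))"
  proof (rule sum_mono)
    fix i assume "i \<in> {..<n}"
    then have i: "i < n" by simp
    show "\<bar>?DV i\<bar> \<le> P * \<Delta> * (K * X * (M * mass))"
      using step[OF i] mult_left_mono[OF \<zeta>b[OF i], of "P * \<Delta>"] P_nonneg \<Delta>(1) by simp
  qed
  also have "\<dots> = P * (l - k) * (K * X * (M * mass))" using \<Delta>(3) by simp
  finally have main: "\<bar>LINT p|lborel. wt k p * (\<Sum>i<n. indicator {\<kappa> i..<\<kappa> (Suc i)} (snd p) * (a (snd p) \<bullet> V (\<kappa> (Suc i)) (fst p)))\<bar>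
     \<le> P * (l - k) * (K * X * (M * mass))" unfolding abel .
  let ?G = "\<lambda>p. \<Sum>i<n. indicator {\<kappa> i..<\<kappa> (Suc i)} (snd p) * (a (snd p) \<bullet> V (\<kappa> (Suc i)) (fst p))"
  have Gm[measurable]: "?G \<in> borel_measurable borel" unfolding borel_prod[symmetric] by measurable
  \<comment> \<open>\<open>?G\<close> samples the velocity dependence at the right end point of each
    slab; a mesh finer than \<open>d\<close> makes it uniformly close to
    \<open>flow\<close>.\<close>
  have close: "\<bar>flow s p - ?G p\<bar> \<le> K * e'" if "wt k p \<noteq> 0" for p
  proof -
    have tI: "snd p \<in> I" using wt_neq_0D[OF that kl(2)] by simp
    have "flow s p - ?G p = (\<Sum>i<n. indicator {\<kappa> i..<\<kappa> (Suc i)} (snd p) * (a (snd p) \<bullet> (V (snd p) (fst p) - V (\<kappa> (Suc i)) (fst p))))"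
    proof -
      have "flow s p = indicator {k..<l} (snd p) * (a (snd p) \<bullet> V (snd p) (fst p))"
        by (simp add: flow_def V_def)
      also have "\<dots> = (\<Sum>i<n. indicator {\<kappa> i..<\<kappa> (Suc i)} (snd p) * (a (snd p) \<bullet> V (snd p) (fst p)))"
        unfolding sum_distrib_right[symmetric] sum_indicator_partition[OF mono] \<kappa>0 ..
      finally show ?thesis by (simp add: sum_subtractf inner_diff_right right_diff_distrib)
    qed
    also have "\<bar>\<dots>\<bar> \<le> (\<Sum>i<n. indicator {\<kappa> i..<\<kappa> (Suc i)} (snd p) * (K * e'))"
    proof (rule order_trans[OF sum_abs sum_mono])
      fix i assume "i \<in> {..<n}"
      then have i: "i < n" by simp
      show "\<bar>indicator {\<kappa> i..<\<kappa> (Suc i)} (snd p) * (a (snd p) \<bullet> (V (snd p) (fst p) - V (\<kappa> (Suc i)) (fst p)))\<bar>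
          \<le> indicator {\<kappa> i..<\<kappa> (Suc i)} (snd p) * (K * e')"
      proof (cases "snd p \<in> {\<kappa> i..<\<kappa> (Suc i)}")
        case True
        have b: "k \<le> snd p" "snd p \<le> l" "k \<le> \<kappa> (Suc i)" "\<kappa> (Suc i) \<le> l"
          using True \<kappa>b[of i] \<kappa>b[of "Suc i"] i by auto
        have "\<bar>snd p - \<kappa> (Suc i)\<bar> < d" using True \<kappa>S[of i] \<Delta> by auto
        from cauchy[OF tI d(2)[OF b this s, of "fst p"]] True show ?thesis by (simp add: V_def)
      qed simp
    qed
    also have "\<dots> = indicator {k..<l} (snd p) * (K * e')"
      unfolding sum_distrib_right[symmetric] sum_indicator_partition[OF mono] \<kappa>0 ..
    also have "\<dots> \<le> 1 * (K * e')"
      using K_nonneg \<open>0 < e'\<close> by (intro mult_right_mono) (auto simp: indicator_def)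
    finally show ?thesis by simp
  qed
  have far: "flow s p = 0" "?G p = 0" if "R2 < norm (fst p)" for p
  proof -
    show "?G p = 0"
      using Vz[OF that \<kappa>b] by (intro sum.neutral) auto
    show "flow s p = 0"
      using Vz[OF that, of "snd p"] by (cases "snd p \<in> {k..<l}") (auto simp: flow_def V_def)
  qed
  have Gb: "\<bar>?G p\<bar> \<le> real n * (K * ((l - k)\<^sup>2 * B))" if "wt k p \<noteq> 0" for p
  proof -
    have tI: "snd p \<in> I" using wt_neq_0D[OF that kl(2)] by simp
    have "\<bar>?G p\<bar> \<le> (\<Sum>i<n. K * ((l - k)\<^sup>2 * B))"
    proof (rule order_trans[OF sum_abs sum_mono])
      fix i assume "i \<in> {..<n}"
      then have i: "Suc i \<le> n" by simp
      show "\<bar>indicator {\<kappa> i..<\<kappa> (Suc i)} (snd p) * (a (snd p) \<bullet> V (\<kappa> (Suc i)) (fst p))\<bar> \<le> K * ((l - k)\<^sup>2 * B)"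
        using cauchy[OF tI Vb[OF \<kappa>b[OF i]], of "fst p"] K_nonneg B_nonneg by (auto simp: indicator_def)
    qed
    then show ?thesis by simp
  qed
  have intG: "integrable lborel (\<lambda>p. wt k p * ?G p)"
    by (rule integrable_wt[OF kl(2) Gm Gb far(2)])
  have intF: "integrable lborel (\<lambda>p. wt k p * flow s p)"
  proof (rule integrable_wt[OF kl(2) flow_meas _ far(1)])
    show "\<bar>flow s p\<bar> \<le> real n * (K * ((l - k)\<^sup>2 * B)) + K * e'" if "wt k p \<noteq> 0" for p
      using Gb[OF that] close[OF that] by linarith
  qed
  have "\<bar>(LINT p|lborel. wt k p * flow s p) - (LINT p|lborel. wt k p * ?G p)\<bar> =
      \<bar>LINT p|lborel. wt k p * (flow s p - ?G p)\<bar>"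
    unfolding right_diff_distrib by (subst Bochner_Integration.integral_diff[OF intF intG]) simp
  also have "\<dots> \<le> K * e' * vol"
    unfolding vol_def by (rule integral_wt_bound[OF kl(2) order_refl close])
      (use far K_nonneg \<open>0 < e'\<close> in auto)
  also have "\<dots> \<le> e"
  proof -
    have "K * e' * vol = (K * vol) / (K * vol + 1) * e" by (simp add: e'_def)
    also have "\<dots> \<le> 1 * e" using K_nonneg \<open>0 \<le> vol\<close> \<open>0 < e\<close>
      by (intro mult_right_mono) (auto simp: divide_le_eq_1 add_nonneg_pos)
    finally show ?thesis by simp
  qed
  finally show "\<bar>LINT p|lborel. wt k p * flow s p\<bar> \<le> P * (l - k) * (K * X * (M * mass)) + e"
    using main by linarith
qed

end

section \<open>Translating the test function and averaging over velocity and translation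
  length\<close>

lemma integrable_pair_bounded_support:
  fixes F :: "'s \<times> 'a::euclidean_space \<Rightarrow> real"
  assumes U: "prob_space U" and m: "F \<in> borel_measurable (U \<Otimes>\<^sub>M lborel)"
    and b: "\<And>s p. \<bar>F (s, p)\<bar> \<le> C" and z: "\<And>s p. R < norm p \<Longrightarrow> F (s, p) = 0"
  shows "integrable (U \<Otimes>\<^sub>M lborel) F"
proof -
  interpret U: prob_space U by fact
  have int: "integrable (U \<Otimes>\<^sub>M lborel) (\<lambda>x. C * indicator (space U \<times> cball (0::'a) R) x :: real)"
  proof (intro integrable_mult_right integrable_real_indicator)
    have "emeasure lborel (cball (0::'a) R) < \<infinity>" by (intro emeasure_bounded_finite) auto
    then show "emeasure (U \<Otimes>\<^sub>M lborel) (space U \<times> cball (0::'a) R) < \<infinity>"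
      by (subst lborel.emeasure_pair_measure_Times) (auto simp: U.emeasure_space_1)
  qed auto
  have "norm (F (s, p)) \<le> norm (C * indicator (space U \<times> cball 0 R) (s, p))" if "s \<in> space U" for s p
    using b[of s p] z[of p s] that order_trans[OF abs_ge_zero b[of s p]] by (cases "norm p \<le> R") auto
  then show ?thesis
    by (intro Bochner_Integration.integrable_bound[OF int m] AE_I2) (auto simp: space_pair_measure)
qed

context kinetic_test
begin

text \<open>The translation is carried by the smooth factor \<open>w\<close>, so that it can be
  differentiated in \<open>s\<close> although the kinetic function is discontinuous.\<close>

definition moved :: "real \<Rightarrow> (real^'n) \<times> real \<Rightarrow> real" where
  "moved s p = indicator {k..<l} (snd p) * (\<psi> (snd p) * w (fst p + s *\<^sub>R a (snd p)))"

lemma moved_meas [measurable]: "moved s \<in> borel_measurable borel"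
  unfolding moved_def[abs_def] \<psi>_def borel_prod[symmetric] by measurable

lemma moved_bound: "\<bar>moved s p\<bar> \<le> (l - k)\<^sup>2 * A"
  using \<psi>_bounds[of "snd p"] w(4) A_nonneg
  by (auto simp: moved_def indicator_def abs_mult intro!: mult_mono)

lemma moved_zero:
  assumes "R2 < norm (fst p)" "\<bar>s\<bar> \<le> S" shows "moved s p = 0"
  using w(3)[OF shift_outside[OF assms in_I[of "snd p"]]] by (auto simp: moved_def indicator_def)

lemma integrable_moved: "\<bar>s\<bar> \<le> S \<Longrightarrow> integrable lborel (\<lambda>p. wt k p * moved s p)"
  by (rule integrable_wt[OF kl(2) moved_meas moved_bound moved_zero])

lemma flow_zero:
  assumes "R2 < norm (fst p)" "\<bar>s\<bar> \<le> S" shows "flow s p = 0"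
  using Dw_zero[OF shift_outside[OF assms in_I[of "snd p"]]] by (auto simp: flow_def indicator_def)

lemma integrable_flow:
  assumes "\<bar>s\<bar> \<le> S" shows "integrable lborel (\<lambda>p. wt k p * flow s p)"
proof (rule integrable_wt[OF kl(2) flow_meas _ flow_zero[OF _ assms]])
  fix p assume "wt k p \<noteq> 0"
  then have t: "snd p \<in> I" using wt_neq_0D kl(2) by blast
  have "\<bar>a (snd p) \<bullet> Dw (fst p + s *\<^sub>R a (snd p))\<bar> \<le> norm (a (snd p)) * norm (Dw (fst p + s *\<^sub>R a (snd p)))"
    by (rule Cauchy_Schwarz_ineq2)
  also have "\<dots> \<le> K * B" by (intro mult_mono a_bound t w(5) K_nonneg) auto
  finally show "\<bar>flow s p\<bar> \<le> (l - k)\<^sup>2 * (K * B)"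
    using \<psi>_bounds[of "snd p"] K_nonneg B_nonneg
    by (auto simp: flow_def indicator_def abs_mult intro!: mult_mono)
qed

lemma moved_has_derivative:
  assumes s: "s \<in> {-S..S}"
  shows "((\<lambda>s. LINT p|lborel. wt k p * moved s p) has_field_derivative (LINT p|lborel. wt k p * flow s p)) (at s within {-S..S})"
proof -
  have M: "0 \<le> M" using order_trans[OF u_nonneg u_le] .
  define vol where "vol = M * measure lborel {x \<in> cball 0 R2. k \<le> u x}"
  have "0 \<le> vol" unfolding vol_def using M by simp
  have sS: "\<bar>s\<bar> \<le> S" using s by auto
  have "\<exists>d>0. \<forall>y\<in>{-S..S}. norm (y - s) < d \<longrightarrow>
     norm ((LINT p|lborel. wt k p * moved y p) - (LINT p|lborel. wt k p * moved s p) - (y - s) * (LINT p|lborel. wt k p * flow s p))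
       \<le> e * norm (y - s)" if "e > 0" for e
  proof -
    define c where "c = (l - k)\<^sup>2 * K * vol"
    have "0 \<le> c" unfolding c_def using K_nonneg \<open>0 \<le> vol\<close> by simp
    define e' where "e' = e / (c + 1)"
    have "0 < e'" unfolding e'_def using \<open>0 \<le> c\<close> \<open>e > 0\<close> by simp
    then obtain d where d: "0 < d" "\<And>p h. norm h < d \<Longrightarrow> \<bar>w (p + h) - w p - h \<bullet> Dw p\<bar> \<le> norm h * e'"
      using GDERIV_uniform_linearization[OF w(2) cont_Dw w(3)] by metis
    have "norm ((LINT p|lborel. wt k p * moved y p) - (LINT p|lborel. wt k p * moved s p) - (y - s) * (LINT p|lborel. wt k p * flow s p))
       \<le> e * norm (y - s)" if y: "y \<in> {-S..S}" "norm (y - s) < d / (K + 1)" for y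
    proof -
      have yS: "\<bar>y\<bar> \<le> S" using y by auto
      have "(LINT p|lborel. wt k p * moved y p) - (LINT p|lborel. wt k p * moved s p) - (y - s) * (LINT p|lborel. wt k p * flow s p)
         = (LINT p|lborel. wt k p * moved y p - wt k p * moved s p - (y - s) * (wt k p * flow s p))"
        using integrable_moved[OF yS] integrable_moved[OF sS] integrable_flow[OF sS] by simp
      also have "\<dots> = (LINT p|lborel. wt k p * (moved y p - moved s p - (y - s) * flow s p))"
        by (intro Bochner_Integration.integral_cong refl) (simp add: algebra_simps)
      also have "\<bar>\<dots>\<bar> \<le> ((l - k)\<^sup>2 * (\<bar>y - s\<bar> * K * e')) * vol"
        unfolding vol_def
      proof (rule integral_wt_bound[OF kl(2) order_refl])
        fix p assume "wt k p \<noteq> 0"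
        then have "snd p \<in> I" using wt_neq_0D kl(2) by blast
        then have at: "norm (a (snd p)) \<le> K" by (rule a_bound)
        let ?h = "(y - s) *\<^sub>R a (snd p)" and ?x = "fst p + s *\<^sub>R a (snd p)"
        have nh: "norm ?h \<le> \<bar>y - s\<bar> * K" using at by (simp add: mult_left_mono)
        also have "\<dots> \<le> \<bar>y - s\<bar> * (K + 1)" by (intro mult_left_mono) auto
        also have "\<dots> < d" using y(2) K_nonneg by (simp add: pos_less_divide_eq)
        finally have "\<bar>w (?x + ?h) - w ?x - ?h \<bullet> Dw ?x\<bar> \<le> norm ?h * e'" by (rule d(2))
        also have "\<dots> \<le> \<bar>y - s\<bar> * K * e'" using nh \<open>0 < e'\<close> by (intro mult_right_mono) auto
        finally have *: "\<bar>w (?x + ?h) - w ?x - ?h \<bullet> Dw ?x\<bar> \<le> \<bar>y - s\<bar> * K * e'" .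
        have "moved y p - moved s p - (y - s) * flow s p =
            indicator {k..<l} (snd p) * \<psi> (snd p) * (w (?x + ?h) - w ?x - ?h \<bullet> Dw ?x)"
          by (simp add: moved_def flow_def algebra_simps)
        also have "\<bar>\<dots>\<bar> \<le> (l - k)\<^sup>2 * (\<bar>y - s\<bar> * K * e')"
          unfolding abs_mult[of _ "w (?x + ?h) - w ?x - ?h \<bullet> Dw ?x"]
          using \<psi>_bounds[of "snd p"] by (intro mult_mono *) (auto simp: indicator_def)
        finally show "\<bar>moved y p - moved s p - (y - s) * flow s p\<bar> \<le> (l - k)\<^sup>2 * (\<bar>y - s\<bar> * K * e')" .
      qed (use moved_zero yS sS flow_zero K_nonneg \<open>0 < e'\<close> in auto)
      also have "\<dots> = c / (c + 1) * (e * \<bar>y - s\<bar>)" by (simp add: c_def e'_def)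
      also have "\<dots> \<le> 1 * (e * \<bar>y - s\<bar>)" using \<open>0 \<le> c\<close> \<open>e > 0\<close> by (intro mult_right_mono) auto
      finally show ?thesis by simp
    qed
    moreover have "0 < d / (K + 1)" using d(1) K_nonneg by simp
    ultimately show ?thesis by blast
  qed
  then show ?thesis
    unfolding has_field_derivative_def has_derivative_within_alt
    by (auto simp: mult.commute intro: bounded_linear_mult_right)
qed

abbreviation Q :: real where "Q \<equiv> P * (l - k) * (K * X * (M * mass))"

lemma translation_bound:
  assumes "\<bar>s\<bar> \<le> S"
  shows "\<bar>(LINT p|lborel. wt k p * moved s p) - (LINT p|lborel. wt k p * moved 0 p)\<bar> \<le> S * Q"
proof -
  have "norm ((LINT p|lborel. wt k p * moved s p) - (LINT p|lborel. wt k p * moved 0 p)) \<le> Q * norm (s - 0)"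
    by (rule field_differentiable_bound[where S = "{-S..S}", OF _ moved_has_derivative])
      (use assms flow_integral_bound in auto)
  moreover have "0 \<le> Q" using order_trans[OF abs_ge_zero flow_integral_bound[of 0]] S by simp
  ultimately show ?thesis using assms mult_left_mono[OF assms \<open>0 \<le> Q\<close>] by (simp add: mult.commute)
qed

text \<open>The velocity field is controlled on \<open>I\<close> only. Freezing it outside
  \<open>[k, l]\<close> gives a bound at every argument, as \<open>directional_average_decay\<close>
  requires, and changes nothing where the weight lives.\<close>

definition clipped :: "real \<Rightarrow> real^'n" where "clipped t = a (max k (min l t))"

lemma clipped_meas [measurable]: "clipped \<in> borel_measurable borel"
  unfolding clipped_def[abs_def] by measurable

lemma norm_clipped: "norm (clipped t) \<le> K"
  unfolding clipped_def using kl by (intro a_bound in_I) auto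

text \<open>Averaging \<open>translation_bound\<close> over \<open>s\<close> replaces
  \<open>w\<close> by its directional average, at cost \<open>S * Q\<close>. Cauchy--Schwarz in
  phase space then separates the weighted kinetic function, whose square integral is at most (l -
  k)^4 M \<open>mass\<close>, from the mean square \<open>Y\<close> of that average.\<close>

lemma averaged_bound:
  assumes "0 < S"
  defines "Y \<equiv> LINT v|uniform_measure lborel {k..l}. LINT x|lborel.
      (avg (uniform_measure lborel {-S..S}) (\<lambda>s. clip S s *\<^sub>R clipped v) w x)\<^sup>2"
  shows "\<bar>LINT p|lborel. wt k p * moved 0 p\<bar> \<le> S * Q + (l - k)\<^sup>2 * sqrt (M * mass * ((l - k) * Y))"
proof -
  define U where "U = uniform_measure lborel {-S..S}"
  have U: "prob_space U" unfolding U_def by (rule prob_space_uniform_interval) (use \<open>0 < S\<close> in simp)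
  interpret U: prob_space U by fact
  have sU[measurable_cong]: "sets U = sets borel" by (simp add: U_def)
  have cS: "\<bar>clip S s\<bar> \<le> S" for s by (rule abs_clip_le[OF \<open>0 < S\<close>])
  define Bw where "Bw p = avg U (\<lambda>s. clip S s *\<^sub>R clipped (snd p)) w (fst p)" for p
  define H where "H p = wt k p * (indicator {k..<l} (snd p) * \<psi> (snd p))" for p
  have Bm[measurable]: "Bw \<in> borel_measurable borel"
    unfolding Bw_def[abs_def] avg_def borel_prod[symmetric] by measurable
  have Hm[measurable]: "H \<in> borel_measurable borel"
    unfolding H_def[abs_def] \<psi>_def
    by (intro borel_measurable_times wt_meas) (simp_all add: borel_prod[symmetric])
  have Bb: "\<bar>Bw p\<bar> \<le> A" for p unfolding Bw_def by (rule avg_bound[OF U w(4)])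
  have Bz: "Bw p = 0" if "R2 < norm (fst p)" for p
  proof -
    have "w (fst p + clip S s *\<^sub>R clipped (snd p)) = 0" for s
      unfolding clipped_def using kl by (intro w(3) shift_outside that cS in_I) auto
    then show ?thesis by (simp add: Bw_def avg_def)
  qed
  have int: "integrable (U \<Otimes>\<^sub>M lborel) (\<lambda>(s, p). wt k p * moved (clip S s) p)"
  proof (rule integrable_pair_bounded_support[OF U, where C = "(l - k)\<^sup>2 * A" and R = "R2 + M"])
    show "(\<lambda>(s, p). wt k p * moved (clip S s) p) \<in> borel_measurable (U \<Otimes>\<^sub>M lborel)"
    proof -
      have [measurable]: "(fst :: (real^'n) \<times> real \<Rightarrow> _) \<in> borel \<rightarrow>\<^sub>M borel" "(snd :: (real^'n) \<times> real \<Rightarrow> _) \<in> borel \<rightarrow>\<^sub>M borel"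
        by (simp_all add: borel_prod[symmetric])
      show ?thesis unfolding moved_def \<psi>_def case_prod_beta' by measurable
    qed
    fix s p
    show "\<bar>(\<lambda>(s, p). wt k p * moved (clip S s) p) (s, p)\<bar> \<le> (l - k)\<^sup>2 * A"
      using mult_mono[OF wt_le_1[of k p] moved_bound[of "clip S s" p]] wt_nonneg[of k p] by (simp add: abs_mult)
    show "(\<lambda>(s, p). wt k p * moved (clip S s) p) (s, p) = 0" if "R2 + M < norm p"
    proof (rule ccontr)
      assume "(\<lambda>(s, p). wt k p * moved (clip S s) p) (s, p) \<noteq> 0"
      then have "wt k p \<noteq> 0" "moved (clip S s) p \<noteq> 0" by auto
      then have "norm (fst p) \<le> R2" "norm (snd p) \<le> M"
        using moved_zero[OF _ cS, of p s] wt_neq_0D(4,5)[OF _ kl(2), of p] by (auto simp: not_less[symmetric])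
      then show False using norm_Pair_le[of "fst p" "snd p"] that by simp
    qed
  qed
  interpret UL: pair_sigma_finite U "lborel :: ((real^'n) \<times> real) measure" ..
  have "(LINT s|U. LINT p|lborel. wt k p * moved (clip S s) p) = (LINT p|lborel. LINT s|U. wt k p * moved (clip S s) p)"
    using UL.Fubini_integral[OF int] by simp
  also have "\<dots> = (LINT p|lborel. H p * Bw p)"
  proof (rule Bochner_Integration.integral_cong[OF refl])
    fix p
    show "(LINT s|U. wt k p * moved (clip S s) p) = H p * Bw p"
      by (cases "snd p \<in> {k..<l}") (auto simp: moved_def H_def Bw_def avg_def clipped_def)
  qed
  finally have fub: "(LINT s|U. LINT p|lborel. wt k p * moved (clip S s) p) = (LINT p|lborel. H p * Bw p)" .
  have "\<bar>(LINT p|lborel. H p * Bw p) - (LINT p|lborel. wt k p * moved 0 p)\<bar> =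
     \<bar>LINT s|U. (LINT p|lborel. wt k p * moved (clip S s) p) - (LINT p|lborel. wt k p * moved 0 p)\<bar>"
    using UL.integrable_fst[OF int] fub by (subst Bochner_Integration.integral_diff) (auto simp: U.prob_space)
  also have "\<dots> \<le> S * Q" by (rule U.integral_le_bound) (rule translation_bound[OF cS])
  finally have 1: "\<bar>(LINT p|lborel. H p * Bw p) - (LINT p|lborel. wt k p * moved 0 p)\<bar> \<le> S * Q" .
  \<comment> \<open>Both factors must be square integrable on all of phase space: \<open>H'\<close>
    is cut off in \<open>x\<close> beyond the reach of the translates, \<open>B'\<close> in the
    velocity. Their product is unchanged.\<close>
  define H' where "H' p = wt k p * (indicator {k..<l} (snd p) * \<psi> (snd p) * indicator (cball (0::real^'n) R2) (fst p))" for p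
  define B' where "B' p = indicator {k..l} (snd p) * Bw p" for p
  have HB: "H p * Bw p = H' p * B' p" for p
    using Bz[of p] by (auto simp: H_def H'_def B'_def indicator_def)
  have \<psi>i: "\<bar>indicator {k..<l} t * \<psi> t * indicator C x\<bar> \<le> (l - k)\<^sup>2" for t x and C :: "(real^'n) set"
    using \<psi>_bounds[of t] by (auto simp: indicator_def)
  have [measurable]: "cball (0::real^'n) R2 \<in> sets borel" by simp
  have H'm: "(\<lambda>p. indicator {k..<l} (snd p) * \<psi> (snd p) * indicator (cball (0::real^'n) R2) (fst p)) \<in> borel_measurable borel"
    unfolding \<psi>_def borel_prod[symmetric] by measurable
  then have [measurable]: "H' \<in> borel_measurable borel" unfolding H'_def[abs_def] by measurable
  have B'm[measurable]: "B' \<in> borel_measurable borel" unfolding B'_def[abs_def]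
    using Bm by (simp add: borel_prod[symmetric])
  have iHB: "integrable lborel (\<lambda>p. H' p * B' p)"
  proof -
    have "integrable lborel (\<lambda>p. wt k p * ((indicator {k..<l} (snd p) * \<psi> (snd p) * indicator (cball (0::real^'n) R2) (fst p)) * B' p))"
    proof (rule integrable_wt[OF kl(2), where C = "(l - k)\<^sup>2 * A" and R = R2])
      show "(\<lambda>p. (indicator {k..<l} (snd p) * \<psi> (snd p) * indicator (cball (0::real^'n) R2) (fst p)) * B' p) \<in> borel_measurable borel"
        by (intro borel_measurable_times H'm B'm)
      fix p
      have "\<bar>B' p\<bar> \<le> A" using Bb[of p] A_nonneg by (simp add: B'_def indicator_def)
      then show "\<bar>(indicator {k..<l} (snd p) * \<psi> (snd p) * indicator (cball (0::real^'n) R2) (fst p)) * B' p\<bar> \<le> (l - k)\<^sup>2 * A"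
        unfolding abs_mult[of _ "B' p"] by (intro mult_mono \<psi>i) auto
    qed auto
    then show ?thesis by (simp add: H'_def mult.assoc)
  qed
  have iHH: "integrable lborel (\<lambda>p. H' p * H' p)"
    and HH: "(LINT p|lborel. H' p * H' p) \<le> ((l - k)\<^sup>2)\<^sup>2 * (M * mass)"
  proof -
    let ?j = "\<lambda>p. (indicator {k..<l} (snd p) * \<psi> (snd p) * indicator (cball (0::real^'n) R2) (fst p))\<^sup>2"
    have e: "H' p * H' p = wt k p * ?j p" for p
      by (simp add: H'_def wt_def power2_eq_square indicator_def)
    have b: "\<bar>?j p\<bar> \<le> ((l - k)\<^sup>2)\<^sup>2" for p
      using power_mono[OF \<psi>i, of "snd p" "cball (0::real^'n) R2" "fst p" 2] by simp
    show "integrable lborel (\<lambda>p. H' p * H' p)" unfolding e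
      by (rule integrable_wt[OF kl(2) _ b, where R = R2]) (use H'm in \<open>auto intro!: borel_measurable_power\<close>)
    have "\<bar>LINT p|lborel. wt k p * ?j p\<bar> \<le> ((l - k)\<^sup>2)\<^sup>2 * (M * mass)"
      by (rule integral_wt_bound[OF kl(2) order_refl b]) (use R in auto)
    then show "(LINT p|lborel. H' p * H' p) \<le> ((l - k)\<^sup>2)\<^sup>2 * (M * mass)" unfolding e by linarith
  qed
  have iBB: "integrable lborel (\<lambda>p. B' p * B' p)"
  proof (rule integrable_bounded_support[where C = "A * A" and R = "R2 + max \<bar>k\<bar> \<bar>l\<bar>"])
    fix p
    have "\<bar>B' p\<bar> \<le> A" using Bb[of p] A_nonneg by (simp add: B'_def indicator_def)
    from mult_mono[OF this this A_nonneg abs_ge_zero] show "norm (B' p * B' p) \<le> A * A"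
      unfolding real_norm_def abs_mult .
    show "B' p * B' p = 0" if "R2 + max \<bar>k\<bar> \<bar>l\<bar> < norm p"
    proof (cases "R2 < norm (fst p)")
      case False
      moreover have "norm p \<le> norm (fst p) + norm (snd p)" using norm_Pair_le[of "fst p" "snd p"] by simp
      ultimately have "max \<bar>k\<bar> \<bar>l\<bar> < norm (snd p)" using that by linarith
      then show ?thesis by (auto simp: B'_def indicator_def)
    qed (simp add: B'_def Bz)
  qed measurable
  have BB: "(LINT p|lborel. B' p * B' p) = (l - k) * Y"
  proof -
    have sq: "B' p * B' p = indicator {k..l} (snd p) * (avg U (\<lambda>s. clip S s *\<^sub>R clipped (snd p)) w (fst p))\<^sup>2" for p
      by (simp add: B'_def Bw_def power2_eq_square indicator_def)
    have "integrable (lborel \<Otimes>\<^sub>M lborel) (\<lambda>(x, t). indicator {k..l} t * (avg U (\<lambda>s. clip S s *\<^sub>R clipped t) w x)\<^sup>2)"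
      using iBB unfolding sq by (simp add: lborel_prod case_prod_beta')
    from lborel_pair.integral_snd[OF this]
    have "(LINT p|lborel. B' p * B' p) =
       (LINT t|lborel. LINT x|lborel. indicator {k..l} t * (avg U (\<lambda>s. clip S s *\<^sub>R clipped t) w x)\<^sup>2)"
      unfolding sq by (simp add: lborel_prod case_prod_beta')
    also have "\<dots> = (l - k) * Y"
      unfolding Y_def U_def[symmetric]
      by (subst integral_uniform_interval[OF _ kl(1)]) (use kl in \<open>simp_all add: avg_def\<close>)
    finally show ?thesis .
  qed
  have "(LINT p|lborel. H p * Bw p)\<^sup>2 \<le> ((l - k)\<^sup>2)\<^sup>2 * (M * mass * ((l - k) * Y))"
  proof -
    have "0 \<le> (l - k) * Y" unfolding BB[symmetric] by simp
    have "(LINT p|lborel. H p * Bw p)\<^sup>2 \<le> (LINT p|lborel. H' p * H' p) * (LINT p|lborel. B' p * B' p)"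
      unfolding HB by (rule integral_Cauchy_Schwarz[OF iHH iBB iHB])
    also have "\<dots> \<le> (((l - k)\<^sup>2)\<^sup>2 * (M * mass)) * ((l - k) * Y)"
      unfolding BB by (rule mult_right_mono[OF HH \<open>0 \<le> (l - k) * Y\<close>])
    finally show ?thesis by (simp add: mult.assoc)
  qed
  from real_sqrt_le_mono[OF this]
  have "\<bar>LINT p|lborel. H p * Bw p\<bar> \<le> (l - k)\<^sup>2 * sqrt (M * mass * ((l - k) * Y))"
    by (simp only: real_sqrt_mult[of "((l - k)\<^sup>2)\<^sup>2"] real_sqrt_abs abs_power2)
  with 1 show ?thesis by linarith
qed

end

section \<open>Decay across one dyadic scale under genuine nonlinearity\<close>

lemma powr_power_cancel:
  assumes "0 < (\<theta>::real)" "0 < N"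
  shows "(\<theta> powr (2 * (\<alpha> / (2 * real N)))) ^ N = \<theta> powr \<alpha>"
proof -
  have "(\<theta> powr (2 * (\<alpha> / (2 * real N)))) ^ N = \<theta> powr (real N * (2 * (\<alpha> / (2 * real N))))"
    by (rule powr_power) (use assms in simp)
  moreover have "real N * (2 * (\<alpha> / (2 * real N))) = \<alpha>" using assms by simp
  ultimately show ?thesis by simp
qed

lemma mollify_GDERIV:
  fixes h :: "real^'n \<Rightarrow> real"
  assumes "integrable lborel h" "0 < \<sigma>"
  shows "\<exists>D. \<forall>x. GDERIV (mollify h \<sigma>) x :> D x"
proof -
  have "C_k (Suc 0) (mollify h \<sigma>)" by (rule C_k_mollify[OF assms])
  then show ?thesis by auto
qed

locale gn_subsolution = subsolution a u K M lo I
  for a :: "real \<Rightarrow> real^'n" and u K M lo I +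
  fixes C0 \<alpha> :: real
  assumes \<alpha>: "0 < \<alpha>" "\<alpha> \<le> 1" and C0: "0 < C0"
    and gn: "\<And>k l \<xi> \<eta>. lo \<le> k \<Longrightarrow> l \<in> I \<Longrightarrow> norm \<xi> = 1 \<Longrightarrow> 0 < \<eta> \<Longrightarrow>
      measure lborel {v \<in> {k..l}. \<bar>a v \<bullet> \<xi>\<bar> < \<eta>} \<le> C0 * \<eta> powr \<alpha>"
begin

definition level :: "real \<Rightarrow> real \<Rightarrow> real" where
  "level k r = measure lborel {x \<in> cball 0 r. k \<le> u x}"

text \<open>With d = \<open>CARD('n)\<close>, the mollification scale \<sigma> = \<theta>^(8 (d +
  1)) and the translation length S = \<theta>^(6 (d + 1)) satisfy S^2 / \<sigma> = \<theta>^(4 (d +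
  1)) and \<sigma> / S = \<theta>^(2 (d + 1)). The first keeps the translation cost small; the
  second outweighs the loss \<theta>^(-(d + 1)) of the smoothing lemma.\<close>

definition scale_exp :: nat where "scale_exp = 8 * (CARD('n) + 1)"

text \<open>The nonlinearity condition gives \<theta>^\<alpha>; undoing the repeated squaring takes
  the root of order 2^d, and Cauchy--Schwarz takes one more square root.\<close>

definition gain_exp :: real where "gain_exp = \<alpha> / (2 * 2 ^ CARD('n))"

definition pairing :: "real \<Rightarrow> real \<Rightarrow> (real^'n \<Rightarrow> real) \<Rightarrow> real" where
  "pairing k l g = (LINT p|lborel. wt k p * (indicator {k..<l} (snd p) * ((snd p - k) * (l - snd p) * g (fst p))))"

definition decay_const :: real where
  "decay_const = 2 * ((1 + K) ^ CARD('n) * (2 * real CARD('n)) * M + 2 * real CARD('n) * C0)"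

definition scale_const :: "real \<Rightarrow> real" where
  "scale_const C = (2 * M + M\<^sup>2 * K * (2 * C * 2 ^ scale_exp)) * M * (K * (8 * C) * M) + M\<^sup>2 * sqrt (8 * M * (decay_const + M))"

lemma M_nonneg: "0 \<le> M"
  using order_trans[OF u_nonneg u_le] .

lemma level_nonneg: "0 \<le> level k r"
  by (simp add: level_def)

lemma gain_exp_bounds: "0 < gain_exp" "gain_exp \<le> 1"
proof -
  have "1 \<le> (2::real) * 2 ^ CARD('n)" using one_le_power[of "2::real" "CARD('n)"] by linarith
  then show "0 < gain_exp" "gain_exp \<le> 1" using \<alpha> by (auto simp: gain_exp_def divide_simps)
qed

lemma decay_const_nonneg: "0 \<le> decay_const"
  unfolding decay_const_def using K_nonneg M_nonneg C0 by simp

text \<open>The threshold in the nonlinearity condition is \<theta> itself. The translation cost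
  carries a factor of order S + S^2 / \<sigma>', at most a multiple of \<theta>, and the mean square
  of the directional average is of order U \<theta>^(2 \<open>gain_exp\<close>). After
  Cauchy--Schwarz against a set of measure U both contributions are linear in U with a positive
  power of \<theta>. The upper bound on \<theta> keeps all mollifications and translations inside
  the collar of width \<rho>.\<close>

lemma scale_bound:
  fixes h :: "real^'n \<Rightarrow> real"
  assumes grad: "0 < C" "\<And>(h::real^'n \<Rightarrow> real) \<sigma> x D. integrable lborel h \<Longrightarrow> (\<And>y. \<bar>h y\<bar> \<le> 1) \<Longrightarrow> 0 < \<sigma> \<Longrightarrow>
      GDERIV (mollify h \<sigma>) x :> D \<Longrightarrow> norm D \<le> C / \<sigma>"
    and kl: "lo \<le> k" "k < l" "l \<in> I" "l - k \<le> M"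
    and r: "0 \<le> r" "0 < \<rho>" "\<rho> \<le> 1" "r + \<rho> < 2"
    and h: "bsfun h" "\<And>x. \<bar>h x\<bar> \<le> 1" "\<And>x. r + \<rho> / 8 < norm x \<Longrightarrow> h x = 0"
    and H: "(LINT x|lborel. \<bar>h x\<bar>) \<le> 2 * level k (r + \<rho>)"
    and \<theta>: "0 < \<theta>" "\<theta> \<le> \<rho> / (8 * (K + 1))"
  shows "\<bar>pairing k l (\<lambda>x. mollify h ((\<theta> / 2) ^ scale_exp) x - mollify h (\<theta> ^ scale_exp) x)\<bar>
    \<le> scale_const C * level k (r + \<rho>) * \<theta> powr gain_exp / \<rho>"
proof -
  define m where "m = scale_exp"
  define d where "d = CARD('n)"
  have m: "m = 8 * (d + 1)" by (simp add: m_def d_def scale_exp_def)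
  define \<sigma> where "\<sigma> = \<theta> ^ m"
  define \<sigma>' where "\<sigma>' = (\<theta> / 2) ^ m"
  define S where "S = \<theta> ^ (6 * (d + 1))"
  define \<delta> where "\<delta> = l - k"
  define U where "U = level k (r + \<rho>)"
  define g where "g = (\<lambda>x. mollify h \<sigma>' x - mollify h \<sigma> x)"
  have K: "0 \<le> K" by (rule K_nonneg)
  have M: "0 < M" "0 < \<delta>" "\<delta> \<le> M" using kl by (auto simp: \<delta>_def)
  have U: "0 \<le> U" by (simp add: U_def level_nonneg)
  have \<theta>K: "\<theta> * (K + 1) \<le> \<rho> / 8" using \<theta>(2) K by (simp add: field_simps)
  have "0 \<le> \<theta> * K" using \<theta> K by simp
  then have \<theta>1: "\<theta> \<le> \<rho> / 8" "\<theta> * K \<le> \<rho> / 8" using \<theta>K \<theta>(1) by (auto simp: algebra_simps)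
  then have \<theta>le1: "\<theta> \<le> 1" using r by linarith
  have pos: "0 < \<sigma>" "0 < \<sigma>'" "0 < S" using \<theta> by (auto simp: \<sigma>_def \<sigma>'_def S_def)
  have \<sigma>'\<sigma>: "\<sigma>' \<le> \<sigma>" unfolding \<sigma>_def \<sigma>'_def using \<theta> by (intro power_mono) auto
  have \<sigma>\<theta>: "\<sigma> \<le> \<theta>" unfolding \<sigma>_def m using power_decreasing[of 1 "8 * (d + 1)" \<theta>] \<theta> \<theta>le1 by simp
  have S\<theta>: "S \<le> \<theta>" unfolding S_def using power_decreasing[of 1 "6 * (d + 1)" \<theta>] \<theta> \<theta>le1 by simp
  have ih: "integrable lborel h" by (rule bsfun_integrable[OF h(1)])
  \<comment> \<open>Mollified at scale \<rho>/8 this becomes the cutoff \<zeta>. It is 1 up to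
    radius r + 3\<rho>/8, as far as \<open>g\<close>, supported in radius r + \<rho>/4, can be moved
    by \<open>S * K \<le> \<rho> / 8\<close>; and it vanishes well before r + \<rho>.\<close>
  define c where "c = (indicator (cball 0 (r + \<rho> / 2)) :: real^'n \<Rightarrow> real)"
  have c2: "\<And>x. \<bar>c x\<bar> \<le> 1" "\<And>x. r + \<rho> / 2 < norm x \<Longrightarrow> c x = 0"
    by (auto simp: c_def indicator_def)
  moreover have "c \<in> borel_measurable borel" unfolding c_def by (rule borel_measurable_indicator) simp
  ultimately have "bsfun c" unfolding bsfun_def bfun_def by blast
  note c = this c2
  have ic: "integrable lborel c" by (rule bsfun_integrable[OF c(1)])
  obtain Dg1 where Dg1: "\<And>x. GDERIV (mollify h \<sigma>) x :> Dg1 x"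
    using mollify_GDERIV[OF ih pos(1)] by blast
  obtain Dg2 where Dg2: "\<And>x. GDERIV (mollify h \<sigma>') x :> Dg2 x"
    using mollify_GDERIV[OF ih pos(2)] by blast
  have "0 < \<rho> / 8" using r by simp
  obtain Dc where Dc: "\<And>x. GDERIV (mollify c (\<rho> / 8)) x :> Dc x"
    using mollify_GDERIV[OF ic \<open>0 < \<rho> / 8\<close>] by blast
  interpret kin: kinetic_test a u K M lo I k l S 2 "2 * C / \<sigma>'" "r + \<rho> / 4" "r + 3 * \<rho> / 8" "r + \<rho>" "8 * C / \<rho>"
    g "mollify c (\<rho> / 8)" "\<lambda>x. Dg2 x - Dg1 x" Dc
  proof
    show "k < l" "lo \<le> k" "l \<in> I" "0 \<le> S" using kl pos by auto
    show "C_k j g" for j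
      unfolding g_def using C_k_add[OF C_k_mollify[OF ih pos(2)] C_k_cmult[OF C_k_mollify[OF ih pos(1)]], of j "-1"] by simp
    show "GDERIV g x :> Dg2 x - Dg1 x" for x unfolding g_def by (rule GDERIV_diff[OF Dg2 Dg1])
    show "g x = 0" if "r + \<rho> / 4 < norm x" for x
      using mollify_support[OF h(3) pos(1), where x = x] mollify_support[OF h(3) pos(2), where x = x] that \<sigma>'\<sigma> \<sigma>\<theta> \<theta>1 by (simp add: g_def)
    show "\<bar>g x\<bar> \<le> 2" for x
      using mollify_bounds[OF bfun_measurable[OF bsfunD[OF h(1)]] h(2) pos(1), where x = x]
        mollify_bounds[OF bfun_measurable[OF bsfunD[OF h(1)]] h(2) pos(2), where x = x] by (simp add: g_def)
    show "norm (Dg2 x - Dg1 x) \<le> 2 * C / \<sigma>'" for x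
    proof -
      have "norm (Dg2 x - Dg1 x) \<le> C / \<sigma>' + C / \<sigma>"
        using norm_triangle_ineq4[of "Dg2 x" "Dg1 x"] grad(2)[OF ih h(2) pos(1) Dg1[of x]] grad(2)[OF ih h(2) pos(2) Dg2[of x]] by linarith
      moreover have "C / \<sigma> \<le> C / \<sigma>'" using \<sigma>'\<sigma> pos grad(1) by (intro divide_left_mono) auto
      moreover have "2 * C / \<sigma>' = C / \<sigma>' + C / \<sigma>'" by simp
      ultimately show ?thesis by linarith
    qed
    show "C_k j (mollify c (\<rho> / 8))" for j by (rule C_k_mollify[OF ic]) (use r in simp)
    show "GDERIV (mollify c (\<rho> / 8)) x :> Dc x" for x by (rule Dc)
    show "mollify c (\<rho> / 8) x = 0" if "r + \<rho> < norm x" for x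
      by (rule mollify_support[OF c(3)]) (use r that in auto)
    show "0 \<le> mollify c (\<rho> / 8) x" for x
      unfolding mollify_def by (rule integral_nonneg_AE) (use r in \<open>auto simp: c_def bump_nonneg\<close>)
    show "mollify c (\<rho> / 8) x = 1" if "norm x \<le> r + 3 * \<rho> / 8" for x
    proof -
      have "\<bar>mollify c (\<rho> / 8) x - 1\<bar> \<le> 0"
      proof (rule mollify_near[OF bfun_measurable[OF bsfunD[OF c(1)]] c(2)])
        fix y assume "dist x y \<le> \<rho> / 8"
        then have "norm y \<le> r + \<rho> / 2"
          using that norm_triangle_ineq2[of y x] by (simp add: dist_norm norm_minus_commute)
        then show "\<bar>c y - 1\<bar> \<le> 0" by (simp add: c_def)
      qed (use r in simp)
      then show ?thesis by simp
    qed
    show "norm (Dc x) \<le> 8 * C / \<rho>" for x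
      using grad(2)[OF ic c(2) _ Dc[of x]] r by (simp add: mult.commute)
    show "r + \<rho> / 4 + S * K \<le> r + 3 * \<rho> / 8"
      using mult_right_mono[OF S\<theta> K] \<theta>1 by simp
  qed (use r in auto)
  define Y where "Y = (LINT v|uniform_measure lborel {k..l}. LINT x|lborel.
      (avg (uniform_measure lborel {-S..S}) (\<lambda>s. clip S s *\<^sub>R kin.clipped v) g x)\<^sup>2)"
  have pk: "pairing k l g = (LINT p|lborel. wt k p * kin.moved 0 p)"
    by (simp add: pairing_def kin.moved_def kin.\<psi>_def)
  have mass: "measure lborel {x \<in> cball 0 (r + \<rho>). k \<le> u x} = U" by (simp add: U_def level_def)
  have avgd: "\<bar>pairing k l g\<bar> \<le> S * (kin.P * \<delta> * (K * (8 * C / \<rho>) * (M * U))) + \<delta>\<^sup>2 * sqrt (M * U * (\<delta> * Y))"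
    unfolding pk using kin.averaged_bound[OF pos(3)] unfolding mass Y_def \<delta>_def .
  \<comment> \<open>The two errors of \<open>directional_average_decay\<close>: the Lipschitz term,
    which reduces to \<theta>^(d + 1), and the probability of nearly orthogonal velocities. A factor
    \<open>M / \<delta> \<ge> 1\<close> brings the first to the form of the second.\<close>
  have Eb: "2 * (((1 + K) / \<theta>) ^ d * (real d * (2 / S) / \<theta>) * \<sigma> + 2 * real d * ((C0 * \<theta> powr \<alpha>) / \<delta>)) \<le> decay_const / \<delta> * \<theta> powr \<alpha>"
  proof -
    have "((1 + K) / \<theta>) ^ d * (real d * (2 / S) / \<theta>) * \<sigma> = (1 + K) ^ d * (2 * real d) * \<theta> ^ (d + 1)"
    proof -
      have "\<sigma> = S * \<theta> ^ (d + 1) * \<theta> ^ (d + 1)"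
        unfolding \<sigma>_def S_def m power_add[symmetric] by (rule arg_cong[where f = "\<lambda>n. \<theta> ^ n"]) simp
      then show ?thesis using \<theta> pos by (simp add: power_divide field_simps)
    qed
    also have "\<dots> \<le> (1 + K) ^ d * (2 * real d) * \<theta> powr \<alpha>"
    proof (rule mult_left_mono)
      have "\<theta> ^ (d + 1) \<le> \<theta> ^ 1" using \<theta> \<theta>le1 by (intro power_decreasing) auto
      also have "\<dots> = \<theta> powr 1" using \<theta> by simp
      also have "\<dots> \<le> \<theta> powr \<alpha>" using \<theta> \<theta>le1 \<alpha> by (intro powr_mono') auto
      finally show "\<theta> ^ (d + 1) \<le> \<theta> powr \<alpha>" .
    qed (use K in simp)
    also have "\<dots> \<le> (1 + K) ^ d * (2 * real d) * \<theta> powr \<alpha> * (M / \<delta>)"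
    proof -
      have "1 \<le> M / \<delta>" using M by simp
      moreover have "0 \<le> (1 + K) ^ d * (2 * real d) * \<theta> powr \<alpha>" using K by simp
      ultimately show ?thesis using mult_left_mono by fastforce
    qed
    finally have "((1 + K) / \<theta>) ^ d * (real d * (2 / S) / \<theta>) * \<sigma> \<le> (1 + K) ^ d * (2 * real d) * \<theta> powr \<alpha> * (M / \<delta>)" .
    then have "2 * (((1 + K) / \<theta>) ^ d * (real d * (2 / S) / \<theta>) * \<sigma> + 2 * real d * ((C0 * \<theta> powr \<alpha>) / \<delta>)) \<le>
        2 * ((1 + K) ^ d * (2 * real d) * \<theta> powr \<alpha> * (M / \<delta>) + 2 * real d * ((C0 * \<theta> powr \<alpha>) / \<delta>))"
      by (intro mult_left_mono add_right_mono) simp_all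
    also have "\<dots> = decay_const / \<delta> * \<theta> powr \<alpha>"
      unfolding decay_const_def d_def[symmetric] using M by (simp add: field_simps)
    finally show ?thesis .
  qed
  have H4: "4 * (LINT x|lborel. \<bar>h x\<bar>) \<le> 8 * U" using H unfolding U_def by linarith
  have "0 \<le> (LINT x|lborel. \<bar>h x\<bar>)" by (rule integral_nonneg_AE) (rule AE_I2, rule abs_ge_zero)
  then have H0: "0 \<le> 4 * (LINT x|lborel. \<bar>h x\<bar>)" by linarith
  define N where "N = (2::nat) ^ d"
  have "0 < N" by (simp add: N_def)
  have gE: "gain_exp = \<alpha> / (2 * real N)" by (simp only: gain_exp_def N_def d_def of_nat_power of_nat_numeral)
  have Yb: "Y ^ N \<le> (4 * (LINT x|lborel. \<bar>h x\<bar>)) ^ N *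
     (2 * (((1 + K) / \<theta>) ^ d * (real d * (2 / S) / \<theta>) * \<sigma> + 2 * real d * ((C0 * \<theta> powr \<alpha>) / \<delta>)))"
    unfolding Y_def g_def N_def d_def \<delta>_def
  proof (rule directional_average_decay[OF kl(2) pos(3) kin.clipped_meas kin.norm_clipped \<theta>(1) \<theta>le1 _ h(1,2) pos(2) \<sigma>'\<sigma> pos(1) order_refl])
    fix \<xi> :: "real^'n" assume \<xi>: "norm \<xi> = 1"
    have "{v \<in> {k..l}. \<bar>kin.clipped v \<bullet> \<xi>\<bar> < \<theta>} = {v \<in> {k..l}. \<bar>a v \<bullet> \<xi>\<bar> < \<theta>}"
      by (auto simp: kin.clipped_def)
    then show "measure lborel {v \<in> {k..l}. \<bar>kin.clipped v \<bullet> \<xi>\<bar> < \<theta>} \<le> C0 * \<theta> powr \<alpha>"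
      using gn[OF kl(1,3) \<xi> \<theta>(1)] by simp
  qed
  have "0 \<le> (4 * (LINT x|lborel. \<bar>h x\<bar>)) ^ N" by simp
  from order_trans[OF Yb mult_left_mono[OF Eb this]]
  have Yc: "Y ^ N \<le> (4 * (LINT x|lborel. \<bar>h x\<bar>)) ^ N * (decay_const / \<delta> * \<theta> powr \<alpha>)" .
  define D where "D = decay_const / \<delta>"
  have D0: "0 \<le> D" unfolding D_def using decay_const_nonneg M by simp
  define q where "q = \<theta> powr (2 * gain_exp)"
  have q0: "0 \<le> q" by (simp add: q_def)
  have qN: "q ^ N = \<theta> powr \<alpha>"
    using powr_power_cancel[OF \<theta>(1) \<open>0 < N\<close>, of \<alpha>] unfolding gE q_def .
  \<comment> \<open>Dominating D by an N-th power allows the root to be taken by comparing N-th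
    powers.\<close>
  have "D + 1 \<le> (D + 1) ^ N" by (rule self_le_power) (use D0 \<open>0 < N\<close> in auto)
  then have "D \<le> (D + 1) ^ N" by linarith
  then have f2: "D * q ^ N \<le> (D + 1) ^ N * q ^ N" by (rule mult_right_mono) (use q0 in simp)
  have f1: "(4 * (LINT x|lborel. \<bar>h x\<bar>)) ^ N \<le> (8 * U) ^ N" by (rule power_mono[OF H4 H0])
  have "Y ^ N \<le> (8 * U) ^ N * ((D + 1) ^ N * q ^ N)"
    using order_trans[OF Yc[folded D_def qN] mult_mono[OF f1 f2]] U D0 q0 by simp
  also have "\<dots> = (8 * U * ((D + 1) * q)) ^ N"
    by (simp add: power_mult_distrib)
  finally have Yp: "Y ^ N \<le> (8 * U * ((D + 1) * q)) ^ N" .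
  obtain n where n: "N = Suc n" using \<open>0 < N\<close> gr0_conv_Suc by blast
  have "Y \<le> 8 * U * ((D + 1) * q)"
    by (rule power_le_imp_le_base[OF Yp[unfolded n]]) (use U D0 q0 in auto)
  then have Y: "Y \<le> 8 * U * ((decay_const / \<delta> + 1) * \<theta> powr (2 * gain_exp))"
    by (simp only: D_def q_def)
  have "M * U * (\<delta> * Y) \<le> M * U * (8 * U * ((decay_const + M) * \<theta> powr (2 * gain_exp)))"
  proof (intro mult_left_mono)
    \<comment> \<open>The length \<delta> of the velocity interval cancels the
      \<open>1 / \<delta>\<close> in the bound for \<open>Y\<close>, so the constant does not
      degenerate as \<open>l\<close> approaches \<open>k\<close>, which the iteration over levels
      requires.\<close>
    have "\<delta> * Y \<le> \<delta> * (8 * U * ((decay_const / \<delta> + 1) * \<theta> powr (2 * gain_exp)))"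
      using Y M by (intro mult_left_mono) auto
    also have "\<dots> = 8 * U * ((decay_const + \<delta>) * \<theta> powr (2 * gain_exp))"
      using M by (simp add: field_simps)
    also have "\<dots> \<le> 8 * U * ((decay_const + M) * \<theta> powr (2 * gain_exp))"
      using M U by (intro mult_left_mono mult_right_mono) auto
    finally show "\<delta> * Y \<le> 8 * U * ((decay_const + M) * \<theta> powr (2 * gain_exp))" .
  qed (use M U in auto)
  also have "\<dots> = (8 * M * (decay_const + M)) * (U * \<theta> powr gain_exp)\<^sup>2"
    using \<theta> by (simp add: power2_eq_square powr_add[symmetric])
  finally have "sqrt (M * U * (\<delta> * Y)) \<le> sqrt ((8 * M * (decay_const + M)) * (U * \<theta> powr gain_exp)\<^sup>2)"
    by (rule real_sqrt_le_mono)
  also have "\<dots> = sqrt (8 * M * (decay_const + M)) * (U * \<theta> powr gain_exp)"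
    using U by (simp only: real_sqrt_mult[of "8 * M * (decay_const + M)"] real_sqrt_abs) simp
  finally have "sqrt (M * U * (\<delta> * Y)) \<le> sqrt (8 * M * (decay_const + M)) * (U * \<theta> powr gain_exp)" .
  then have "\<delta>\<^sup>2 * sqrt (M * U * (\<delta> * Y)) \<le> \<delta>\<^sup>2 * (sqrt (8 * M * (decay_const + M)) * (U * \<theta> powr gain_exp))"
    by (rule mult_left_mono) simp
  also have "\<dots> \<le> M\<^sup>2 * (sqrt (8 * M * (decay_const + M)) * (U * \<theta> powr gain_exp))"
    using M U decay_const_nonneg by (intro mult_right_mono power_mono) auto
  also have "\<dots> \<le> M\<^sup>2 * (sqrt (8 * M * (decay_const + M)) * (U * \<theta> powr gain_exp)) / \<rho>"
  proof -
    have "0 \<le> M\<^sup>2 * (sqrt (8 * M * (decay_const + M)) * (U * \<theta> powr gain_exp))" using M U decay_const_nonneg by simp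
    then show ?thesis using r(2,3) by (simp add: le_divide_eq_1 pos_le_divide_eq mult_left_le)
  qed
  finally have T: "\<delta>\<^sup>2 * sqrt (M * U * (\<delta> * Y)) \<le> M\<^sup>2 * sqrt (8 * M * (decay_const + M)) * U * \<theta> powr gain_exp / \<rho>"
    by (simp add: mult.assoc)
  have SP: "S * kin.P * \<delta> \<le> \<theta> powr gain_exp * (2 * M + M\<^sup>2 * K * (2 * C * 2 ^ m)) * M"
  proof -
    have "\<theta> powr 1 \<le> \<theta> powr gain_exp" using \<theta> \<theta>le1 gain_exp_bounds by (intro powr_mono') auto
    then have \<theta>g: "\<theta> \<le> \<theta> powr gain_exp" using \<theta> by simp
    \<comment> \<open>This quotient is the part of the cost caused by the gradient of
      \<open>g\<close>, of order \<open>1 / \<sigma>'\<close>.\<close>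
    have "S * S / \<sigma>' = 2 ^ m * \<theta> ^ (4 * (d + 1))"
    proof -
      have "S * S = \<sigma> * \<theta> ^ (4 * (d + 1))"
        unfolding \<sigma>_def S_def m power_add[symmetric] by (rule arg_cong[where f = "\<lambda>n. \<theta> ^ n"]) simp
      moreover have "\<sigma>' = \<sigma> / 2 ^ m" by (simp add: \<sigma>_def \<sigma>'_def power_divide)
      ultimately show ?thesis using pos by simp
    qed
    also have "\<dots> \<le> 2 ^ m * \<theta>"
      using power_decreasing[of 1 "4 * (d + 1)" \<theta>] \<theta> \<theta>le1 by simp
    finally have SS: "S * S / \<sigma>' \<le> 2 ^ m * \<theta>" .
    have "S * kin.P = 2 * \<delta> * S + \<delta>\<^sup>2 * K * (2 * C) * (S * S / \<sigma>')"
      unfolding kin.P_def \<delta>_def[symmetric] by (simp add: algebra_simps)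
    also have "\<dots> \<le> 2 * M * \<theta> + M\<^sup>2 * K * (2 * C) * (2 ^ m * \<theta>)"
      using M S\<theta> SS K grad(1) pos \<theta> by (intro add_mono mult_mono power_mono) auto
    also have "\<dots> = \<theta> * (2 * M + M\<^sup>2 * K * (2 * C * 2 ^ m))" by (simp add: algebra_simps)
    also have "\<dots> \<le> \<theta> powr gain_exp * (2 * M + M\<^sup>2 * K * (2 * C * 2 ^ m))"
      using \<theta>g M K grad(1) by (intro mult_right_mono) auto
    finally show ?thesis by (rule mult_mono) (use M K grad(1) in auto)
  qed
  have "S * (kin.P * \<delta> * (K * (8 * C / \<rho>) * (M * U))) = (S * kin.P * \<delta>) * (K * (8 * C) * M * U / \<rho>)"
    by simp
  also have "\<dots> \<le> (\<theta> powr gain_exp * (2 * M + M\<^sup>2 * K * (2 * C * 2 ^ m)) * M) * (K * (8 * C) * M * U / \<rho>)"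
    using SP K grad(1) M U r by (intro mult_right_mono) auto
  finally have "\<bar>pairing k l g\<bar> \<le> (\<theta> powr gain_exp * (2 * M + M\<^sup>2 * K * (2 * C * 2 ^ m)) * M) * (K * (8 * C) * M * U / \<rho>)
     + M\<^sup>2 * sqrt (8 * M * (decay_const + M)) * U * \<theta> powr gain_exp / \<rho>"
    using avgd T by linarith
  also have "\<dots> = scale_const C * U * \<theta> powr gain_exp / \<rho>"
    using r by (simp add: scale_const_def m_def[symmetric] field_simps)
  finally show ?thesis by (simp add: g_def U_def \<sigma>_def \<sigma>'_def m_def)
qed

end

text \<open>Outer regularity keeps the L^1 norm near the measure of \<open>F\<close>, and the
  distance to \<open>F\<close> supplies the function. Lipschitz continuity makes its mollifications
  converge uniformly; \<Lambda> may depend on \<open>F\<close> and \<open>e\<close>, as it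
  disappears in the limit of the dyadic expansion.\<close>

lemma Lipschitz_cutoff:
  fixes F :: "(real^'n) set"
  assumes F: "compact F" "F \<noteq> {}" "F \<subseteq> cball 0 r" and "0 < s" "0 < e"
  obtains h \<Lambda> where "bsfun h" "\<And>x. 0 \<le> h x" "\<And>x. h x \<le> 1" "\<And>x. x \<in> F \<Longrightarrow> h x = 1" "\<And>x. r + s < norm x \<Longrightarrow> h x = 0"
    "\<And>x y. \<bar>h x - h y\<bar> \<le> \<Lambda> * dist x y" "0 \<le> \<Lambda>" "(LINT x|lborel. \<bar>h x\<bar>) \<le> measure lborel F + e"
proof -
  have Fb: "F \<in> sets borel" using F(1) by (simp add: borel_compact)
  obtain V where V: "open V" "F \<subseteq> V" "emeasure lborel (V - F) < e"
    using outer_regular_lborel[OF Fb \<open>0 < e\<close>] by blast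
  define W where "W = V \<inter> ball 0 (r + s)"
  have W: "open W" "F \<subseteq> W" using V F(3) \<open>0 < s\<close> by (force simp: W_def)+
  obtain \<epsilon> where \<epsilon>: "0 < \<epsilon>" "{x. infdist x F \<le> \<epsilon>} \<subseteq> W"
    using compact_in_open_separated[OF F(2,1) W] by blast
  define h where "h x = max 0 (1 - infdist x F / \<epsilon>)" for x
  have hc: "continuous_on UNIV h" unfolding h_def by (intro continuous_intros continuous_on_infdist) (use \<epsilon> in auto)
  have h01: "0 \<le> h x" "h x \<le> 1" for x using \<epsilon> by (auto simp: h_def infdist_nonneg)
  have hF: "h x = 1" if "x \<in> F" for x using that by (simp add: h_def)
  have hW: "x \<in> W" if "h x \<noteq> 0" for x
  proof -
    have "infdist x F < \<epsilon>" using that \<epsilon>(1) by (auto simp: h_def max_def field_simps split: if_splits)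
    then show ?thesis using \<epsilon>(2) by auto
  qed
  have hz: "h x = 0" if "r + s < norm x" for x using hW[of x] that by (auto simp: W_def)
  have bs: "bsfun h" unfolding bsfun_def bfun_def
    using hc h01 hz by (intro conjI exI[of _ 1] exI[of _ "r + s"]) (auto intro: borel_measurable_continuous_onI)
  have lip: "\<bar>h x - h y\<bar> \<le> 1 / \<epsilon> * dist x y" for x y
  proof -
    have "\<bar>h x - h y\<bar> \<le> \<bar>infdist x F / \<epsilon> - infdist y F / \<epsilon>\<bar>" unfolding h_def by linarith
    also have "\<dots> = \<bar>infdist x F - infdist y F\<bar> / \<epsilon>" using \<epsilon> by (simp add: diff_divide_distrib[symmetric])
    also have "\<dots> \<le> dist x y / \<epsilon>" using \<epsilon> by (intro divide_right_mono infdist_triangle_abs) auto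
    finally show ?thesis by simp
  qed
  have bW: "bounded W" unfolding W_def by (rule bounded_subset[OF bounded_ball]) auto
  have fW: "emeasure lborel W < \<infinity>" by (rule emeasure_bounded_finite[OF bW])
  have "(LINT x|lborel. \<bar>h x\<bar>) \<le> (LINT x|lborel. indicator W x)"
  proof (rule integral_mono')
    show "integrable lborel (indicator W :: real^'n \<Rightarrow> real)"
      by (rule integrable_real_indicator) (use W fW in auto)
    show "\<bar>h x\<bar> \<le> indicator W x" for x using h01[of x] hW[of x] by (cases "x \<in> W") auto
  qed simp
  also have "\<dots> = measure lborel W" by simp
  also have "\<dots> = measure lborel F + measure lborel (W - F)"
  proof -
    have "measure lborel (W - F) = measure lborel W - measure lborel F"
      by (rule measure_Diff) (use fW W Fb in \<open>auto\<close>)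
    then show ?thesis by simp
  qed
  also have "measure lborel (W - F) \<le> e"
  proof -
    have "emeasure lborel (W - F) \<le> emeasure lborel (V - F)"
      using V(1) Fb by (intro emeasure_mono) (auto simp: W_def)
    then have "emeasure lborel (W - F) \<le> ennreal e" using V(3) by simp
    then show ?thesis unfolding measure_def using \<open>0 < e\<close> by (simp add: enn2real_leI)
  qed
  finally show ?thesis using that[OF bs h01 hF hz lip] \<epsilon>(1) by simp
qed

text \<open>Inner regularity, supplying the compact set for \<open>Lipschitz_cutoff\<close>; the
  lost half of the measure costs a factor 2.\<close>

lemma compact_half_measure:
  fixes E :: "(real^'n) set"
  assumes E: "E \<in> sets borel" "bounded E" and pos: "0 < measure lborel E"
  obtains F where "compact F" "F \<subseteq> E" "measure lborel E / 2 \<le> measure lborel F"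
proof -
  have "E \<in> sets lebesgue" "0 < measure lborel E / 2" using E(1) pos by simp_all
  then obtain T where T: "closed T" "T \<subseteq> E" "E - T \<in> lmeasurable" "emeasure lebesgue (E - T) < ennreal (measure lborel E / 2)"
    by (rule sets_lebesgue_inner_closed)
  have "compact T" using T(1,2) E(2) bounded_subset compact_eq_bounded_closed by blast
  have "emeasure lborel E < \<infinity>" by (rule emeasure_bounded_finite[OF E(2)])
  then have "measure lborel (E - T) = measure lborel E - measure lborel T"
    by (intro measure_Diff) (use E T in auto)
  moreover have "measure lborel (E - T) \<le> measure lborel E / 2"
  proof -
    have "emeasure lborel (E - T) \<le> ennreal (measure lborel E / 2)" using T(4) E(1) T(1) by simp
    then show ?thesis unfolding measure_def[of lborel "E - T"] by (intro enn2real_leI) auto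
  qed
  ultimately show ?thesis using that[OF \<open>compact T\<close> T(2)] by linarith
qed

section \<open>Bounds from below and above for the pairing with a cutoff\<close>

context gn_subsolution
begin

lemma weight_bound:
  fixes t y c :: real
  assumes "k < l" "\<bar>y\<bar> \<le> c"
  shows "\<bar>indicator {k..<l} t * ((t - k) * (l - t) * y)\<bar> \<le> (l - k)\<^sup>2 * c"
proof -
  have "0 \<le> c" using order_trans[OF abs_ge_zero assms(2)] .
  moreover have "\<bar>(t - k) * (l - t)\<bar> \<le> (l - k)\<^sup>2" if "k \<le> t" "t < l"
    unfolding abs_mult power2_eq_square using that by (intro mult_mono) auto
  ultimately show ?thesis using assms mult_mono[of "\<bar>(t - k) * (l - t)\<bar>" "(l - k)\<^sup>2" "\<bar>y\<bar>" c]
    by (auto simp: indicator_def abs_mult)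
qed

lemma weight_meas:
  assumes [measurable]: "g \<in> borel_measurable borel"
  shows "(\<lambda>p::(real^'n) \<times> real. indicator {k..<l} (snd p) * ((snd p - k) * (l - snd p) * g (fst p))) \<in> borel_measurable borel"
  unfolding borel_prod[symmetric] by measurable

lemma integrable_pairing:
  assumes "lo \<le> k" "k < l" "bsfun g"
  shows "integrable lborel (\<lambda>p. wt k p * (indicator {k..<l} (snd p) * ((snd p - k) * (l - snd p) * g (fst p))))"
proof -
  obtain C where C: "\<And>x. \<bar>g x\<bar> \<le> C" using bfunE[OF bsfunD[OF assms(3)]] by metis
  obtain R where R: "\<And>x. R < norm x \<Longrightarrow> g x = 0" using assms(3) by (auto simp: bsfun_def)
  show ?thesis
    by (rule integrable_wt[OF assms(1) weight_meas[OF bfun_measurable[OF bsfunD[OF assms(3)]]] weight_bound[OF assms(2) C]])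
      (use R in auto)
qed

lemma pairing_bound:
  assumes "lo \<le> k" "k < l" "\<And>x. \<bar>g x\<bar> \<le> c" "\<And>x. R < norm x \<Longrightarrow> g x = 0"
  shows "\<bar>pairing k l g\<bar> \<le> (l - k)\<^sup>2 * c * (M * level k R)"
  unfolding pairing_def level_def
  by (rule integral_wt_bound[OF assms(1) order_refl weight_bound[OF assms(2,3)]])
    (use assms order_trans[OF abs_ge_zero assms(3)] in auto)

lemma pairing_diff:
  assumes "lo \<le> k" "k < l" "bsfun f" "bsfun g"
  shows "pairing k l (\<lambda>x. f x - g x) = pairing k l f - pairing k l g"
  unfolding pairing_def Bochner_Integration.integral_diff[OF integrable_pairing[OF assms(1-3)] integrable_pairing[OF assms(1,2,4)], symmetric]
  by (intro Bochner_Integration.integral_cong refl) (simp add: algebra_simps)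

text \<open>Over \<open>F\<close> the kinetic function equals 1 on the whole velocity interval. On
  its middle half, of length (l - k)/2, both factors of the weight are at least (l - k)/4.\<close>

lemma pairing_lower_bound:
  assumes kl: "lo \<le> k" "k < l" and h: "bsfun h" "\<And>x. 0 \<le> h x"
    and F: "F \<in> sets borel" "bounded F" "\<And>x. x \<in> F \<Longrightarrow> h x = 1" "\<And>x. x \<in> F \<Longrightarrow> l \<le> u x"
  shows "measure lborel F * ((l - k) ^ 3 / 32) \<le> pairing k l h"
proof -
  define \<delta> where "\<delta> = l - k"
  have \<delta>: "0 < \<delta>" using kl by (simp add: \<delta>_def)
  have le: "k + \<delta> / 4 \<le> l - \<delta> / 4" using \<delta> by (simp add: \<delta>_def field_simps)
  note ms = measure_Times_interval[OF F(1,2) le]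
  have "measure lborel F * ((l - k) ^ 3 / 32) = (\<delta>\<^sup>2 / 16) * measure lborel (F \<times> {k + \<delta> / 4..l - \<delta> / 4})"
    unfolding ms(1) by (simp add: \<delta>_def power2_eq_square power3_eq_cube field_simps)
  also have "\<dots> = (LINT p|lborel. (\<delta>\<^sup>2 / 16) * indicator (F \<times> {k + \<delta> / 4..l - \<delta> / 4}) p)" using ms by simp
  also have "\<dots> \<le> pairing k l h"
    unfolding pairing_def
  proof (rule integral_mono')
    show "integrable lborel (\<lambda>p. wt k p * (indicator {k..<l} (snd p) * ((snd p - k) * (l - snd p) * h (fst p))))"
      by (rule integrable_pairing[OF kl h(1)])
    fix p
    have nn: "0 \<le> wt k p * (indicator {k..<l} (snd p) * ((snd p - k) * (l - snd p) * h (fst p)))"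
      using h(2) wt_nonneg by (auto simp: indicator_def)
    then show "0 \<le> wt k p * (indicator {k..<l} (snd p) * ((snd p - k) * (l - snd p) * h (fst p)))" .
    show "(\<delta>\<^sup>2 / 16) * indicator (F \<times> {k + \<delta> / 4..l - \<delta> / 4}) p \<le> wt k p * (indicator {k..<l} (snd p) * ((snd p - k) * (l - snd p) * h (fst p)))"
    proof (cases "p \<in> F \<times> {k + \<delta> / 4..l - \<delta> / 4}")
      case True
      then have x: "fst p \<in> F" and t: "k + \<delta> / 4 \<le> snd p" "snd p \<le> l - \<delta> / 4" by (auto simp: mem_Times_iff)
      have "wt k p = 1" using F(4)[OF x] t \<delta> by (simp add: wt_def indicator_def)
      moreover have "snd p \<in> {k..<l}" using t \<delta> by auto
      moreover have "(\<delta> / 4) * (\<delta> / 4) \<le> (snd p - k) * (l - snd p)" using t \<delta> by (intro mult_mono) auto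
      ultimately show ?thesis using True F(3)[OF x] by (simp add: power2_eq_square)
    qed (use nn in simp)
  qed
  finally show ?thesis .
qed

text \<open>The scale \<theta>/2^j contributes a bound proportional to
  (\<theta>/2^j)^\<open>gain_exp\<close>, so the differences of successive mollifications sum as a
  geometric series. The coarsest mollification is estimated by its supremum.\<close>

lemma pairing_upper_bound:
  assumes grad: "0 < C" "\<And>(h::real^'n \<Rightarrow> real) \<sigma> x D. integrable lborel h \<Longrightarrow> (\<And>y. \<bar>h y\<bar> \<le> 1) \<Longrightarrow> 0 < \<sigma> \<Longrightarrow>
      GDERIV (mollify h \<sigma>) x :> D \<Longrightarrow> norm D \<le> C / \<sigma>"
    and sup: "0 < C'" "\<And>(h::real^'n \<Rightarrow> real) \<sigma> x. integrable lborel h \<Longrightarrow> 0 < \<sigma> \<Longrightarrow>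
      \<bar>mollify h \<sigma> x\<bar> \<le> C' / \<sigma> ^ CARD('n) * (LINT y|lborel. \<bar>h y\<bar>)"
    and kl: "lo \<le> k" "k < l" "l \<in> I" "l - k \<le> M"
    and r: "0 \<le> r" "0 < \<rho>" "\<rho> \<le> 1" "r + \<rho> < 2"
    and h: "bsfun h" "\<And>x. \<bar>h x\<bar> \<le> 1" "\<And>x. r + \<rho> / 8 < norm x \<Longrightarrow> h x = 0"
      "\<And>x y. \<bar>h x - h y\<bar> \<le> \<Lambda> * dist x y" "0 \<le> \<Lambda>"
    and H: "(LINT x|lborel. \<bar>h x\<bar>) \<le> 2 * level k (r + \<rho>)"
    and \<theta>: "0 < \<theta>" "\<theta> \<le> \<rho> / (8 * (K + 1))"
  shows "pairing k l h \<le> (l - k)\<^sup>2 * (C' / \<theta> ^ (scale_exp * CARD('n)) * (2 * level k (r + \<rho>))) * (M * level k (r + \<rho>))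
    + scale_const C * level k (r + \<rho>) * \<theta> powr gain_exp / \<rho> * (1 / (1 - (1/2) powr gain_exp))"
proof -
  define U where "U = level k (r + \<rho>)"
  have U: "0 \<le> U" by (simp add: U_def level_nonneg)
  define \<sigma> where "\<sigma> j = (\<theta> / 2 ^ j) ^ scale_exp" for j :: nat
  define w where "w j = mollify h (\<sigma> j)" for j
  have \<sigma>0: "0 < \<sigma> j" for j using \<theta> by (simp add: \<sigma>_def)
  have se: "1 \<le> scale_exp" by (simp add: scale_exp_def)
  have "\<rho> / (8 * (K + 1)) \<le> \<rho> / 8"
    using K_nonneg r by (intro divide_left_mono) auto
  with \<theta>(2) have \<theta>8: "\<theta> \<le> \<rho> / 8" by linarith
  with r have \<theta>1: "\<theta> \<le> 1" by linarith
  have \<theta>j: "0 < \<theta> / 2 ^ j" "\<theta> / 2 ^ j \<le> \<theta>" for j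
    using \<theta> one_le_power[of "2::real" j] by (auto simp: divide_le_eq mult_le_cancel_left1)
  have \<sigma>le: "\<sigma> j \<le> \<theta> / 2 ^ j" for j
  proof -
    have "\<theta> / 2 ^ j \<le> 1" using \<theta>j(2)[of j] \<theta>1 by linarith
    from power_decreasing[OF se less_imp_le[OF \<theta>j(1)] this] show ?thesis unfolding \<sigma>_def power_one_right .
  qed
  have \<sigma>8: "\<sigma> j \<le> \<rho> / 8" for j using \<sigma>le[of j] \<theta>j[of j] \<theta>8 by linarith
  have bw: "bsfun (w j)" for j unfolding w_def by (rule bsfun_mollify[OF h(1) \<sigma>0])
  have hz: "h x = 0" if "r + \<rho> < norm x" for x using h(3)[of x] that r by simp
  have wz: "w j x = 0" if "r + \<rho> < norm x" for j x
    unfolding w_def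
  proof (rule mollify_support[where R = "r + \<rho> / 8", OF h(3) \<sigma>0])
    show "r + \<rho> / 8 + \<sigma> j < norm x" using that \<sigma>8[of j] r(2) by argo
  qed
  have ih: "integrable lborel h" by (rule bsfun_integrable[OF h(1)])
  \<comment> \<open>One factor U comes from the L^1 norm of \<open>h\<close> in the supremum bound,
    the other from the support of the kinetic function: this is the quadratic term.\<close>
  have base: "pairing k l (w 0) \<le> (l - k)\<^sup>2 * (C' / \<theta> ^ (scale_exp * CARD('n)) * (2 * U)) * (M * U)"
  proof -
    have "\<bar>w 0 x\<bar> \<le> C' / \<theta> ^ (scale_exp * CARD('n)) * (2 * U)" for x
    proof -
      have "\<bar>w 0 x\<bar> \<le> C' / \<sigma> 0 ^ CARD('n) * (LINT y|lborel. \<bar>h y\<bar>)" unfolding w_def by (rule sup(2)[OF ih \<sigma>0])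
      also have "\<dots> \<le> C' / \<sigma> 0 ^ CARD('n) * (2 * U)"
        using H sup(1) less_imp_le[OF \<sigma>0[of 0]] by (intro mult_left_mono) (auto simp: U_def)
      finally have *: "\<bar>w 0 x\<bar> \<le> C' / \<sigma> 0 ^ CARD('n) * (2 * U)" .
      have s0: "\<sigma> 0 ^ CARD('n) = \<theta> ^ (scale_exp * CARD('n))"
        by (simp only: \<sigma>_def power_0 div_by_1 power_mult)
      show ?thesis using * unfolding s0 .
    qed
    from pairing_bound[where R = "r + \<rho>" and g = "w 0", OF kl(1,2) this wz] show ?thesis unfolding U_def by linarith
  qed
  let ?S = "scale_const C * U / \<rho>"
  define \<gamma> where "\<gamma> = (1/2::real) powr gain_exp"
  have \<gamma>: "0 < \<gamma>" "\<gamma> < 1"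
  proof -
    show "0 < \<gamma>" by (simp add: \<gamma>_def)
    have "(1/2::real) powr gain_exp < 1 powr gain_exp" using gain_exp_bounds by (intro powr_less_mono2) auto
    then show "\<gamma> < 1" by (simp add: \<gamma>_def)
  qed
  have step: "\<bar>pairing k l (w (Suc j)) - pairing k l (w j)\<bar> \<le> ?S * \<theta> powr gain_exp * \<gamma> ^ j" for j
  proof -
    have "\<theta> / 2 ^ j \<le> \<rho> / (8 * (K + 1))" using \<theta>j[of j] \<theta> by linarith
    from scale_bound[OF grad kl r h(1-3) H \<theta>j(1) this]
    have "\<bar>pairing k l (\<lambda>x. w (Suc j) x - w j x)\<bar> \<le> scale_const C * U * (\<theta> / 2 ^ j) powr gain_exp / \<rho>"
      by (simp add: w_def \<sigma>_def U_def mult.commute)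
    moreover have "(\<theta> / 2 ^ j) powr gain_exp = \<theta> powr gain_exp * \<gamma> ^ j"
    proof -
      have "\<theta> / 2 ^ j = \<theta> * (1/2) ^ j" by (simp add: power_divide)
      then have "(\<theta> / 2 ^ j) powr gain_exp = \<theta> powr gain_exp * ((1/2) ^ j) powr gain_exp"
        using \<theta> by (simp add: powr_mult)
      also have "((1/2::real) ^ j) powr gain_exp = \<gamma> ^ j"
      proof -
        have "((1/2::real) ^ j) powr gain_exp = ((1/2) powr real j) powr gain_exp"
          by (subst powr_realpow) simp_all
        also have "\<dots> = (1/2) powr (real j * gain_exp)" by (rule powr_powr)
        also have "\<dots> = \<gamma> ^ j" unfolding \<gamma>_def by (rule powr_power[symmetric]) simp
        finally show ?thesis .
      qed
      finally show ?thesis .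
    qed
    ultimately show ?thesis unfolding pairing_diff[OF kl(1,2) bw bw] by (simp add: mult_ac)
  qed
  have S0: "0 \<le> ?S * \<theta> powr gain_exp"
    using order_trans[OF abs_ge_zero step[of 0]] by simp
  have tel: "pairing k l (w J) \<le> pairing k l (w 0) + ?S * \<theta> powr gain_exp * (1 / (1 - \<gamma>))" for J
  proof -
    have "pairing k l (w J) - pairing k l (w 0) = (\<Sum>j<J. pairing k l (w (Suc j)) - pairing k l (w j))"
      using sum_lessThan_telescope[of "\<lambda>j. pairing k l (w j)" J] by simp
    also have "\<dots> \<le> (\<Sum>j<J. ?S * \<theta> powr gain_exp * \<gamma> ^ j)"
      using step by (intro sum_mono) (simp only: abs_le_iff)
    also have "\<dots> = ?S * \<theta> powr gain_exp * (\<Sum>j<J. \<gamma> ^ j)" by (simp add: sum_distrib_left)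
    also have "\<dots> \<le> ?S * \<theta> powr gain_exp * (1 / (1 - \<gamma>))"
    proof (rule mult_left_mono[OF _ S0])
      have "(\<Sum>j<J. \<gamma> ^ j) = (1 - \<gamma> ^ J) / (1 - \<gamma>)" using \<gamma> by (simp add: sum_gp_strict)
      also have "\<dots> \<le> 1 / (1 - \<gamma>)" using \<gamma> by (intro divide_right_mono) auto
      finally show "(\<Sum>j<J. \<gamma> ^ j) \<le> 1 / (1 - \<gamma>)" .
    qed
    finally show ?thesis by simp
  qed
  \<comment> \<open>The uncontrolled constant \<Lambda> occurs only here, multiplied by (1/2)^J; it
    drops out in the limit.\<close>
  have near: "pairing k l h \<le> pairing k l (w J) + (l - k)\<^sup>2 * (\<Lambda> * \<theta>) * (M * U) * (1/2) ^ J" for J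
  proof -
    have "\<bar>h x - w J x\<bar> \<le> \<Lambda> * (\<theta> / 2 ^ J)" for x
    proof -
      have "\<bar>w J x - h x\<bar> \<le> \<Lambda> * \<sigma> J" unfolding w_def
      proof (rule mollify_near[OF bfun_measurable[OF bsfunD[OF h(1)]] h(2) _ \<sigma>0])
        fix y assume "dist x y \<le> \<sigma> J"
        then show "\<bar>h y - h x\<bar> \<le> \<Lambda> * \<sigma> J"
          using h(4)[of y x] h(5) mult_left_mono[of "dist x y" "\<sigma> J" \<Lambda>] by (simp add: dist_commute)
      qed
      also have "\<dots> \<le> \<Lambda> * (\<theta> / 2 ^ J)" by (rule mult_left_mono[OF \<sigma>le h(5)])
      finally show ?thesis by (simp add: abs_minus_commute)
    qed
    from pairing_bound[where R = "r + \<rho>" and g = "\<lambda>x. h x - w J x", OF kl(1,2) this]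
    have "\<bar>pairing k l h - pairing k l (w J)\<bar> \<le> (l - k)\<^sup>2 * (\<Lambda> * (\<theta> / 2 ^ J)) * (M * U)"
      using hz wz unfolding pairing_diff[OF kl(1,2) h(1) bw] U_def by simp
    then show ?thesis by (simp add: power_divide abs_le_iff mult_ac)
  qed
  have lim: "(\<lambda>J. pairing k l (w 0) + ?S * \<theta> powr gain_exp * (1 / (1 - \<gamma>)) + (l - k)\<^sup>2 * (\<Lambda> * \<theta>) * (M * U) * (1/2) ^ J)
     \<longlonglongrightarrow> pairing k l (w 0) + ?S * \<theta> powr gain_exp * (1 / (1 - \<gamma>)) + (l - k)\<^sup>2 * (\<Lambda> * \<theta>) * (M * U) * 0"
    by (intro tendsto_intros LIMSEQ_power_zero) simp
  have bd: "pairing k l h \<le> pairing k l (w 0) + ?S * \<theta> powr gain_exp * (1 / (1 - \<gamma>)) + (l - k)\<^sup>2 * (\<Lambda> * \<theta>) * (M * U) * (1/2) ^ J" for J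
    using near[of J] tel[of J] by linarith
  have "pairing k l h \<le> pairing k l (w 0) + ?S * \<theta> powr gain_exp * (1 / (1 - \<gamma>)) + (l - k)\<^sup>2 * (\<Lambda> * \<theta>) * (M * U) * 0"
    by (rule LIMSEQ_le_const[OF lim]) (use bd in blast)
  then show ?thesis using base unfolding U_def[symmetric] \<gamma>_def by simp
qed

end

subsection \<open>De Giorgi iteration\<close>

text \<open>Induction shows Y n \<le> Y 0 * q^n with q = b powr (-1/e), chosen so that b * q^e = 1:
  the growth \<open>b ^ n\<close> is then exactly compensated by the extra power \<open>e\<close> of
  \<open>Y n\<close>. The condition on \<open>Y 0\<close> says that the remaining factor D * (Y 0)^e
  is at most q.\<close>

lemma De_Giorgi_iteration:
  fixes Y :: "nat \<Rightarrow> real"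
  assumes Y: "\<And>n. 0 \<le> Y n" "\<And>n. Y (Suc n) \<le> D * b ^ n * Y n powr (1 + e)"
    and "0 < D" "1 < b" "0 < e"
    and Y0: "Y 0 \<le> D powr (- (1 / e)) * b powr (- (1 / e\<^sup>2))"
  shows "Y \<longlonglongrightarrow> 0"
proof -
  define q where "q = b powr (- (1 / e))"
  have q: "0 < q" "q < 1"
  proof -
    show "0 < q" using \<open>1 < b\<close> by (simp add: q_def)
    have "b powr (- (1 / e)) < b powr 0" using \<open>1 < b\<close> \<open>0 < e\<close> by (intro powr_less_mono) auto
    then show "q < 1" using \<open>1 < b\<close> by (simp add: q_def)
  qed
  have qe: "q powr e = 1 / b"
  proof -
    have "q powr e = b powr (-1)" unfolding q_def powr_powr using \<open>0 < e\<close> by simp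
    then show ?thesis using \<open>1 < b\<close> by (simp add: powr_minus_divide)
  qed
  have DY: "D * Y 0 powr e \<le> q"
  proof -
    have "Y 0 powr e \<le> (D powr (- (1 / e)) * b powr (- (1 / e\<^sup>2))) powr e"
      using Y0 Y(1) \<open>0 < e\<close> by (intro powr_mono2) auto
    also have "\<dots> = D powr (-1) * q"
      using \<open>0 < D\<close> \<open>1 < b\<close> \<open>0 < e\<close> by (simp add: powr_mult powr_powr q_def power2_eq_square)
    finally have "D * Y 0 powr e \<le> D * (D powr (-1) * q)" using \<open>0 < D\<close> by (intro mult_left_mono) auto
    also have "\<dots> = q" using \<open>0 < D\<close> by (simp add: powr_minus_divide)
    finally show ?thesis .
  qed
  have bound: "Y n \<le> Y 0 * q ^ n" for n
  proof (induction n)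
    case (Suc n)
    have "Y (Suc n) \<le> D * b ^ n * Y n powr (1 + e)" by (rule Y(2))
    also have "\<dots> \<le> D * b ^ n * (Y 0 * q ^ n) powr (1 + e)"
      using Suc Y(1) \<open>0 < D\<close> \<open>1 < b\<close> \<open>0 < e\<close> by (intro mult_left_mono powr_mono2) auto
    also have "\<dots> = (D * Y 0 powr e) * (Y 0 * q ^ n)"
    proof -
      have n0: "0 \<le> Y 0 * q ^ n" using Y(1) q by simp
      have "(Y 0 * q ^ n) powr (1 + e) = (Y 0 * q ^ n) * (Y 0 * q ^ n) powr e"
        using n0 by (cases "Y 0 * q ^ n = 0") (simp_all add: powr_add)
      also have "(Y 0 * q ^ n) powr e = Y 0 powr e * (q ^ n) powr e" using Y(1) q by (simp add: powr_mult)
      also have "(q ^ n) powr e = (1 / b) ^ n"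
      proof -
        have "(q ^ n) powr e = (q powr real n) powr e" using q by (simp add: powr_realpow)
        also have "\<dots> = (q powr e) powr real n" by (simp add: powr_powr mult.commute)
        also have "\<dots> = (1 / b) ^ n" unfolding qe using \<open>1 < b\<close> by (subst powr_realpow) auto
        finally show ?thesis .
      qed
      finally have *: "(Y 0 * q ^ n) powr (1 + e) = (Y 0 * q ^ n) * (Y 0 powr e * (1 / b) ^ n)" .
      have "b ^ n * (1 / b) ^ n = 1" using \<open>1 < b\<close> by (simp add: power_mult_distrib[symmetric])
      then have "D * b ^ n * (Y 0 * q ^ n * (Y 0 powr e * (1 / b) ^ n)) = D * (Y 0 * q ^ n * Y 0 powr e)"
        by (metis (no_types, opaque_lifting) mult.assoc mult.left_commute mult.right_neutral)
      then show ?thesis unfolding * by simp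
    qed
    also have "\<dots> \<le> q * (Y 0 * q ^ n)" using DY Y(1) q by (intro mult_right_mono) auto
    finally show ?case by (simp add: mult_ac)
  qed simp
  have "(\<lambda>n. Y 0 * q ^ n) \<longlonglongrightarrow> Y 0 * 0" using q by (intro tendsto_intros LIMSEQ_power_zero) auto
  then have "(\<lambda>n. Y 0 * q ^ n) \<longlonglongrightarrow> 0" by simp
  then show ?thesis
    by (rule tendsto_sandwich[OF _ _ tendsto_const, rotated 2]) (use Y bound in auto)
qed

section \<open>The superlinear inequality between levels, and its iteration\<close>

context gn_subsolution
begin

lemma level_mono: "k \<le> k' \<Longrightarrow> r' \<le> r \<Longrightarrow> level k' r' \<le> level k r"
  unfolding level_def
proof (rule measure_mono_fmeasurable)
  assume "k \<le> k'" "r' \<le> r"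
  then show "{x \<in> cball 0 r'. k' \<le> u x} \<subseteq> {x \<in> cball 0 r. k \<le> u x}" by auto
  show "{x \<in> cball 0 r'. k' \<le> u x} \<in> sets lborel" by measurable
  have "bounded {x \<in> cball 0 r. k \<le> u x}" by (rule bounded_subset[OF bounded_cball[of 0 r]]) auto
  then show "{x \<in> cball 0 r. k \<le> u x} \<in> fmeasurable lborel"
    using emeasure_bounded_finite by (intro fmeasurableI) auto
qed

lemma scale_const_nonneg: "0 < C \<Longrightarrow> 0 \<le> scale_const C"
  unfolding scale_const_def using K_nonneg M_nonneg decay_const_nonneg by (intro add_nonneg_nonneg mult_nonneg_nonneg) auto

lemma half_powr_less_1: "(1/2::real) powr gain_exp < 1"
  using powr_less_mono2[of gain_exp "1/2" 1] gain_exp_bounds by simp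

text \<open>Lower and upper bound are compared for the pairing with a cutoff of a compact part
  \<open>F\<close> of \<open>{x \<in> cball 0 r. l \<le> u x}\<close>. Halving the measure turns the
  32 of the lower bound into 64. The parameter \<theta> is still free.\<close>

lemma gain_raw:
  assumes grad: "0 < C" "\<And>(h::real^'n \<Rightarrow> real) \<sigma> x D. integrable lborel h \<Longrightarrow> (\<And>y. \<bar>h y\<bar> \<le> 1) \<Longrightarrow> 0 < \<sigma> \<Longrightarrow>
      GDERIV (mollify h \<sigma>) x :> D \<Longrightarrow> norm D \<le> C / \<sigma>"
    and sup: "0 < C'" "\<And>(h::real^'n \<Rightarrow> real) \<sigma> x. integrable lborel h \<Longrightarrow> 0 < \<sigma> \<Longrightarrow>
      \<bar>mollify h \<sigma> x\<bar> \<le> C' / \<sigma> ^ CARD('n) * (LINT y|lborel. \<bar>h y\<bar>)"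
    and kl: "lo \<le> k" "k < l" "l \<in> I" "l - k \<le> M"
    and r: "0 \<le> r" "0 < \<rho>" "\<rho> \<le> 1" "r + \<rho> < 2"
    and \<theta>: "0 < \<theta>" "\<theta> \<le> \<rho> / (8 * (K + 1))"
  shows "level l r * ((l - k) ^ 3 / 64) \<le> (l - k)\<^sup>2 * (C' / \<theta> ^ (scale_exp * CARD('n)) * (2 * level k (r + \<rho>))) * (M * level k (r + \<rho>))
    + scale_const C * level k (r + \<rho>) * \<theta> powr gain_exp / \<rho> * (1 / (1 - (1/2) powr gain_exp))" (is "_ \<le> ?R")
proof (cases "level l r = 0")
  case True
  have "0 \<le> ?R"
    using scale_const_nonneg[OF grad(1)] level_nonneg[of k "r + \<rho>"] sup(1) M_nonneg \<theta>(1) r(2) half_powr_less_1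
    by (intro add_nonneg_nonneg mult_nonneg_nonneg divide_nonneg_nonneg) auto
  with True show ?thesis by simp
next
  case False
  define E where "E = {x \<in> cball 0 r. l \<le> u x}"
  have E: "E \<in> sets borel" "bounded E" unfolding E_def
    by (auto intro: bounded_subset[OF bounded_cball[of 0 r]])
  have lE: "level l r = measure lborel E" by (simp add: level_def E_def)
  then have pos: "0 < measure lborel E" using False by (simp add: zero_less_measure_iff)
  obtain F where F: "compact F" "F \<subseteq> E" "measure lborel E / 2 \<le> measure lborel F"
    using compact_half_measure[OF E pos] by blast
  have Fne: "F \<noteq> {}" using F(3) pos by auto
  have Fr: "F \<subseteq> cball 0 r" using F(2) by (auto simp: E_def)
  have UE: "level l r \<le> level k (r + \<rho>)" using kl r by (intro level_mono) auto
  have FE: "measure lborel F \<le> measure lborel E"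
    using F E emeasure_bounded_finite[OF E(2)] by (intro measure_mono_fmeasurable fmeasurableI) (auto simp: borel_compact)
  have "0 < level k (r + \<rho>)" using UE lE pos by simp
  \<comment> \<open>The permitted excess of the L^1 norm is \<open>level k (r + \<rho>)\<close>
    itself, which is positive in this case; since \<open>F\<close> has at most that measure too, the
    total is at most twice it.\<close>
  obtain h \<Lambda> where h: "bsfun h" "\<And>x. 0 \<le> h x" "\<And>x. h x \<le> 1" "\<And>x. x \<in> F \<Longrightarrow> h x = 1" "\<And>x. r + \<rho> / 8 < norm x \<Longrightarrow> h x = 0"
    "\<And>x y. \<bar>h x - h y\<bar> \<le> \<Lambda> * dist x y" "0 \<le> \<Lambda>" "(LINT x|lborel. \<bar>h x\<bar>) \<le> measure lborel F + level k (r + \<rho>)"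
    using Lipschitz_cutoff[OF F(1) Fne Fr _ \<open>0 < level k (r + \<rho>)\<close>, of "\<rho> / 8"] r(2) by (metis divide_pos_pos zero_less_numeral)
  have "measure lborel F * ((l - k) ^ 3 / 32) \<le> pairing k l h"
    by (rule pairing_lower_bound[OF kl(1,2) h(1,2)]) (use F h E in \<open>auto simp: borel_compact compact_imp_bounded E_def\<close>)
  moreover have "pairing k l h \<le> ?R"
  proof -
    have h1: "\<bar>h x\<bar> \<le> 1" for x using h(2,3)[of x] by simp
    have h2: "(LINT x|lborel. \<bar>h x\<bar>) \<le> 2 * level k (r + \<rho>)" using h(8) FE UE lE by linarith
    show ?thesis by (rule pairing_upper_bound[OF grad sup kl r h(1) h1 h(5,6,7) h2 \<theta>])
  qed
  moreover have "level l r * ((l - k) ^ 3 / 64) \<le> measure lborel F * ((l - k) ^ 3 / 32)"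
  proof -
    have "(level l r / 2) * ((l - k) ^ 3 / 32) \<le> measure lborel F * ((l - k) ^ 3 / 32)"
      using F(3) lE kl(2) by (intro mult_right_mono) auto
    then show ?thesis by simp
  qed
  ultimately show ?thesis by linarith
qed

text \<open>Normalises the measures of superlevel sets to at most 1, so that their powers compare by
  exponents.\<close>

definition ballvol :: real where "ballvol = measure lborel (cball (0::real^'n) 2)"

lemma ballvol_pos: "0 < ballvol"
  unfolding ballvol_def by (rule content_cball_pos) simp

definition step_exp :: nat where "step_exp = scale_exp * CARD('n)"

text \<open>With \<theta> proportional to y^(1 / (2 \<open>step_exp\<close>)), where y is the
  normalised measure, the quadratic term of \<open>gain_raw\<close> becomes y^(3/2) and the dyadic
  sum becomes y^(1 + \<open>iter_exp\<close>); the latter is the smaller exponent.\<close>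

definition iter_exp :: real where "iter_exp = gain_exp / (2 * real step_exp)"

definition step_const :: "real \<Rightarrow> real \<Rightarrow> real" where
  "step_const C C' = 64 * (M\<^sup>2 * (C' * (8 * (K + 1)) ^ step_exp * (2 * ballvol)) * (M * ballvol)
    + scale_const C * ballvol * (1 / (1 - (1/2) powr gain_exp)))"

lemma step_exp_ge_1: "1 \<le> step_exp"
  by (simp add: step_exp_def scale_exp_def Suc_le_eq)

lemma iter_exp_bounds: "0 < iter_exp" "iter_exp \<le> 1 / 2"
proof -
  have "1 \<le> real step_exp" using step_exp_ge_1 by simp
  then show "0 < iter_exp" using gain_exp_bounds by (auto simp: iter_exp_def intro!: divide_pos_pos)
  have "gain_exp / (2 * real step_exp) \<le> 1 / (2 * 1)"
    using \<open>1 \<le> real step_exp\<close> gain_exp_bounds by (intro frac_le) auto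
  then show "iter_exp \<le> 1 / 2" by (simp add: iter_exp_def)
qed

lemma step_const_nonneg: "0 < C \<Longrightarrow> 0 < C' \<Longrightarrow> 0 \<le> step_const C C'"
  unfolding step_const_def using scale_const_nonneg[of C] K_nonneg M_nonneg less_imp_le[OF ballvol_pos] half_powr_less_1
  by (intro mult_nonneg_nonneg add_nonneg_nonneg divide_nonneg_nonneg) auto

lemma gain:
  assumes grad: "0 < C" "\<And>(h::real^'n \<Rightarrow> real) \<sigma> x D. integrable lborel h \<Longrightarrow> (\<And>y. \<bar>h y\<bar> \<le> 1) \<Longrightarrow> 0 < \<sigma> \<Longrightarrow>
      GDERIV (mollify h \<sigma>) x :> D \<Longrightarrow> norm D \<le> C / \<sigma>"
    and sup: "0 < C'" "\<And>(h::real^'n \<Rightarrow> real) \<sigma> x. integrable lborel h \<Longrightarrow> 0 < \<sigma> \<Longrightarrow>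
      \<bar>mollify h \<sigma> x\<bar> \<le> C' / \<sigma> ^ CARD('n) * (LINT y|lborel. \<bar>h y\<bar>)"
    and kl: "lo \<le> k" "k < l" "l \<in> I" "l - k \<le> M"
    and r: "0 \<le> r" "0 < \<rho>" "\<rho> \<le> 1" "r + \<rho> < 2"
  shows "level l r \<le> step_const C C' / ((l - k) ^ 3 * \<rho> ^ step_exp) * (level k (r + \<rho>) / ballvol) powr (1 + iter_exp)"
proof (cases "level k (r + \<rho>) = 0")
  case True
  then have "level l r \<le> 0" using level_mono[of k l r "r + \<rho>"] kl r by simp
  with True show ?thesis by simp
next
  case False
  define y where "y = level k (r + \<rho>) / ballvol"
  define s where "s = step_exp"
  define \<beta> where "\<beta> = gain_exp"
  define \<epsilon> where "\<epsilon> = iter_exp"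
  have V: "0 < ballvol" by (rule ballvol_pos)
  have U: "level k (r + \<rho>) = ballvol * y" using V by (simp add: y_def)
  have "level k (r + \<rho>) \<le> ballvol"
    unfolding level_def ballvol_def using r(4)
    by (intro measure_mono_fmeasurable fmeasurableI emeasure_bounded_finite) auto
  then have y: "0 < y" "y \<le> 1" using False level_nonneg[of k "r + \<rho>"] V by (auto simp: y_def)
  define \<tau> where "\<tau> = y powr (1 / (2 * real s))"
  have s: "1 \<le> s" "0 < real s" using step_exp_ge_1 by (auto simp: s_def)
  have \<tau>: "0 < \<tau>" "\<tau> \<le> 1" unfolding \<tau>_def using y s by (auto intro!: powr_le1)
  have \<tau>s: "\<tau> ^ s = y powr (1 / 2)" unfolding \<tau>_def using y s by (simp add: powr_power)
  have \<tau>\<beta>: "\<tau> powr \<beta> = y powr \<epsilon>" unfolding \<tau>_def \<epsilon>_def iter_exp_def \<beta>_def s_def by (simp add: powr_powr)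
  define \<theta>0 where "\<theta>0 = \<rho> / (8 * (K + 1))"
  have K8: "1 \<le> 8 * (K + 1)" using K_nonneg by simp
  have \<theta>0: "0 < \<theta>0" "\<theta>0 \<le> 1" unfolding \<theta>0_def using r K8 by (auto simp: divide_le_eq_1)
  define \<theta> where "\<theta> = \<tau> * \<theta>0"
  have \<theta>: "0 < \<theta>" "\<theta> \<le> \<theta>0" unfolding \<theta>_def using \<tau> \<theta>0 by (auto intro: mult_left_le_one_le)
  define \<delta> where "\<delta> = l - k"
  have \<delta>: "0 < \<delta>" "\<delta> \<le> M" using kl by (auto simp: \<delta>_def)
  have raw: "level l r * (\<delta> ^ 3 / 64) \<le> \<delta>\<^sup>2 * (C' / \<theta> ^ s * (2 * (ballvol * y))) * (M * (ballvol * y))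
    + scale_const C * (ballvol * y) * \<theta> powr \<beta> / \<rho> * (1 / (1 - (1/2) powr \<beta>))"
    using gain_raw[OF grad sup kl r \<theta>(1) \<theta>(2)[unfolded \<theta>0_def]]
    unfolding U \<delta>_def s_def step_exp_def \<beta>_def .
  have y1: "y powr (1 + \<epsilon>) = y * y powr \<epsilon>" using y by (simp add: powr_add)
  have t1: "\<delta>\<^sup>2 * (C' / \<theta> ^ s * (2 * (ballvol * y))) * (M * (ballvol * y)) \<le>
      M\<^sup>2 * (C' * (8 * (K + 1)) ^ s * (2 * ballvol)) * (M * ballvol) / \<rho> ^ s * y powr (1 + \<epsilon>)"
  proof -
    have "\<theta> ^ s = y powr (1/2) * (\<rho> ^ s / (8 * (K + 1)) ^ s)"
      unfolding \<theta>_def power_mult_distrib \<tau>s \<theta>0_def power_divide ..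
    then have th: "C' / \<theta> ^ s = C' * (8 * (K + 1)) ^ s / (y powr (1/2) * \<rho> ^ s)"
      by simp
    have yy: "y * y / y powr (1/2) \<le> y powr (1 + \<epsilon>)"
    proof -
      have "y powr (3/2) * y powr (1/2) = y * y"
        using y by (simp add: powr_add[symmetric] powr_numeral power2_eq_square)
      then have "y * y / y powr (1/2) = y powr (3/2)" using y by (simp add: field_simps)
      also have "\<dots> \<le> y powr (1 + \<epsilon>)" using y iter_exp_bounds by (intro powr_mono') (auto simp: \<epsilon>_def)
      finally show ?thesis .
    qed
    have "\<delta>\<^sup>2 * (C' / \<theta> ^ s * (2 * (ballvol * y))) * (M * (ballvol * y)) =
        \<delta>\<^sup>2 * ((C' * (8 * (K + 1)) ^ s * (2 * ballvol)) * (M * ballvol) / \<rho> ^ s * (y * y / y powr (1/2)))"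
    proof -
      have "D2 * (c8 / (p * q) * (2 * (V * y))) * (N * (V * y)) = D2 * (c8 * (2 * V) * (N * V) / q * (y * y / p))"
        for D2 c8 p q V N :: real by (simp add: mult_ac)
      then show ?thesis unfolding th by blast
    qed
    also have "\<dots> \<le> M\<^sup>2 * ((C' * (8 * (K + 1)) ^ s * (2 * ballvol)) * (M * ballvol) / \<rho> ^ s * y powr (1 + \<epsilon>))"
      using \<delta> yy sup(1) K8 V r y by (intro mult_mono power_mono) auto
    finally show ?thesis by (simp add: mult_ac)
  qed
  have t2: "scale_const C * (ballvol * y) * \<theta> powr \<beta> / \<rho> * (1 / (1 - (1/2) powr \<beta>)) \<le>
      scale_const C * ballvol * (1 / (1 - (1/2) powr \<beta>)) / \<rho> ^ s * y powr (1 + \<epsilon>)"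
  proof -
    have "\<theta> powr \<beta> \<le> y powr \<epsilon>"
    proof -
      have "\<theta> \<le> \<tau>" unfolding \<theta>_def using \<tau> \<theta>0 by (auto intro: mult_left_le)
      then have "\<theta> powr \<beta> \<le> \<tau> powr \<beta>" using \<theta> gain_exp_bounds by (intro powr_mono2) (auto simp: \<beta>_def)
      then show ?thesis using \<tau>\<beta> by simp
    qed
    \<comment> \<open>The loss 1/\<rho> of the dyadic sum is absorbed into the larger loss
      \<rho>^(-s) that the choice of \<theta> causes in the quadratic term.\<close>
    moreover have "1 / \<rho> \<le> 1 / \<rho> ^ s"
    proof -
      have "\<rho> ^ s \<le> \<rho> ^ 1" using r s by (intro power_decreasing) auto
      then show ?thesis using r by (intro divide_left_mono) auto
    qed
    ultimately have "\<theta> powr \<beta> * (1 / \<rho>) \<le> y powr \<epsilon> * (1 / \<rho> ^ s)" using r by (intro mult_mono) auto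
    then have "(scale_const C * ballvol * (1 / (1 - (1/2) powr \<beta>)) * y) * (\<theta> powr \<beta> * (1 / \<rho>)) \<le>
       (scale_const C * ballvol * (1 / (1 - (1/2) powr \<beta>)) * y) * (y powr \<epsilon> * (1 / \<rho> ^ s))"
      using scale_const_nonneg[OF grad(1)] V y half_powr_less_1
      by (intro mult_left_mono mult_nonneg_nonneg) (auto simp: \<beta>_def)
    then show ?thesis unfolding y1 by (simp add: mult_ac)
  qed
  have "level l r * (\<delta> ^ 3 / 64) \<le> step_const C C' / 64 / \<rho> ^ s * y powr (1 + \<epsilon>)"
  proof -
    have "A / q * Z + B / q * Z = 64 * (A + B) / 64 / q * Z" for A B q Z :: real
      by (simp add: add_divide_distrib distrib_right)
    with order_trans[OF raw add_mono[OF t1 t2]] show ?thesis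
      unfolding step_const_def s_def[symmetric] \<beta>_def[symmetric] by metis
  qed
  then have "level l r \<le> step_const C C' / (\<delta> ^ 3 * \<rho> ^ s) * y powr (1 + \<epsilon>)"
    using \<delta> r by (simp add: field_simps)
  then show ?thesis by (simp add: y_def s_def \<epsilon>_def \<delta>_def)
qed

text \<open>The smallness threshold of \<open>De_Giorgi_iteration\<close> with its power of \<kappa>
  removed. The powers of 4 and 2 come from \<rho> n = 2^(-(n + 2)), \<open>ballvol / 2\<close> from
  normalisation and Chebyshev's inequality at level \<kappa>/2; the \<open>+ 1\<close> guarantees a
  positive base.\<close>

definition vanish_const :: "real \<Rightarrow> real \<Rightarrow> real" where
  "vanish_const C C' = ballvol / 2 * (((step_const C C' / ballvol + 1) * 4 ^ (3 + step_exp)) powr (- (1 / iter_exp))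
    * (2 ^ (3 + step_exp)) powr (- (1 / iter_exp\<^sup>2)))"

lemma vanish_const_pos: "0 < C \<Longrightarrow> 0 < C' \<Longrightarrow> 0 < vanish_const C C'"
proof -
  assume "0 < C" "0 < C'"
  then have "0 < step_const C C' / ballvol + 1"
    using step_const_nonneg ballvol_pos by (intro add_nonneg_pos divide_nonneg_pos) auto
  then show ?thesis unfolding vanish_const_def using ballvol_pos by simp
qed

text \<open>Levels rise from \<kappa>/2 to \<kappa> while radii shrink from 3/2 to 1. The level gaps
  are proportional to \<kappa>, so their cubes in \<open>gain\<close> give D proportional to
  \<kappa>^(-3) and a threshold proportional to \<kappa>^(3 / \<open>iter_exp\<close>); Chebyshev's
  inequality for the first level adds one more power of \<kappa>.\<close>

lemma level_vanishes:
  assumes grad: "0 < C" "\<And>(h::real^'n \<Rightarrow> real) \<sigma> x D. integrable lborel h \<Longrightarrow> (\<And>y. \<bar>h y\<bar> \<le> 1) \<Longrightarrow> 0 < \<sigma> \<Longrightarrow>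
      GDERIV (mollify h \<sigma>) x :> D \<Longrightarrow> norm D \<le> C / \<sigma>"
    and sup: "0 < C'" "\<And>(h::real^'n \<Rightarrow> real) \<sigma> x. integrable lborel h \<Longrightarrow> 0 < \<sigma> \<Longrightarrow>
      \<bar>mollify h \<sigma> x\<bar> \<le> C' / \<sigma> ^ CARD('n) * (LINT y|lborel. \<bar>h y\<bar>)"
    and kk: "0 < \<kappa>" "lo \<le> \<kappa> / 2" "\<kappa> \<in> I" "\<kappa> \<le> M"
    and small: "(LINT x|lborel. u x) \<le> vanish_const C C' * \<kappa> powr (1 + 3 / iter_exp)"
  shows "level \<kappa> 1 = 0"
proof -
  define s where "s = 3 + step_exp"
  define e where "e = iter_exp"
  have e: "0 < e" using iter_exp_bounds by (simp add: e_def)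
  define B where "B = (step_const C C' / ballvol + 1) * 4 ^ s"
  define b where "b = (2::real) ^ s"
  have V: "0 < ballvol" by (rule ballvol_pos)
  have st: "0 \<le> step_const C C'" by (rule step_const_nonneg[OF grad(1) sup(1)])
  have B: "0 < B" unfolding B_def using st V by (intro mult_pos_pos add_nonneg_pos divide_nonneg_pos) auto
  have b: "1 < b" unfolding b_def s_def by (intro one_less_power) auto
  define k where "k n = \<kappa> * (1 - (1/2) ^ Suc n)" for n
  define \<rho> where "\<rho> n = (1/2::real) ^ Suc (Suc n)" for n
  define r where "r n = 1 + (1/2::real) ^ Suc n" for n
  define Y where "Y n = level (k n) (r n) / ballvol" for n
  have \<rho>: "0 < \<rho> n" "\<rho> n \<le> 1" for n
  proof -
    show "0 < \<rho> n" by (simp add: \<rho>_def)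
    show "\<rho> n \<le> 1" unfolding \<rho>_def by (rule power_le_one) auto
  qed
  have r: "0 \<le> r n" "r (Suc n) + \<rho> n = r n" "r n < 2" for n
  proof -
    show "0 \<le> r n" by (simp add: r_def)
    show "r (Suc n) + \<rho> n = r n" by (simp add: r_def \<rho>_def)
    have "(1/2::real) ^ Suc n \<le> 1/2" using power_decreasing[of 1 "Suc n" "1/2::real"] by simp
    then show "r n < 2" by (simp add: r_def)
  qed
  have dk: "k (Suc n) - k n = \<kappa> * \<rho> n" for n by (simp add: k_def \<rho>_def algebra_simps)
  have klo: "\<kappa> / 2 \<le> k n" "k n \<le> \<kappa>" for n
  proof -
    have "(1/2::real) ^ Suc n \<le> 1/2" using power_decreasing[of 1 "Suc n" "1/2::real"] by simp
    then have "\<kappa> * (1/2) \<le> k n" unfolding k_def using kk(1) by (intro mult_left_mono) auto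
    then show "\<kappa> / 2 \<le> k n" by simp
    have "k n \<le> \<kappa> * 1" unfolding k_def using kk(1) by (intro mult_left_mono) auto
    then show "k n \<le> \<kappa>" by simp
  qed
  have kI: "k n \<in> I" for n
    using mem_is_interval_1_I[OF I(1) I(2) kk(3)] klo[of n] kk(2) by (meson order_trans)
  have "Y \<longlonglongrightarrow> 0"
  proof (rule De_Giorgi_iteration[where D = "B / \<kappa> ^ 3" and b = b and e = e])
    show "0 \<le> Y n" for n unfolding Y_def using level_nonneg V by (intro divide_nonneg_pos) auto
    show "Y (Suc n) \<le> B / \<kappa> ^ 3 * b ^ n * Y n powr (1 + e)" for n
    proof -
      have pos: "0 < \<kappa> * \<rho> n" using kk \<rho> by simp
      have "\<kappa> * \<rho> n \<le> \<kappa> * 1" using kk(1) \<rho>[of n] by (intro mult_left_mono) auto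
      then have leM: "\<kappa> * \<rho> n \<le> M" using kk(4) by linarith
      have "level (k (Suc n)) (r (Suc n)) \<le> step_const C C' / ((k (Suc n) - k n) ^ 3 * \<rho> n ^ step_exp) * (level (k n) (r (Suc n) + \<rho> n) / ballvol) powr (1 + iter_exp)"
      proof (rule gain[OF grad sup])
        show "lo \<le> k n" using klo[of n] kk(2) by linarith
        show "k n < k (Suc n)" "k (Suc n) - k n \<le> M" using dk[of n] pos leM by auto
        show "r (Suc n) + \<rho> n < 2" using r by simp
      qed (use kI r \<rho> in auto)
      then have "level (k (Suc n)) (r (Suc n)) \<le> step_const C C' / ((\<kappa> * \<rho> n) ^ 3 * \<rho> n ^ step_exp) * Y n powr (1 + e)"
        unfolding dk r(2) Y_def e_def .
      also have "(\<kappa> * \<rho> n) ^ 3 * \<rho> n ^ step_exp = \<kappa> ^ 3 * \<rho> n ^ s"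
        by (simp add: power_mult_distrib s_def power_add)
      finally have lev: "level (k (Suc n)) (r (Suc n)) \<le> step_const C C' / (\<kappa> ^ 3 * \<rho> n ^ s) * Y n powr (1 + e)" .
      have \<rho>s: "1 / \<rho> n ^ s = 4 ^ s * b ^ n"
      proof -
        have "\<rho> n = (1/4) * (1/2) ^ n" by (simp add: \<rho>_def)
        then have "\<rho> n ^ s = (1/4) ^ s * (1/2) ^ (n * s)" by (simp only: power_mult_distrib power_mult)
        also have "(1/2::real) ^ (n * s) = (1 / b) ^ n" unfolding b_def by (simp add: power_mult[symmetric] power_divide mult.commute)
        finally show ?thesis by (simp add: power_divide)
      qed
      have "Y (Suc n) \<le> (step_const C C' / (\<kappa> ^ 3 * \<rho> n ^ s) * Y n powr (1 + e)) / ballvol"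
        unfolding Y_def[of "Suc n"] using lev V by (intro divide_right_mono) auto
      also have "\<dots> = step_const C C' / ballvol * (1 / \<kappa> ^ 3 * (1 / \<rho> n ^ s) * Y n powr (1 + e))" by simp
      also have "\<dots> \<le> (step_const C C' / ballvol + 1) * (1 / \<kappa> ^ 3 * (1 / \<rho> n ^ s) * Y n powr (1 + e))"
        using kk(1) \<rho>[of n] by (intro mult_right_mono) auto
      also have "\<dots> = B / \<kappa> ^ 3 * b ^ n * Y n powr (1 + e)" unfolding \<rho>s B_def by simp
      finally show ?thesis .
    qed
    show "0 < B / \<kappa> ^ 3" using B kk by simp
    show "Y 0 \<le> (B / \<kappa> ^ 3) powr (- (1 / e)) * b powr (- (1 / e\<^sup>2))"
    proof -
      have iu: "integrable lborel u"
      proof (rule integrable_bounded_support[where C = M and R = 2])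
        show "norm (u x) \<le> M" for x using u_nonneg[of x] u_le[of x] by simp
        show "u x = 0" if "2 < norm x" for x using u_outside that by simp
      qed simp
      define E where "E = {x \<in> cball 0 (r 0). k 0 \<le> u x}"
      have "\<kappa> / 2 * measure lborel E \<le> (LINT x|lborel. u x)"
      proof -
        have "E \<in> sets borel" "bounded E" unfolding E_def by (auto intro: bounded_subset[OF bounded_cball[of 0 "r 0"]])
        then have E: "E \<in> sets lborel" "emeasure lborel E < \<infinity>" using emeasure_bounded_finite by auto
        have "\<kappa> / 2 * measure lborel E = (LINT x|lborel. \<kappa> / 2 * indicator E x)" using E by simp
        also have "\<dots> \<le> (LINT x|lborel. u x)"
        proof (rule integral_mono'[OF iu])
          show "\<kappa> / 2 * indicator E x \<le> u x" for x
            using klo(1)[of 0] u_nonneg[of x] by (auto simp: E_def indicator_def)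
        qed (rule u_nonneg)
        finally show ?thesis .
      qed
      also have "\<dots> \<le> ballvol / 2 * (B powr (- (1 / e)) * b powr (- (1 / e\<^sup>2))) * (\<kappa> * \<kappa> powr (3 / e))"
      proof -
        have "\<kappa> powr (1 + 3 / e) = \<kappa> * \<kappa> powr (3 / e)" using kk(1) by (simp add: powr_add)
        then show ?thesis using small unfolding vanish_const_def B_def b_def s_def e_def by simp
      qed
      finally have "\<kappa> / 2 * measure lborel E \<le> \<kappa> / 2 * (ballvol * (B powr (- (1 / e)) * b powr (- (1 / e\<^sup>2)) * \<kappa> powr (3 / e)))"
        by (simp add: mult_ac)
      then have mE: "measure lborel E \<le> ballvol * (B powr (- (1 / e)) * b powr (- (1 / e\<^sup>2)) * \<kappa> powr (3 / e))"
        using kk(1) by (simp only: mult_le_cancel_left_pos half_gt_zero)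
      have "(B / \<kappa> ^ 3) powr (- (1 / e)) = B powr (- (1 / e)) * \<kappa> powr (3 / e)"
      proof -
        have "(B / \<kappa> ^ 3) powr (- (1 / e)) = B powr (- (1 / e)) / (\<kappa> powr 3) powr (- (1 / e))"
          using B kk(1) by (simp add: powr_divide powr_numeral)
        also have "(\<kappa> powr 3) powr (- (1 / e)) = \<kappa> powr (- (3 / e))" by (simp add: powr_powr)
        finally show ?thesis by (simp add: powr_minus_divide)
      qed
      then show ?thesis using mE V unfolding Y_def level_def E_def[symmetric]
        by (simp add: pos_divide_le_eq mult_ac)
    qed
  qed (use b e in auto)
  moreover have "level \<kappa> 1 \<le> ballvol * Y n" for n
  proof -
    have "level \<kappa> 1 \<le> level (k n) (r n)" using klo(2)[of n] by (intro level_mono) (auto simp: r_def)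
    then show ?thesis using V by (simp add: Y_def)
  qed
  ultimately have "level \<kappa> 1 \<le> ballvol * 0"
    by (intro LIMSEQ_le_const[OF tendsto_mult_left]) auto
  then show ?thesis using level_nonneg[of \<kappa> 1] by simp
qed

end

subsection \<open>Reduction to Borel representatives\<close>

lemma convex_on_pos_part: "convex_on UNIV (\<lambda>v::real. max 0 (v - \<kappa>))"
proof (rule convex_onI)
  fix t x y :: real assume "0 < t" "t < 1"
  then have "(1 - t) * (x - \<kappa>) \<le> (1 - t) * max 0 (x - \<kappa>)" "t * (y - \<kappa>) \<le> t * max 0 (y - \<kappa>)"
    "0 \<le> (1 - t) * max 0 (x - \<kappa>)" "0 \<le> t * max 0 (y - \<kappa>)"
    by (auto intro!: mult_left_mono)
  moreover have "(1 - t) *\<^sub>R x + t *\<^sub>R y - \<kappa> = (1 - t) * (x - \<kappa>) + t * (y - \<kappa>)"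
    by (simp add: algebra_simps)
  ultimately show "max 0 ((1 - t) *\<^sub>R x + t *\<^sub>R y - \<kappa>) \<le> (1 - t) * max 0 (x - \<kappa>) + t * max 0 (y - \<kappa>)"
    by (intro max.boundedI) linarith+
qed simp

text \<open>\<open>entropy_flux\<close> prescribes a derivative of the flux only where the entropy
  has one; the third claim disposes of the kink.\<close>

lemma pos_part_derivatives:
  fixes \<kappa> :: real
  shows "\<kappa> < v \<Longrightarrow> ((\<lambda>v. max 0 (v - \<kappa>)) has_real_derivative 1) (at v)"
    and "v < \<kappa> \<Longrightarrow> ((\<lambda>v. max 0 (v - \<kappa>)) has_real_derivative 0) (at v)"
    and "\<not> (\<lambda>v. max 0 (v - \<kappa>)) differentiable (at \<kappa>)"
proof -
  show "((\<lambda>v. max 0 (v - \<kappa>)) has_real_derivative 1) (at v)" if "\<kappa> < v"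
  proof (rule has_field_derivative_transform_within[where f = "\<lambda>v. v - \<kappa>" and d = "v - \<kappa>"])
    show "((\<lambda>v. v - \<kappa>) has_real_derivative 1) (at v)" by (auto intro!: derivative_eq_intros)
  qed (use that in \<open>auto simp: dist_real_def\<close>)
  show "((\<lambda>v. max 0 (v - \<kappa>)) has_real_derivative 0) (at v)" if "v < \<kappa>"
    by (rule has_field_derivative_transform_within[where f = "\<lambda>v. 0" and d = "\<kappa> - v"])
      (use that in \<open>auto simp: dist_real_def\<close>)
  show "\<not> (\<lambda>v. max 0 (v - \<kappa>)) differentiable (at \<kappa>)"
  proof
    assume "(\<lambda>v. max 0 (v - \<kappa>)) differentiable (at \<kappa>)"
    then obtain D where D: "((\<lambda>v. max 0 (v - \<kappa>)) has_real_derivative D) (at \<kappa>)"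
      using real_differentiable_def by blast
    have "((\<lambda>v. v - \<kappa>) has_real_derivative D) (at \<kappa> within {\<kappa>..})"
      by (rule has_field_derivative_transform_within[OF has_field_derivative_at_within[OF D], of 1]) auto
    moreover have "((\<lambda>v. v - \<kappa>) has_real_derivative 1) (at \<kappa> within {\<kappa>..})" by (auto intro!: derivative_eq_intros)
    moreover have "at \<kappa> within {\<kappa>..} \<noteq> bot" by (simp add: at_within_Ici_at_right)
    ultimately have "D = 1" using has_field_derivative_unique by blast
    have "((\<lambda>v. 0) has_real_derivative D) (at \<kappa> within {..\<kappa>})"
      by (rule has_field_derivative_transform_within[OF has_field_derivative_at_within[OF D], of 1]) auto
    moreover have "((\<lambda>v. 0) has_real_derivative 0) (at \<kappa> within {..\<kappa>})" by simp
    moreover have "at \<kappa> within {..\<kappa>} \<noteq> bot" by (simp add: at_within_Iic_at_left)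
    ultimately have "D = 0" using has_field_derivative_unique by blast
    with \<open>D = 1\<close> show False by simp
  qed
qed

lemma entropy_flux_pos_part:
  fixes a :: "real \<Rightarrow> real^'n"
  assumes a: "continuous_on UNIV a"
  shows "entropy_flux a (\<lambda>v. max 0 (v - \<kappa>)) (\<lambda>v. LINT t|lborel. indicator {\<kappa>..v} t *\<^sub>R a t)"
proof -
  let ?\<eta> = "\<lambda>v. max 0 (v - \<kappa>)" and ?q = "\<lambda>v. LINT t|lborel. indicator {\<kappa>..v} t *\<^sub>R a t"
  have ca: "continuous_on S a" for S by (rule continuous_on_subset[OF a]) simp
  have q: "?q v = integral {\<kappa>..v} a" for v
    using set_borel_integral_eq_integral(2)[OF borel_integrable_atLeastAtMost'[OF ca, of \<kappa> v]]
    by (simp add: set_lebesgue_integral_def)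
  \<comment> \<open>With \<open>max \<kappa> v\<close> one formula covers both sides of the kink,
    and continuity follows from that of the indefinite integral.\<close>
  have qmax: "?q v = integral {\<kappa>..max \<kappa> v} a" for v
    unfolding q by (cases "\<kappa> \<le> v") (auto simp: max_def)
  have "isCont ?q v" for v
  proof -
    have "continuous_on {..max \<kappa> v + 1} (\<lambda>v. integral {\<kappa>..max \<kappa> v} a)"
      by (rule continuous_on_compose2[OF indefinite_integral_continuous_1[of a \<kappa> "max \<kappa> v + 1"]])
        (auto intro!: continuous_intros integrable_continuous_interval ca)
    then have "continuous_on {..max \<kappa> v + 1} ?q" unfolding qmax .
    then show ?thesis by (rule continuous_on_interior) auto
  qed
  then have "continuous_on UNIV ?q" by (simp add: continuous_at_imp_continuous_on)
  moreover have "((\<lambda>w. ?q w $ i) has_real_derivative deriv ?\<eta> v * a v $ i) (at v)"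
    if diff: "?\<eta> differentiable (at v)" for v i
  proof (cases v \<kappa> rule: linorder_cases)
    case less
    have "((\<lambda>w. 0) has_real_derivative 0) (at v)" by simp
    then have "((\<lambda>w. ?q w $ i) has_real_derivative 0) (at v)"
    proof (rule has_field_derivative_transform_within[where d = "\<kappa> - v"])
      fix w assume "dist w v < \<kappa> - v"
      then have "w < \<kappa>" by (auto simp: dist_real_def)
      then show "0 = ?q w $ i" by simp
    qed (use less in auto)
    then show ?thesis using DERIV_imp_deriv[OF pos_part_derivatives(2)[OF less]] by simp
  next
    case equal
    with diff pos_part_derivatives(3) show ?thesis by blast
  next
    case greater
    have "((\<lambda>w. integral {\<kappa>..w} a) has_vector_derivative a v) (at v within {\<kappa>..v + 1})"
      by (rule integral_has_vector_derivative[OF ca]) (use greater in auto)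
    then have "(?q has_vector_derivative a v) (at v within {\<kappa>..v + 1})" unfolding q .
    then have "(?q has_vector_derivative a v) (at v)"
      using at_within_Icc_at[of \<kappa> v "v + 1"] greater by simp
    then have "((\<lambda>w. ?q w $ i) has_vector_derivative a v $ i) (at v)"
      by (rule bounded_linear.has_vector_derivative[OF bounded_linear_vec_nth])
    then show ?thesis
      using DERIV_imp_deriv[OF pos_part_derivatives(1)[OF greater]]
      by (simp add: has_real_derivative_iff_has_vector_derivative)
  qed
  ultimately show ?thesis unfolding entropy_flux_def by blast
qed

lemma C1_norm_bounds:
  assumes "C1_norm a I = ereal K" "v \<in> I"
  shows "norm (a v) \<le> K" "norm (vector_derivative a (at v)) \<le> K"
proof -
  let ?A = "SUP v\<in>I. ereal (norm (a v))" and ?B = "SUP v\<in>I. ereal (norm (vector_derivative a (at v)))"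
  have A: "ereal (norm (a v)) \<le> ?A" and B: "ereal (norm (vector_derivative a (at v))) \<le> ?B"
    using assms(2) by (auto intro: SUP_upper)
  have "0 \<le> ?A" "0 \<le> ?B" using order_trans[OF _ A, of 0] order_trans[OF _ B, of 0] by auto
  then have "?A \<le> ereal K" "?B \<le> ereal K"
    using assms(1) add_increasing2[of ?B ?A ?A] add_increasing[of ?A ?B ?B] unfolding C1_norm_def by auto
  from order_trans[OF A this(1)] order_trans[OF B this(2)]
  show "norm (a v) \<le> K" "norm (vector_derivative a (at v)) \<le> K" by auto
qed

lemma C1_Lipschitz:
  fixes a :: "real \<Rightarrow> 'a::real_normed_vector"
  assumes a: "a C1_differentiable_on UNIV" and I: "is_interval I"
    and K: "\<And>v. v \<in> I \<Longrightarrow> norm (vector_derivative a (at v)) \<le> K" and vw: "v \<in> I" "w \<in> I"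
  shows "norm (a v - a w) \<le> K * \<bar>v - w\<bar>"
proof -
  have "norm (a v - a w) \<le> K * norm (v - w)"
  proof (rule differentiable_bound[where S = I and f' = "\<lambda>x h. h *\<^sub>R vector_derivative a (at x)"])
    show "convex I" using I by (rule is_interval_convex)
    fix x assume x: "x \<in> I"
    have "(a has_vector_derivative vector_derivative a (at x)) (at x)"
      using a by (simp add: C1_differentiable_on_eq vector_derivative_works)
    then show "(a has_derivative (\<lambda>h. h *\<^sub>R vector_derivative a (at x))) (at x within I)"
      unfolding has_vector_derivative_def by (rule has_derivative_at_withinI)
    show "onorm (\<lambda>h. h *\<^sub>R vector_derivative a (at x)) \<le> K"
    proof (rule onorm_le)
      fix h :: real
      have "\<bar>h\<bar> * norm (vector_derivative a (at x)) \<le> \<bar>h\<bar> * K" by (intro mult_left_mono K x) simp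
      then show "norm (h *\<^sub>R vector_derivative a (at x)) \<le> K * norm h" by (simp add: mult.commute)
    qed
  qed (use vw in auto)
  then show ?thesis by simp
qed

lemma AE_lebesgue_on_ball_iff:
  "(AE x in lebesgue_on (ball 0 r). P x) \<longleftrightarrow> (AE x in lborel. x \<in> ball (0::'a::euclidean_space) r \<longrightarrow> P x)"
  by (subst AE_restrict_space_iff) (auto simp: AE_completion_iff)

lemma integral_lebesgue_on_ball:
  fixes f :: "'a::euclidean_space \<Rightarrow> real"
  assumes f: "f \<in> borel_measurable (lebesgue_on (ball 0 r))" and g[measurable]: "g \<in> borel_measurable borel"
    and eq: "AE x in lborel. x \<in> ball 0 r \<longrightarrow> f x = g x" and z: "\<And>x. x \<notin> ball 0 r \<Longrightarrow> g x = 0"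
  shows "(LINT x|lebesgue_on (ball 0 r). f x) = (LINT x|lborel. g x)"
proof -
  have gm: "g \<in> borel_measurable (lebesgue_on (ball 0 r))"
    by (intro measurable_restrict_space1 measurable_completion) simp
  have "(LINT x|lebesgue_on (ball 0 r). f x) = (LINT x|lebesgue_on (ball 0 r). g x)"
    by (rule integral_cong_AE[OF f gm]) (use eq in \<open>simp add: AE_lebesgue_on_ball_iff\<close>)
  also have "\<dots> = (LINT x|lebesgue. indicator (ball 0 r) x *\<^sub>R g x)"
    by (rule integral_restrict_space) simp
  also have "\<dots> = (LINT x|lebesgue. g x)"
    by (intro Bochner_Integration.integral_cong refl) (use z in \<open>auto simp: indicator_def\<close>)
  also have "\<dots> = (LINT x|lborel. g x)" by (rule integral_completion) simp
  finally show ?thesis .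
qed

text \<open>Values outside \<open>J\<close> are reset to \<open>0\<close>, so that what held almost
  everywhere for \<open>u\<close> holds at every point for \<open>u'\<close>, with \<open>0\<close>
  as the only exceptional value.\<close>

lemma Borel_representative:
  fixes u :: "'a::euclidean_space \<Rightarrow> real"
  assumes u: "u \<in> borel_measurable (lebesgue_on (ball 0 r))" and J: "J \<in> sets borel"
    and uJ: "AE x in lebesgue_on (ball 0 r). u x \<in> J"
  obtains u' where "u' \<in> borel_measurable borel" "\<And>x. x \<notin> ball 0 r \<Longrightarrow> u' x = 0" "\<And>x. u' x = 0 \<or> u' x \<in> J"
    "AE x in lborel. x \<in> ball 0 r \<longrightarrow> u x = u' x \<and> u' x \<in> J"
proof -
  have "(\<lambda>x. if x \<in> ball 0 r then u x else 0) \<in> borel_measurable lebesgue"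
    using u by (subst borel_measurable_if) auto
  from completion_ex_borel_measurable_real[OF this]
  obtain g where g: "g \<in> borel_measurable lborel" "AE x in lborel. (if x \<in> ball 0 r then u x else 0) = g x"
    by blast
  have [measurable]: "g \<in> borel_measurable borel" using g(1) by simp
  define u' where "u' x = (if x \<in> ball 0 r \<and> g x \<in> J then g x else 0)" for x
  have [measurable]: "J \<in> sets borel" "ball (0::'a) r \<in> sets borel" using J by auto
  have "u' \<in> borel_measurable borel" unfolding u'_def by measurable
  moreover have "AE x in lborel. x \<in> ball 0 r \<longrightarrow> u x = u' x \<and> u' x \<in> J"
    using g(2) uJ[unfolded AE_lebesgue_on_ball_iff] by eventually_elim (auto simp: u'_def)
  ultimately show ?thesis using that[of u'] by (auto simp: u'_def)
qed

lemma Linf_norm_le_iff: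
  fixes u :: "'a::euclidean_space \<Rightarrow> real"
  assumes "u \<in> borel_measurable (lebesgue_on (ball 0 r))"
  shows "Linf_norm (ball 0 r) u \<le> ereal c \<longleftrightarrow> (AE x in lborel. x \<in> ball 0 r \<longrightarrow> \<bar>u x\<bar> \<le> c)"
proof
  assume "Linf_norm (ball 0 r) u \<le> ereal c"
  then have *: "esssup (lebesgue_on (ball 0 r)) (\<lambda>x. ereal \<bar>u x\<bar>) \<le> ereal c" by (simp add: Linf_norm_def)
  have "AE x in lebesgue_on (ball 0 r). ereal \<bar>u x\<bar> \<le> esssup (lebesgue_on (ball 0 r)) (\<lambda>x. ereal \<bar>u x\<bar>)"
    by (rule esssup_AE)
  then have "AE x in lebesgue_on (ball 0 r). \<bar>u x\<bar> \<le> c"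
    using * by (auto elim!: eventually_mono dest: order_trans)
  then show "AE x in lborel. x \<in> ball 0 r \<longrightarrow> \<bar>u x\<bar> \<le> c" unfolding AE_lebesgue_on_ball_iff .
next
  assume "AE x in lborel. x \<in> ball 0 r \<longrightarrow> \<bar>u x\<bar> \<le> c"
  then have "AE x in lebesgue_on (ball 0 r). ereal \<bar>u x\<bar> \<le> ereal c"
    unfolding AE_lebesgue_on_ball_iff[symmetric] by simp
  moreover have "(\<lambda>x. ereal \<bar>u x\<bar>) \<in> borel_measurable (lebesgue_on (ball 0 r))" using assms by measurable
  ultimately show "Linf_norm (ball 0 r) u \<le> ereal c" unfolding Linf_norm_def by (intro esssup_I)
qed

lemma measurable_lebesgue_on_smaller_ball:
  fixes u :: "'a::euclidean_space \<Rightarrow> real"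
  assumes "u \<in> borel_measurable (lebesgue_on (ball 0 2))"
  shows "u \<in> borel_measurable (lebesgue_on (ball 0 1))"
  by (rule measurable_restrict_mono[OF assms]) auto

lemma content_superlevel_subset:
  fixes I :: "real set" and a :: "real \<Rightarrow> 'a::euclidean_space"
  assumes gn: "genuinely_nonlinear a I \<alpha> C0" and I: "closed I" and a: "continuous_on UNIV a"
    and kl: "{k..l} \<subseteq> I" and \<xi>: "norm \<xi> = 1" "0 < \<eta>"
  shows "measure lborel {v \<in> {k..l}. \<bar>a v \<bullet> \<xi>\<bar> < \<eta>} \<le> C0 * \<eta> powr \<alpha>"
proof -
  have [measurable]: "I \<in> sets borel" "a \<in> borel_measurable borel"
    using I a by (auto intro: borel_measurable_continuous_onI)
  have "emeasure lborel {v \<in> {k..l}. \<bar>a v \<bullet> \<xi>\<bar> < \<eta>} \<le> emeasure lborel {v \<in> I. \<bar>a v \<bullet> \<xi>\<bar> < \<eta>}"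
    by (intro emeasure_mono) (use kl in auto)
  also have "\<dots> \<le> ennreal (C0 * \<eta> powr \<alpha>)"
    using gn \<xi> by (auto simp: genuinely_nonlinear_def)
  finally show ?thesis
    unfolding measure_def using gn by (intro enn2real_leI) (auto simp: genuinely_nonlinear_def)
qed

lemma gradient_zero_outside_support:
  assumes "test_function \<Omega> \<phi>" "\<And>x. GDERIV \<phi> x :> D x" "x \<notin> \<Omega>"
  shows "D x = 0"
proof -
  let ?S = "- closure {x. \<phi> x \<noteq> 0}"
  have x: "x \<in> ?S" using assms(1,3) by (auto simp: test_function_def)
  have S: "open ?S" by auto
  have "((\<lambda>_. 0) has_derivative (\<lambda>h. h \<bullet> 0)) (at x)" by simp
  then have "GDERIV \<phi> x :> 0" unfolding gderiv_def
  proof (rule has_derivative_transform_within_open[OF _ S x])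
    fix y assume "y \<in> ?S"
    then show "0 = \<phi> y" using closure_subset[of "{x. \<phi> x \<noteq> 0}"] by auto
  qed
  with assms(2) show ?thesis using GDERIV_unique by blast
qed

text \<open>This prepares a proof by contradiction. If the bound \<kappa> fails on the unit ball,
  \<open>u'\<close> takes a value in \<open>I\<close> that is at least \<kappa>. As its mass is
  below that of the constant \<kappa>/2, it also takes a value in \<open>I\<close> below \<kappa>/2.
  The interval \<open>I\<close> therefore contains \<open>\<kappa> / 2\<close> and
  \<open>\<kappa>\<close>, which makes \<kappa>/2 an admissible base level even if \<open>0\<close>
  is not in \<open>I\<close>.\<close>

lemma gn_subsolution_representative:
  fixes a :: "real \<Rightarrow> real^'n"
  assumes I: "is_interval I" "closed I" and gn: "genuinely_nonlinear a I \<alpha> C0" and K: "C1_norm a I = ereal K"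
    and sub: "entropy_subsolution a (ball 0 2) u"
    and nn: "AE x in lebesgue_on (ball 0 2). 0 \<le> u x" and uI: "AE x in lebesgue_on (ball 0 2). u x \<in> I"
    and M: "0 \<le> M" "Linf_norm (ball 0 2) u \<le> ereal M" and \<kappa>: "0 < \<kappa>"
    and small: "L1_norm (ball 0 2) u < \<kappa> / 2 * measure lborel (ball (0::real^'n) 2)"
    and large: "\<not> Linf_norm (ball 0 1) u \<le> ereal \<kappa>"
  obtains u' where "gn_subsolution a u' K M (\<kappa> / 2) I C0 \<alpha>" "\<kappa> \<in> I"
    "(LINT x|lborel. u' x) = L1_norm (ball 0 2) u" "measure lborel {x \<in> cball 0 1. \<kappa> \<le> u' x} \<noteq> 0"
proof -
  have um: "u \<in> borel_measurable (lebesgue_on (ball 0 2))" using sub by (simp add: entropy_subsolution_def Linf_def)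
  have uM: "AE x in lebesgue_on (ball 0 2). \<bar>u x\<bar> \<le> M"
    using M(2) unfolding Linf_norm_le_iff[OF um] AE_lebesgue_on_ball_iff .
  define J where "J = I \<inter> {0..M}"
  have J: "J \<in> sets borel" unfolding J_def using I(2) by (intro borel_closed closed_Int) auto
  have uJ: "AE x in lebesgue_on (ball 0 2). u x \<in> J"
    using nn uI uM by eventually_elim (auto simp: J_def)
  obtain u' where u'm[measurable]: "u' \<in> borel_measurable borel" and u'z: "\<And>x. x \<notin> ball 0 2 \<Longrightarrow> u' x = 0"
    and u'J: "\<And>x. u' x = 0 \<or> u' x \<in> J" and u'u: "AE x in lborel. x \<in> ball 0 2 \<longrightarrow> u x = u' x \<and> u' x \<in> J"
    by (rule Borel_representative[OF um J uJ]) blast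
  have u'nn: "0 \<le> u' x" and u'M: "u' x \<le> M" for x using u'J[of x] M(1) by (auto simp: J_def)
  have u'I: "u' x \<in> I" if "0 < u' x" for x using u'J[of x] that by (auto simp: J_def)
  have aC1: "a C1_differentiable_on UNIV" using gn by (simp add: genuinely_nonlinear_def)
  have ac: "continuous_on UNIV a" by (rule C1_differentiable_imp_continuous_on[OF aC1])
  have L1: "L1_norm (ball 0 2) u = (LINT x|lborel. u' x)"
    unfolding L1_norm_def
  proof (rule integral_lebesgue_on_ball)
    show "(\<lambda>x. \<bar>u x\<bar>) \<in> borel_measurable (lebesgue_on (ball 0 2))" using um by measurable
    show "AE x in lborel. x \<in> ball 0 2 \<longrightarrow> \<bar>u x\<bar> = u' x"
      using u'u by eventually_elim (auto simp: J_def)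
  qed (use u'z in auto)
  have pos: "measure lborel {x \<in> cball 0 1. \<kappa> \<le> u' x} \<noteq> 0"
  proof
    let ?E = "{x \<in> cball 0 1. \<kappa> \<le> u' x}"
    assume "measure lborel ?E = 0"
    moreover have "emeasure lborel ?E < \<infinity>"
      by (rule emeasure_bounded_finite) (auto intro: bounded_subset[OF bounded_cball[of 0 1]])
    ultimately have "?E \<in> null_sets lborel"
      by (simp add: null_sets_def emeasure_eq_ennreal_measure top.not_eq_extremum)
    then have "AE x in lborel. x \<notin> ?E" by (rule AE_not_in)
    then have "AE x in lborel. x \<in> ball 0 1 \<longrightarrow> \<bar>u x\<bar> \<le> \<kappa>"
      using u'u by eventually_elim (auto simp: J_def)
    with large show False unfolding Linf_norm_le_iff[OF measurable_lebesgue_on_smaller_ball[OF um]] by blast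
  qed
  then obtain x1 where x1: "\<kappa> \<le> u' x1" by (metis (no_types, lifting) Collect_empty_eq measure_empty)
  have x1I: "u' x1 \<in> I" by (rule u'I) (use x1 \<kappa> in linarith)
  have "\<exists>x0. u' x0 \<in> I \<and> u' x0 < \<kappa> / 2"
  proof (rule ccontr)
    assume *: "\<not> (\<exists>x0. u' x0 \<in> I \<and> u' x0 < \<kappa> / 2)"
    have iu: "integrable lborel u'"
    proof (rule integrable_bounded_support[where C = M and R = 2])
      show "norm (u' x) \<le> M" for x using u'nn[of x] u'M[of x] by simp
    qed (use u'z in auto)
    have fin: "emeasure lborel (ball (0::real^'n) 2) < \<infinity>" by (rule emeasure_bounded_finite) simp
    have "\<kappa> / 2 * measure lborel (ball (0::real^'n) 2) = (LINT x|lborel. \<kappa> / 2 * indicator (ball (0::real^'n) 2) x)"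
      by simp
    also have "\<dots> \<le> (LINT x|lborel. u' x)"
    proof (rule integral_mono_AE[OF _ iu])
      show "integrable lborel (\<lambda>x. \<kappa> / 2 * indicator (ball (0::real^'n) 2) x :: real)"
        using fin by (intro integrable_mult_right integrable_real_indicator) auto
      show "AE x in lborel. \<kappa> / 2 * indicator (ball 0 2) x \<le> u' x"
        using u'u
      proof eventually_elim
        case (elim x)
        then show ?case using * u'nn[of x] by (cases "x \<in> ball 0 2") (auto simp: J_def not_less)
      qed
    qed
    finally show False using small L1 by simp
  qed
  then obtain x0 where x0: "u' x0 \<in> I" "u' x0 < \<kappa> / 2" by blast
  have \<kappa>I: "\<kappa> \<in> I" "\<kappa> / 2 \<in> I"
    using mem_is_interval_1_I[OF I(1) x0(1) x1I] x0(2) x1 \<kappa> by auto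
  have "gn_subsolution a u' K M (\<kappa> / 2) I C0 \<alpha>"
  proof
    show "continuous_on UNIV a" by (rule ac)
    show "u' \<in> borel_measurable borel" by (rule u'm)
    show "0 \<le> u' x" "u' x \<le> M" for x by (rule u'nn u'M)+
    show "u' x = 0" if "2 \<le> norm x" for x using u'z that by simp
    show "is_interval I" by (rule I(1))
    show "\<kappa> / 2 \<in> I" "0 \<le> \<kappa> / 2" using \<kappa>I \<kappa> by auto
    show "u' x \<in> I" if "\<kappa> / 2 < u' x" for x using u'I that \<kappa> by auto
    show "norm (a v) \<le> K" if "v \<in> I" for v by (rule C1_norm_bounds(1)[OF K that])
    show "norm (a v - a w) \<le> K * \<bar>v - w\<bar>" if "v \<in> I" "w \<in> I" for v w
      by (rule C1_Lipschitz[OF aC1 I(1) C1_norm_bounds(2)[OF K] that])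
    show "0 < \<alpha>" "\<alpha> \<le> 1" "0 < C0" using gn by (auto simp: genuinely_nonlinear_def)
    show "measure lborel {v \<in> {k..l}. \<bar>a v \<bullet> \<xi>\<bar> < \<eta>} \<le> C0 * \<eta> powr \<alpha>"
      if "\<kappa> / 2 \<le> k" "l \<in> I" "norm \<xi> = 1" "0 < \<eta>" for k l \<xi> \<eta>
    proof (rule content_superlevel_subset[OF gn I(2) ac _ that(3,4)])
      show "{k..l} \<subseteq> I" using mem_is_interval_1_I[OF I(1) \<kappa>I(2) that(2)] that(1) by auto
    qed
    fix k :: real and \<phi> :: "real^'n \<Rightarrow> real" and D\<phi> :: "real^'n \<Rightarrow> real^'n"
    assume \<phi>: "test_function (ball 0 2) \<phi>" "\<And>x. 0 \<le> \<phi> x" "\<And>x. GDERIV \<phi> x :> D\<phi> x"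
    let ?\<eta> = "\<lambda>v::real. max 0 (v - k)" and ?q = "\<lambda>v. LINT t|lborel. indicator {k..v} t *\<^sub>R a t"
    have flux: "entropy_flux a ?\<eta> ?q" by (rule entropy_flux_pos_part[OF ac])
    have "mono ?\<eta>" by (auto simp: mono_def)
    then have "0 \<le> (LINT x|lebesgue_on (ball 0 2). ?q (u x) \<bullet> D\<phi> x)"
      using sub flux \<phi> convex_on_pos_part[of k] unfolding entropy_subsolution_def by blast
    also have "\<dots> = (LINT x|lborel. ?q (u' x) \<bullet> D\<phi> x)"
    proof (rule integral_lebesgue_on_ball)
      have qc: "continuous_on UNIV ?q" using flux by (simp add: entropy_flux_def)
      have [measurable]: "?q \<in> borel_measurable borel" by (rule borel_measurable_continuous_onI[OF qc])
      obtain Y where Y: "\<And>x. GDERIV \<phi> x :> Y x" "\<And>k i. C_k k (\<lambda>x. Y x $ i)"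
        using smooth_gradient[of \<phi>] \<phi>(1) unfolding test_function_def by blast
      have "D\<phi> = Y" using GDERIV_unique \<phi>(3) Y(1) by blast
      then have "continuous_on UNIV D\<phi>" using continuous_on_smooth[OF Y(2)] by simp
      then have [measurable]: "D\<phi> \<in> borel_measurable borel" by (rule borel_measurable_continuous_onI)
      have Dm: "D\<phi> \<in> borel_measurable (lebesgue_on (ball 0 2))"
        by (intro measurable_restrict_space1 measurable_completion) simp
      have qm: "(\<lambda>x. ?q (u x)) \<in> borel_measurable (lebesgue_on (ball 0 2))"
        by (rule measurable_compose[OF um]) measurable
      show "(\<lambda>x. ?q (u x) \<bullet> D\<phi> x) \<in> borel_measurable (lebesgue_on (ball 0 2))"
        by (rule borel_measurable_inner[OF qm Dm])
      show "(\<lambda>x. ?q (u' x) \<bullet> D\<phi> x) \<in> borel_measurable borel"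
        by (rule borel_measurable_inner[OF measurable_compose[OF u'm]]) measurable
      show "AE x in lborel. x \<in> ball 0 2 \<longrightarrow> ?q (u x) \<bullet> D\<phi> x = ?q (u' x) \<bullet> D\<phi> x"
        using u'u by eventually_elim auto
      show "?q (u' x) \<bullet> D\<phi> x = 0" if "x \<notin> ball 0 2" for x
        using gradient_zero_outside_support[OF \<phi>(1,3) that] by simp
    qed
    finally show "0 \<le> (LINT x|lborel. ?q (u' x) \<bullet> D\<phi> x)" .
  qed
  with \<kappa>I(1) L1 pos that show ?thesis by simp
qed

theorem theorem6p1:
  fixes \<alpha> :: real
  assumes "0 < \<alpha>" and "\<alpha> \<le> 1"
  shows "\<exists>\<gamma>>0. \<forall>C\<^sub>0 K M :: real. 0 < C\<^sub>0 \<and> 0 \<le> K \<and> 0 \<le> M \<longrightarrow>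
    (\<exists>C::real. \<forall>(a :: real \<Rightarrow> real^'n) I u.
       is_interval I \<and> closed I \<and> genuinely_nonlinear a I \<alpha> C\<^sub>0 \<and> C1_norm a I = ereal K \<and>
       entropy_subsolution a (ball 0 2) u \<and>
       (AE x in lebesgue_on (ball 0 2). 0 \<le> u x) \<and>
       (AE x in lebesgue_on (ball 0 2). u x \<in> I) \<and>
       Linf_norm (ball 0 2) u \<le> ereal M \<longrightarrow>
       Linf_norm (ball 0 1) u \<le> ereal (C * L1_norm (ball 0 2) u powr \<gamma>))"
proof -
  obtain C1 where grad: "0 < C1" "\<And>(h::real^'n \<Rightarrow> real) \<sigma> x D. integrable lborel h \<Longrightarrow> (\<And>y. \<bar>h y\<bar> \<le> 1) \<Longrightarrow>
      0 < \<sigma> \<Longrightarrow> GDERIV (mollify h \<sigma>) x :> D \<Longrightarrow> norm D \<le> C1 / \<sigma>"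
    using mollify_gradient by blast
  obtain C2 where sup: "0 < C2" "\<And>(h::real^'n \<Rightarrow> real) \<sigma> x. integrable lborel h \<Longrightarrow> 0 < \<sigma> \<Longrightarrow>
      \<bar>mollify h \<sigma> x\<bar> \<le> C2 / \<sigma> ^ CARD('n) * (LINT y|lborel. \<bar>h y\<bar>)"
    using mollify_le_integral by blast
  \<comment> \<open>This is \<open>iter_exp\<close> written out in \<alpha> and the dimension,
    because \<gamma>, the inverse of the exponent in \<open>level_vanishes\<close>, has to be fixed
    before all other data.\<close>
  define e where "e = \<alpha> / (2 * 2 ^ CARD('n)) / (2 * real (8 * (CARD('n) + 1) * CARD('n)))"
  have e: "0 < e" unfolding e_def using assms(1) by (intro divide_pos_pos) auto
  define \<gamma> where "\<gamma> = 1 / (1 + 3 / e)"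
  have e3: "0 < 1 + 3 / e" using e by (intro add_pos_pos) auto
  have \<gamma>: "0 < \<gamma>" "\<gamma> * (1 + 3 / e) = 1" using e3 by (auto simp: \<gamma>_def)
  define V where "V = measure lborel (ball (0::real^'n) 2)"
  have V: "0 < V" unfolding V_def by (rule content_ball_pos) simp
  show ?thesis
  proof (rule exI[of _ \<gamma>], intro conjI \<gamma>(1) allI impI)
    fix C0 K M :: real
    assume CKM: "0 < C0 \<and> 0 \<le> K \<and> 0 \<le> M"
    \<comment> \<open>Outside its locale the constant shows its true parameters: it involves neither
      \<open>a\<close>, \<open>I\<close> nor \<open>u\<close>, so it may be chosen before
      them.\<close>
    define c where "c = gn_subsolution.vanish_const TYPE('n) K M C0 \<alpha> C1 C2"
    \<comment> \<open>The first summand gives c Z \<ge> 1, hence the smallness hypothesis of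
      \<open>level_vanishes\<close>; the second makes the mass smaller than that of \<kappa>/2 on
      the ball; the third gives strictness. The absolute value keeps \<open>Z\<close> positive
      already here, where the sign of \<open>c\<close> is not yet available.\<close>
    define Z where "Z = \<bar>1 / c\<bar> + 2 * M powr (3 / e) / V + 1"
    have Z: "0 < Z" unfolding Z_def using V by (intro add_nonneg_pos add_nonneg_nonneg) auto
    show "\<exists>C. \<forall>(a :: real \<Rightarrow> real^'n) I u.
       is_interval I \<and> closed I \<and> genuinely_nonlinear a I \<alpha> C0 \<and> C1_norm a I = ereal K \<and>
       entropy_subsolution a (ball 0 2) u \<and>
       (AE x in lebesgue_on (ball 0 2). 0 \<le> u x) \<and>
       (AE x in lebesgue_on (ball 0 2). u x \<in> I) \<and>
       Linf_norm (ball 0 2) u \<le> ereal M \<longrightarrow>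
       Linf_norm (ball 0 1) u \<le> ereal (C * L1_norm (ball 0 2) u powr \<gamma>)"
    proof (rule exI[of _ "Z powr \<gamma>"], intro allI impI, elim conjE)
      fix a :: "real \<Rightarrow> real^'n" and I u
      assume I: "is_interval I" "closed I" and gn: "genuinely_nonlinear a I \<alpha> C0" and K: "C1_norm a I = ereal K"
        and sub: "entropy_subsolution a (ball 0 2) u"
        and nn: "AE x in lebesgue_on (ball 0 2). 0 \<le> u x" and uI: "AE x in lebesgue_on (ball 0 2). u x \<in> I"
        and M: "Linf_norm (ball 0 2) u \<le> ereal M"
      have um: "u \<in> borel_measurable (lebesgue_on (ball 0 2))" using sub by (simp add: entropy_subsolution_def Linf_def)
      note um1 = measurable_lebesgue_on_smaller_ball[OF um]
      have uM: "AE x in lborel. x \<in> ball 0 2 \<longrightarrow> \<bar>u x\<bar> \<le> M" using M unfolding Linf_norm_le_iff[OF um] .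
      have smaller: "Linf_norm (ball 0 1) u \<le> ereal b" if "AE x in lborel. x \<in> ball 0 2 \<longrightarrow> \<bar>u x\<bar> \<le> b" for b
        unfolding Linf_norm_le_iff[OF um1] using that by eventually_elim auto
      define \<theta> where "\<theta> = L1_norm (ball 0 2) u"
      define \<kappa> where "\<kappa> = Z powr \<gamma> * \<theta> powr \<gamma>"
      have \<theta>0: "0 \<le> \<theta>" unfolding \<theta>_def L1_norm_def by simp
      have "Linf_norm (ball 0 1) u \<le> ereal \<kappa>"
      proof (cases "M \<le> \<kappa>")
        case True
        then show ?thesis by (intro smaller) (use uM in \<open>auto elim!: eventually_mono\<close>)
      next
        case MK: False
        show ?thesis
        \<comment> \<open>For zero mass \<open>0 powr \<gamma> = 0\<close>, so the claim is that
          \<open>u\<close> vanishes almost everywhere.\<close>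
        proof (cases "\<theta> = 0")
          case True
          have iu: "integrable (lebesgue_on (ball 0 2)) (\<lambda>x. \<bar>u x\<bar>)"
          proof (rule finite_measure.integrable_const_bound[where B = M])
            show "finite_measure (lebesgue_on (ball (0::real^'n) 2))"
              by (rule finite_measure_lebesgue_on) (simp add: lmeasurable_ball)
            show "AE x in lebesgue_on (ball 0 2). norm \<bar>u x\<bar> \<le> M" using uM by (simp add: AE_lebesgue_on_ball_iff)
          qed (use um in measurable)
          have "AE x in lebesgue_on (ball 0 2). \<bar>u x\<bar> = 0"
            using integral_nonneg_eq_0_iff_AE[OF iu] True by (simp add: \<theta>_def L1_norm_def)
          then have "AE x in lborel. x \<in> ball 0 2 \<longrightarrow> \<bar>u x\<bar> = 0" unfolding AE_lebesgue_on_ball_iff .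
          then show ?thesis by (intro smaller) (auto simp: \<kappa>_def elim!: eventually_mono)
        next
          case False
          with \<theta>0 have \<theta>: "0 < \<theta>" by simp
          have \<kappa>: "0 < \<kappa>" unfolding \<kappa>_def using \<theta> Z by simp
          have \<kappa>p: "\<kappa> powr (1 + 3 / e) = Z * \<theta>"
            unfolding \<kappa>_def using Z \<theta> \<gamma>(2) by (simp add: powr_mult powr_powr)
          have \<kappa>M: "\<kappa> < M" using MK by simp
          \<comment> \<open>Bounding all but one power of \<kappa> by \<open>M\<close> turns the
            definition of \<kappa> into a linear bound of \<theta> by \<kappa>, which is the mass
            condition \<open>small\<close>.\<close>
          have "Z * \<theta> = \<kappa> * \<kappa> powr (3 / e)" using \<kappa> by (simp add: \<kappa>p[symmetric] powr_add)
          also have "\<dots> \<le> \<kappa> * M powr (3 / e)" using \<kappa> \<kappa>M e by (intro mult_left_mono powr_mono2) auto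
          finally have up: "Z * \<theta> \<le> \<kappa> * M powr (3 / e)" .
          have Mp: "0 < M powr (3 / e)" using \<kappa> \<kappa>M by simp
          have "2 * M powr (3 / e) / V < Z" unfolding Z_def by (simp add: add_nonneg_pos)
          then have "2 * M powr (3 / e) / V * \<theta> < Z * \<theta>" using \<theta> by (rule mult_strict_right_mono)
          with up have "(2 / V * \<theta>) * M powr (3 / e) < \<kappa> * M powr (3 / e)" by (simp add: mult_ac)
          then have "2 / V * \<theta> < \<kappa>" using Mp by (simp only: mult_less_cancel_right_pos)
          then have small: "\<theta> < \<kappa> / 2 * V" using V by (simp add: field_simps)
          show ?thesis
          proof (rule ccontr)
            assume "\<not> Linf_norm (ball 0 1) u \<le> ereal \<kappa>"
            from gn_subsolution_representative[OF I gn K sub nn uI _ M \<kappa> small[unfolded \<theta>_def V_def] this] CKM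
            obtain u' where u': "gn_subsolution a u' K M (\<kappa> / 2) I C0 \<alpha>" "\<kappa> \<in> I"
              "(LINT x|lborel. u' x) = \<theta>" "measure lborel {x \<in> cball 0 1. \<kappa> \<le> u' x} \<noteq> 0"
              unfolding \<theta>_def by blast
            interpret gn_subsolution a u' K M "\<kappa> / 2" I C0 \<alpha> by (rule u'(1))
            have ie: "iter_exp = e"
              unfolding iter_exp_def step_exp_def gain_exp_def scale_exp_def e_def by simp
            have "0 < c" unfolding c_def by (rule vanish_const_pos[OF grad(1) sup(1)])
            have "1 / c \<le> Z" unfolding Z_def using \<open>0 < c\<close> V by simp
            then have "1 \<le> c * Z" using \<open>0 < c\<close> by (simp add: field_simps)
            then have "1 * \<theta> \<le> c * Z * \<theta>" by (rule mult_right_mono) (rule \<theta>0)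
            then have "(LINT x|lborel. u' x) \<le> vanish_const C1 C2 * \<kappa> powr (1 + 3 / iter_exp)"
              unfolding ie \<kappa>p u'(3) c_def[symmetric] by (simp add: mult.assoc)
            from level_vanishes[OF grad sup \<kappa> _ u'(2) _ this] \<kappa>M
            have "level \<kappa> 1 = 0" by simp
            with u'(4) show False by (simp add: level_def)
          qed
        qed
      qed
      then show "Linf_norm (ball 0 1) u \<le> ereal (Z powr \<gamma> * L1_norm (ball 0 2) u powr \<gamma>)"
        by (simp add: \<kappa>_def \<theta>_def)
    qed
  qed
qed

end
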